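(* For every $\lambda\in(0,1)$ there exists a choice of densities $(f_n)_{n\in\mathbb{N}}$ on $\mathbb{R}$ such that, with $f_n=\mathbf{1}_{(0,1)}$ for all integers $n<0$, the two-sided Bernoulli shift $\big(\mathbb{R}^{\mathbb{Z}},\mathcal{B},\bigotimes_{n\in\mathbb{Z}}f_n\big)$ is of type-$\mathrm{III}_\lambda$.
   Context: $\mathbb{N}=\{0,1,2,\dots\}$. A density is a measurable $f:\mathbb{R}\to[0,\infty)$ with $\int_{\mathbb{R}} f(u)\,du=1$; it is identified with the probability measure $E\mapsto\int_E f(u)\,du$. The two-sided Bernoulli shift on $A$ associated with probability measures $(\rho_n)_{n\in\mathbb{Z}}$ on $A$ is the product probability space $(A^{\mathbb{Z}},\mathcal{B},\bigotimes_{n\in\mathbb{Z}}\rho_n)$ ($\mathcal{B}$ the product Borel sigma-algebra) with the left-shift $(Ta)_i=a_{i+1}$. An action $(T_g)_{g\in G}$ of a countable group on a $\sigma$-finite measure space $(\Omega,\mathcal{F},\mu)$ is nonsingular if $\mu\circ T_g\sim\mu$ (same null sets) for all $g$; it is ergodic if every $E\in\mathcal{F}$ with $\mu(E\triangle T_g(E))=0$ for all $g\in G$ satisfies $\mu(E)=0$ or $\mu(E^c)=0$. An invertible nonsingular map $T$ is regarded as the $\mathbb{Z}$-action $(T^n)_{n\in\mathbb{Z}}$. For an ergodic nonsingular action, $r\in\mathbb{R}$ is an essential value if for all $A\in\mathcal{F}$ with $\mu(A)>0$ and all $\epsilon>0$ there is $g\in G$ with $\mu\big(A\cap T_g^{-1}A\cap\{|\log\frac{d\mu\circ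 T_g}{d\mu}-r|<\epsilon\}\big)>0$. The Krieger ratio set $e(T)$ is the set of all essential values. For $0<\lambda<1$, the action is of type-$\mathrm{III}_\lambda$ if it is nonsingular, ergodic and $e(T)=\{n\log\lambda:n\in\mathbb{Z}\}$. *)

theory Defs
  imports "HOL-Probability.Probability"
begin

definition prob_density :: "(real \<Rightarrow> real) \<Rightarrow> bool" where
  "prob_density f \<longleftrightarrow>
     f \<in> borel_measurable borel \<and> (\<forall>u. 0 \<le> f u) \<and> (\<integral>u. f u \<partial>lborel) = 1"

definition density_measure :: "(real \<Rightarrow> real) \<Rightarrow> real measure" where
  "density_measure f = density lborel (\<lambda>u. ennreal (f u))"

definition measurable_action ::
    "'a measure \<Rightarrow> ('g::{group_add,countable} \<Rightarrow> 'a \<Rightarrow> 'a) \<Rightarrow> bool" where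
  "measurable_action M T \<longleftrightarrow>
     (\<forall>g. T g \<in> measurable M M) \<and>
     (\<forall>x\<in>space M. T 0 x = x) \<and>
     (\<forall>g h. \<forall>x\<in>space M. T (g + h) x = T g (T h x))"

(* The measure E |-> mu (T_g E). Since T_g is invertible with inverse T_(-g), this is the
   push-forward of mu under T_(-g). *)
definition translated_measure ::
    "'a measure \<Rightarrow> ('g::{group_add,countable} \<Rightarrow> 'a \<Rightarrow> 'a) \<Rightarrow> 'g \<Rightarrow> 'a measure" where
  "translated_measure M T g = distr M M (T (- g))"

lemma emeasure_translated_measure:
  assumes act: "measurable_action M T" and E: "E \<in> sets M"
  shows "emeasure (translated_measure M T g) E = emeasure M (T g ` E)"
proof -
  have m: "T h \<in> measurable M M" for h
    using act by (simp add: measurable_action_def)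
  have inv1: "T g (T (- g) x) = x" and inv2: "T (- g) (T g x) = x" if "x \<in> space M" for x
    using act that unfolding measurable_action_def
    by (metis right_minus, metis left_minus)
  have "T (- g) -` E \<inter> space M = T g ` E"
  proof (intro equalityI subsetI)
    fix x assume "x \<in> T (- g) -` E \<inter> space M"
    then show "x \<in> T g ` E"
      using inv1[of x] by (metis IntE imageI vimageE)
  next
    fix x assume "x \<in> T g ` E"
    then show "x \<in> T (- g) -` E \<inter> space M"
      using inv2 sets.sets_into_space[OF E] measurable_space[OF m[of g]] by auto
  qed
  then show ?thesis
    by (simp add: translated_measure_def emeasure_distr[OF m E])
qed

definition nonsingular_action ::
    "'a measure \<Rightarrow> ('g::{group_add,countable} \<Rightarrow> 'a \<Rightarrow> 'a) \<Rightarrow> bool" where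
  "nonsingular_action M T \<longleftrightarrow>
     sigma_finite_measure M \<and> measurable_action M T \<and>
     (\<forall>g. null_sets (translated_measure M T g) = null_sets M)"

definition ergodic_action ::
    "'a measure \<Rightarrow> ('g::{group_add,countable} \<Rightarrow> 'a \<Rightarrow> 'a) \<Rightarrow> bool" where
  "ergodic_action M T \<longleftrightarrow>
     (\<forall>E\<in>sets M. (\<forall>g. emeasure M (sym_diff E (T g ` E)) = 0) \<longrightarrow>
        emeasure M E = 0 \<or> emeasure M (space M - E) = 0)"

(* For nonsingular actions the Radon-Nikodym derivative is positive and finite almost
   everywhere, so the values of ln and enn2real at 0 and infinity play no role. *)
definition essential_value ::
    "'a measure \<Rightarrow> ('g::{group_add,countable} \<Rightarrow> 'a \<Rightarrow> 'a) \<Rightarrow> real \<Rightarrow> bool" where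
  "essential_value M T r \<longleftrightarrow>
     (\<forall>A\<in>sets M. emeasure M A > 0 \<longrightarrow> (\<forall>\<epsilon>>0. \<exists>g.
        emeasure M {x \<in> space M. x \<in> A \<and> T g x \<in> A \<and>
          \<bar>ln (enn2real (RN_deriv M (translated_measure M T g) x)) - r\<bar> < \<epsilon>} > 0))"

definition krieger_ratio_set ::
    "'a measure \<Rightarrow> ('g::{group_add,countable} \<Rightarrow> 'a \<Rightarrow> 'a) \<Rightarrow> real set" where
  "krieger_ratio_set M T = {r. essential_value M T r}"

definition type_III_action ::
    "real \<Rightarrow> 'a measure \<Rightarrow> ('g::{group_add,countable} \<Rightarrow> 'a \<Rightarrow> 'a) \<Rightarrow> bool" where
  "type_III_action l M T \<longleftrightarrow>
     0 < l \<and> l < 1 \<and> nonsingular_action M T \<and> ergodic_action M T \<and>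
     krieger_ratio_set M T = {of_int n * ln l | n :: int. True}"

(* The family of integer powers of T. For T a bijection of the space of M with
   measurable inverse it is an action of the integers. *)
definition powers_action :: "'a measure \<Rightarrow> ('a \<Rightarrow> 'a) \<Rightarrow> int \<Rightarrow> 'a \<Rightarrow> 'a" where
  "powers_action M T n =
     (if 0 \<le> n then T ^^ nat n else inv_into (space M) T ^^ nat (- n))"

definition bernoulli_space :: "(int \<Rightarrow> 'a measure) \<Rightarrow> (int \<Rightarrow> 'a) measure" where
  "bernoulli_space \<rho> = PiM UNIV \<rho>"

definition left_shift :: "(int \<Rightarrow> 'a) \<Rightarrow> int \<Rightarrow> 'a" where
  "left_shift a = (\<lambda>i. a (i + 1))"

definition bernoulli_shift_type_III :: "real \<Rightarrow> (int \<Rightarrow> 'a measure) \<Rightarrow> bool" where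
  "bernoulli_shift_type_III l \<rho> \<longleftrightarrow>
     type_III_action l (bernoulli_space \<rho>) (powers_action (bernoulli_space \<rho>) left_shift)"

end

theory Submission
  imports Defs
begin

text \<open>For \<open>k \<ge> 0\<close> let \<open>f\<^sub>k\<close> be \<open>l\<close> on \<open>(0, a\<^sub>k)\<close>, \<open>1 / l\<close> on
  \<open>(1 - l a\<^sub>k, 1)\<close> and \<open>1\<close> elsewhere on \<open>(0, 1)\<close>, where \<open>a\<^sub>k = l\<^sup>5 / (8 (k + 1))\<close>. As \<open>a\<close> is
  decreasing, the sets where \<open>f\<^bsub>k-n\<^esub>\<close> and \<open>f\<^sub>k\<close> differ have summable measure. So for almost every
  \<open>x\<close> only finitely many factors of the Radon-Nikodym derivative
  \<open>\<Prod>\<^sub>k f\<^bsub>k-n\<^esub>(x\<^sub>k) / f\<^sub>k(x\<^sub>k)\<close> of \<open>T\<^sup>n\<close> differ from \<open>1\<close>, and it is \<open>l\<close> to an integer power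
  \<open>c\<^sub>n(x)\<close>. This bounds the ratio set from above. Everything else follows once the Maharam
  extension \<open>(x, j) \<mapsto> (T x, j + c\<^sub>1(x))\<close>, which preserves an infinite measure, is ergodic.

  The constant in \<open>a\<^sub>k\<close> is so small that \<open>l\<^bsup>-2|c\<^sub>n|\<^esup>\<close> has integral \<open>O(\<surd>n)\<close>. Hence, by the
  inequality between the harmonic and the arithmetic mean, \<open>\<Sum>\<^sub>n l\<^bsup>2|c\<^sub>n|\<^esup>\<close> diverges almost
  everywhere, and so the ergodic sums of the integrable function \<open>h(x, j) = l\<^bsup>2|j|\<^esup>\<close> diverge.
  Let \<open>W\<close> be an invariant set and \<open>A\<close> a set depending on finitely many coordinates that
  approximates \<open>W\<close> with respect to \<open>h\<close>. By the maximal inequality the ratios of the Abel sums of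
  \<open>h 1\<^sub>A\<close> and \<open>h\<close> are close to \<open>1\<^sub>W\<close>, uniformly in the discount factor \<open>r < 1\<close>. As \<open>r\<close> tends to
  \<open>1\<close>, the ratios forget any finite part of the orbit. Thus membership in \<open>W\<close> does not change if
  finitely many coordinates of \<open>x\<close> are resampled and \<open>j\<close> is corrected accordingly. As
  \<open>\<Sum> a\<^sub>k = \<infinity>\<close>, resampling a block of far coordinates changes \<open>j\<close> by one with probability bounded
  below, so \<open>W\<close> does not depend on \<open>j\<close>. By Kolmogorov's argument it is trivial.\<close>

section \<open>Approximation and Abel means\<close>

text \<open>The sets that members of \<open>G\<close> approximate in measure are closed under
  complements and countable unions: a countable union is first cut off at a finite stage, then its
  finitely many pieces are approximated one by one.\<close>

lemma sets_approximation:
  assumes fin: "finite_measure N"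
    and alg: "\<And>A. A \<in> G \<Longrightarrow> space N - A \<in> G" "\<And>A B. A \<in> G \<Longrightarrow> B \<in> G \<Longrightarrow> A \<union> B \<in> G" "{} \<in> G"
    and G: "G \<subseteq> sets N" and W: "W \<in> sigma_sets (space N) G" and d: "0 < d"
  shows "\<exists>A\<in>G. measure N (sym_diff W A) < d"
proof -
  interpret finite_measure N by fact
  have S: "sigma_sets (space N) G \<subseteq> sets N"
    using G by (rule sets.sigma_sets_subset)
  show ?thesis
    using W d
  proof (induction arbitrary: d)
    case (Basic a)
    then show ?case by (intro bexI[of _ a]) auto
  next
    case Empty
    then show ?case using alg(3) by (intro bexI[of _ "{}"]) auto
  next
    case (Compl a)
    then obtain A where A: "A \<in> G" "measure N (sym_diff a A) < d" by blast
    have "a \<subseteq> space N" "A \<subseteq> space N"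
      using Compl(1) S A(1) G sets.sets_into_space by blast+
    then have "sym_diff (space N - a) (space N - A) = sym_diff a A" by auto
    then show ?case using A alg(1) by (intro bexI[of _ "space N - A"]) auto
  next
    case (Union a)
    have a: "a i \<in> sets N" for i using Union(1) S by blast
    define U where "U n = (\<Union>i<n. a i)" for n
    have U: "U n \<in> sets N" for n using a by (auto simp: U_def)
    have "(\<lambda>n. measure N (U n)) \<longlonglongrightarrow> measure N (\<Union>n. U n)"
      using U by (intro finite_Lim_measure_incseq) (fastforce simp: incseq_def U_def intro: less_le_trans)+
    moreover have "(\<Union>n. U n) = (\<Union>i. a i)" by (auto simp: U_def)
    ultimately have "eventually (\<lambda>n. measure N (\<Union>i. a i) - d/2 < measure N (U n)) sequentially"
      using Union(3) by (intro order_tendstoD) auto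
    then obtain n where n: "measure N (\<Union>i. a i) - d/2 < measure N (U n)"
      by (auto simp: eventually_sequentially)
    have 1: "measure N ((\<Union>i. a i) - U n) < d/2"
      using n a U by (subst finite_measure_Diff) (auto simp: U_def)
    \<comment> \<open>Each of the \<open>n\<close> pieces may cost \<open>e\<close>, in total at
      most \<open>d / 2\<close>; the \<open>+ 1\<close> keeps \<open>e\<close> positive for
      \<open>n = 0\<close>.\<close>
    define e where "e = d / (2 * (n+1))"
    have "e > 0" using Union(3) by (simp add: e_def)
    with Union(2) obtain A where A: "\<And>i. A i \<in> G" "\<And>i. measure N (sym_diff (a i) (A i)) < e"
      by metis
    have As: "A i \<in> sets N" for i using A(1) G by blast
    have UA: "(\<Union>i<m. A i) \<in> G" for m
      by (induction m) (auto simp: lessThan_Suc intro: alg A)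
    have "measure N (sym_diff (\<Union>i. a i) (\<Union>i<n. A i))
        \<le> measure N (((\<Union>i. a i) - U n) \<union> (\<Union>i<n. sym_diff (a i) (A i)))"
      using a As by (intro finite_measure_mono) (auto simp: U_def)
    also have "\<dots> \<le> measure N ((\<Union>i. a i) - U n) + measure N (\<Union>i<n. sym_diff (a i) (A i))"
      using a As U by (intro measure_Un_le) auto
    also have "measure N (\<Union>i<n. sym_diff (a i) (A i)) \<le> (\<Sum>i<n. measure N (sym_diff (a i) (A i)))"
      using a As by (intro finite_measure_subadditive_finite) auto
    also have "\<dots> \<le> (\<Sum>i<n. e)" by (intro sum_mono less_imp_le A)
    also have "\<dots> = n * e" by simp
    also have "n * e \<le> d / 2"
      using Union(3) by (simp add: e_def divide_simps)
    finally have "measure N (sym_diff (\<Union>i. a i) (\<Union>i<n. A i)) < d" using 1 by linarith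
    then show ?case using UA by blast
  qed
qed

section \<open>Abel sums of bounded sequences\<close>

definition abel_sum :: "real \<Rightarrow> (nat \<Rightarrow> real) \<Rightarrow> real" where
  "abel_sum r p = (\<Sum>n. r ^ n * p n)"

lemma abel_summable:
  fixes p :: "nat \<Rightarrow> real"
  assumes r: "0 \<le> r" "r < 1" and p: "\<And>n. \<bar>p n\<bar> \<le> C"
  shows "summable (\<lambda>n. r ^ n * p n)"
proof (rule summable_comparison_test')
  show "summable (\<lambda>n. r ^ n * C)"
    using r by (intro summable_mult2 summable_geometric) auto
  show "norm (r ^ n * p n) \<le> r ^ n * C" if "n \<ge> 0" for n
    using r p[of n] by (auto simp: abs_mult intro!: mult_left_mono)
qed

text \<open>This one-step recursion is the reason for discounting: along an orbit it reduces the
  maximal inequality to a single integration.\<close>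

lemma abel_sum_split:
  assumes "0 \<le> r" "r < 1" "\<And>n. \<bar>p n\<bar> \<le> C"
  shows "abel_sum r p = p 0 + r * abel_sum r (\<lambda>n. p (Suc n))"
proof -
  have "abel_sum r p = r ^ 0 * p 0 + (\<Sum>n. r ^ Suc n * p (Suc n))"
    unfolding abel_sum_def by (subst suminf_split_head[OF abel_summable[OF assms]]) auto
  also have "(\<Sum>n. r ^ Suc n * p (Suc n)) = r * abel_sum r (\<lambda>n. p (Suc n))"
    unfolding abel_sum_def
    using suminf_mult[OF abel_summable[OF assms(1,2), of "\<lambda>n. p (Suc n)" C], of r] assms(3)
    by (simp add: mult.assoc)
  finally show ?thesis by simp
qed

lemma abel_sum_mono:
  assumes "0 \<le> r" "r < 1" "\<And>n. \<bar>p n\<bar> \<le> C" "\<And>n. \<bar>q n\<bar> \<le> C" "\<And>n. p n \<le> q n"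
  shows "abel_sum r p \<le> abel_sum r q"
  unfolding abel_sum_def using assms
  by (intro suminf_le abel_summable[of _ _ C] mult_left_mono) auto

lemma abel_sum_diff:
  assumes "0 \<le> r" "r < 1" "\<And>n. \<bar>p n\<bar> \<le> C" "\<And>n. \<bar>q n\<bar> \<le> C"
  shows "abel_sum r (\<lambda>n. p n - q n) = abel_sum r p - abel_sum r q"
  unfolding abel_sum_def right_diff_distrib
  using assms by (intro suminf_diff[symmetric] abel_summable[of _ _ C]) auto

lemma abel_sum_cmult:
  assumes "0 \<le> r" "r < 1" "\<And>n. \<bar>p n\<bar> \<le> C"
  shows "abel_sum r (\<lambda>n. t * p n) = t * abel_sum r p"
  unfolding abel_sum_def using suminf_mult[OF abel_summable[OF assms], of t]
  by (simp add: mult.left_commute)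

lemma abel_sum_nonneg:
  assumes "0 \<le> r" "\<And>n. 0 \<le> p n" "r < 1" "\<And>n. p n \<le> C"
  shows "0 \<le> abel_sum r p"
  unfolding abel_sum_def using assms by (intro suminf_nonneg abel_summable[of _ _ C]) auto

lemma abel_sum_pos:
  assumes "0 \<le> r" "r < 1" "\<And>n. 0 \<le> p n" "\<And>n. p n \<le> C" "0 < p 0"
  shows "0 < abel_sum r p"
proof -
  have "0 \<le> abel_sum r (\<lambda>n. p (Suc n))"
    by (rule abel_sum_nonneg) (use assms in auto)
  then show ?thesis
    using abel_sum_split[of r p C] assms by (auto intro: add_pos_nonneg)
qed

text \<open>Each of the first \<open>N\<close> terms contributes at most 1 to the difference,
  whatever \<open>r\<close> is; this uniformity in \<open>r\<close> makes Abel ratios forget a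
  finite part of the orbit.\<close>

lemma abel_sum_eventually_eq:
  assumes r: "0 \<le> r" "r < 1"
    and p: "\<And>n. 0 \<le> p n" "\<And>n. p n \<le> 1" and q: "\<And>n. 0 \<le> q n" "\<And>n. q n \<le> 1"
    and eq: "\<And>n. n \<ge> N \<Longrightarrow> p n = q n"
  shows "\<bar>abel_sum r p - abel_sum r q\<bar> \<le> real N"
proof -
  have "abel_sum r p - abel_sum r q = abel_sum r (\<lambda>n. p n - q n)"
    by (rule abel_sum_diff[symmetric, of _ _ 1]) (use assms in auto)
  also have "\<dots> = (\<Sum>n<N. r ^ n * (p n - q n))"
    unfolding abel_sum_def by (rule suminf_finite) (auto simp: eq)
  also have "\<bar>\<dots>\<bar> \<le> (\<Sum>n<N. \<bar>r ^ n * (p n - q n)\<bar>)" by (rule sum_abs)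
  also have "\<dots> \<le> (\<Sum>n<N. 1)"
  proof (rule sum_mono)
    fix n
    have "\<bar>p n - q n\<bar> \<le> 1" using p[of n] q[of n] by auto
    moreover have "r ^ n \<le> 1" "0 \<le> r ^ n" using r by (auto intro: power_le_one)
    ultimately show "\<bar>r ^ n * (p n - q n)\<bar> \<le> 1"
      by (auto simp: abs_mult intro: mult_le_one)
  qed
  finally show ?thesis by simp
qed

text \<open>Some partial sum without discount exceeds \<open>Z + 1\<close>; its finitely many
  factors \<open>r i ^ n\<close> tend to 1, and the remaining terms are nonnegative.\<close>

lemma abel_sum_tendsto_infinity:
  assumes p: "\<And>n. 0 \<le> p n" "\<And>n. p n \<le> 1" and ns: "\<not> summable p"
    and r: "\<And>i. 0 \<le> r i" "\<And>i. r i < 1" "r \<longlonglongrightarrow> 1"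
  shows "filterlim (\<lambda>i. abel_sum (r i) p) at_top sequentially"
  unfolding filterlim_at_top
proof
  fix Z :: real
  have "\<not> (\<forall>m. (\<Sum>n<m. p n) \<le> Z + 1)"
    using ns p(1) summableI_nonneg_bounded[of p] by blast
  then obtain m where m: "(\<Sum>n<m. p n) > Z + 1" by (auto simp: not_le)
  have "(\<lambda>i. \<Sum>n<m. r i ^ n * p n) \<longlonglongrightarrow> (\<Sum>n<m. 1 ^ n * p n)"
    by (intro tendsto_intros r)
  then have "eventually (\<lambda>i. (\<Sum>n<m. r i ^ n * p n) > Z) sequentially"
    using m by (intro order_tendstoD) auto
  then show "eventually (\<lambda>i. Z \<le> abel_sum (r i) p) sequentially"
  proof eventually_elim
    case (elim i)
    also have "(\<Sum>n<m. r i ^ n * p n) \<le> abel_sum (r i) p"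
      unfolding abel_sum_def using r(1,2)[of i] p
      by (intro sum_le_suminf abel_summable[of _ _ 1]) auto
    finally show ?case by simp
  qed
qed

text \<open>Numerators and denominators change by at most \<open>N\<close>, independently of
  \<open>r\<close>, while the denominators tend to infinity.\<close>

lemma abel_ratio_difference_tendsto_0:
  fixes p q g k :: "nat \<Rightarrow> real"
  assumes p: "\<And>n. 0 < p n" "\<And>n. p n \<le> 1" and q: "\<And>n. 0 < q n" "\<And>n. q n \<le> 1"
    and g: "\<And>n. 0 \<le> g n" "\<And>n. g n \<le> p n" and k: "\<And>n. 0 \<le> k n" "\<And>n. k n \<le> q n"
    and eq: "\<And>n. n \<ge> N \<Longrightarrow> p n = q n" "\<And>n. n \<ge> N \<Longrightarrow> g n = k n"
    and ns: "\<not> summable p"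
    and r: "\<And>i. 0 \<le> r i" "\<And>i. r i < 1" "r \<longlonglongrightarrow> 1"
  shows "(\<lambda>i. abel_sum (r i) g / abel_sum (r i) p - abel_sum (r i) k / abel_sum (r i) q) \<longlonglongrightarrow> 0"
proof (rule Lim_null_comparison)
  have p0: "0 \<le> p n" and q0: "0 \<le> q n" and g1: "g n \<le> 1" and k1: "k n \<le> 1" for n
    using p[of n] q[of n] g[of n] k[of n] by auto
  show "(\<lambda>i. 2 * real N / abel_sum (r i) p) \<longlonglongrightarrow> 0"
    by (intro real_tendsto_divide_at_top[OF tendsto_const] abel_sum_tendsto_infinity p p0 ns r)
  show "\<forall>\<^sub>F i in sequentially. norm (abel_sum (r i) g / abel_sum (r i) p - abel_sum (r i) k / abel_sum (r i) q)
      \<le> 2 * real N / abel_sum (r i) p"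
  proof (rule always_eventually, rule allI)
    fix i
    let ?P = "abel_sum (r i) p" and ?Q = "abel_sum (r i) q" and ?G = "abel_sum (r i) g" and ?K = "abel_sum (r i) k"
    have P: "0 < ?P" by (rule abel_sum_pos[of _ _ 1]) (use p r p0 in auto)
    have Q: "0 < ?Q" by (rule abel_sum_pos[of _ _ 1]) (use q r q0 in auto)
    have K: "0 \<le> ?K" by (rule abel_sum_nonneg[of _ _ 1]) (use k r k1 in auto)
    have KQ: "?K \<le> ?Q" by (rule abel_sum_mono[of _ _ 1]) (use k r k1 q q0 in auto)
    have d1: "\<bar>?P - ?Q\<bar> \<le> real N" by (rule abel_sum_eventually_eq) (use p q p0 q0 r eq in auto)
    have d2: "\<bar>?G - ?K\<bar> \<le> real N" by (rule abel_sum_eventually_eq) (use g k g1 k1 r eq in auto)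
    \<comment> \<open>The change of the denominator is weighted with \<open>?K / ?Q\<close>, which
      lies between 0 and 1.\<close>
    have "?G / ?P - ?K / ?Q = (?G - ?K) / ?P + (?K / ?Q) * ((?Q - ?P) / ?P)"
      using P Q by (simp add: field_simps)
    also have "\<bar>\<dots>\<bar> \<le> \<bar>?G - ?K\<bar> / ?P + \<bar>?K / ?Q\<bar> * (\<bar>?Q - ?P\<bar> / ?P)"
      using P by (auto intro!: order_trans[OF abs_triangle_ineq] simp: abs_mult abs_divide)
    also have "\<dots> \<le> real N / ?P + 1 * (real N / ?P)"
      using d1 d2 P Q K KQ by (intro add_mono mult_mono divide_right_mono) auto
    finally show "norm (?G / ?P - ?K / ?Q) \<le> 2 * real N / ?P" by (simp add: field_simps)
  qed
qed

section \<open>Measure-preserving maps and the maximal inequality\<close>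

lemma integral_measure_preserving:
  fixes f :: "'a \<Rightarrow> real"
  assumes T: "T \<in> measurable M M" "distr M M T = M" and f: "f \<in> borel_measurable M"
  shows "(\<integral>z. f (T z) \<partial>M) = (\<integral>z. f z \<partial>M)"
  using integral_distr[OF T(1) f] T(2) by simp

lemma integrable_measure_preserving:
  fixes f :: "'a \<Rightarrow> real"
  assumes T: "T \<in> measurable M M" "distr M M T = M" and f: "integrable M f"
  shows "integrable M (\<lambda>z. f (T z))"
  using integrable_distr[OF T(1), of f] T(2) f by simp

lemma funpow_measure_preserving:
  assumes T: "T \<in> measurable M M" "distr M M T = M"
  shows "T ^^ n \<in> measurable M M" "distr M M (T ^^ n) = M"
proof (induction n)
  case 0
  show "T ^^ 0 \<in> measurable M M" by simp
  show "distr M M (T ^^ 0) = M" using distr_id[of M] by (simp add: id_def)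
next
  case (Suc n)
  show 1: "T ^^ Suc n \<in> measurable M M" using Suc T by (simp add: measurable_comp)
  have "distr M M (T ^^ Suc n) = distr (distr M M (T ^^ n)) M T"
    using Suc(1) T(1) by (subst distr_distr) (auto simp: comp_def)
  then show "distr M M (T ^^ Suc n) = M" using Suc(2) T(2) by simp
qed

text \<open>Hopf's argument with a discount. For \<open>u = e - t * h\<close> the Abel sum
  \<open>v\<close> satisfies \<open>v z = u z + r * v (T z)\<close>. Hence its positive part
  \<open>w\<close> satisfies \<open>w z - r * w (T z) <= u z\<close> on \<open>A\<close>, and the
  left side is at most 0 off \<open>A\<close>. As \<open>T\<close> preserves \<open>M\<close>, the
  left side integrates to \<open>1 - r\<close> times the integral of \<open>w\<close>, which is
  nonnegative.\<close>

lemma abel_maximal_inequality: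
  fixes e h :: "'a \<Rightarrow> real"
  assumes T: "T \<in> measurable M M" "distr M M T = M"
    and e: "integrable M e" "\<And>z. 0 \<le> e z" "\<And>z. e z \<le> 1"
    and h: "integrable M h" "\<And>z. 0 \<le> h z" "\<And>z. h z \<le> 1"
    and r: "0 \<le> r" "r < 1" and t: "0 < t"
  defines "A \<equiv> {z. t * abel_sum r (\<lambda>n. h ((T ^^ n) z)) < abel_sum r (\<lambda>n. e ((T ^^ n) z))}"
  shows "t * (\<integral>z. indicator A z * h z \<partial>M) \<le> (\<integral>z. e z \<partial>M)"
proof -
  define u where "u z = e z - t * h z" for z
  define v where "v z = abel_sum r (\<lambda>n. u ((T ^^ n) z))" for z
  have u_bd: "\<bar>u z\<bar> \<le> 1 + t" for z
  proof -
    have "t * h z \<le> t * 1" using h t by (intro mult_left_mono) auto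
    moreover have "0 \<le> t * h z" using h t by simp
    ultimately show ?thesis using e(2,3)[of z] unfolding u_def by (auto simp: abs_le_iff)
  qed
  have u_int: "integrable M u" unfolding u_def using e h by auto
  have v_eq: "v z = abel_sum r (\<lambda>n. e ((T ^^ n) z)) - t * abel_sum r (\<lambda>n. h ((T ^^ n) z))" for z
  proof -
    have "\<bar>t * h y\<bar> \<le> 1 + t" for y
      using h(2,3)[of y] t by (simp add: mult_le_cancel_left1 add_increasing)
    moreover have "\<bar>e y\<bar> \<le> 1 + t" for y using e(2,3)[of y] t by simp
    ultimately have "v z = abel_sum r (\<lambda>n. e ((T ^^ n) z)) - abel_sum r (\<lambda>n. t * h ((T ^^ n) z))"
      unfolding v_def u_def by (intro abel_sum_diff[OF r])
    then show ?thesis using abel_sum_cmult[of r "\<lambda>n. h ((T ^^ n) z)" 1 t] r h by simp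
  qed
  have A: "A = {z. 0 < v z}" unfolding A_def v_eq by auto
  have v_rec: "v z = u z + r * v (T z)" for z
  proof -
    have "v z = u ((T ^^ 0) z) + r * abel_sum r (\<lambda>n. u ((T ^^ Suc n) z))"
      unfolding v_def by (rule abel_sum_split[OF r]) (rule u_bd)
    then show ?thesis by (simp only: v_def funpow_Suc_right o_apply funpow_0)
  qed
  have v_int: "integrable M v"
    unfolding v_def abel_sum_def
  proof (rule integrable_suminf)
    \<comment> \<open>All functions \<open>u o T ^^ n\<close> have the same L1 norm, so the
      discounted series converges in L1.\<close>
    have e: "(\<integral>z. \<bar>u ((T ^^ n) z)\<bar> \<partial>M) = (\<integral>z. \<bar>u z\<bar> \<partial>M)" for n
      using integral_measure_preserving[OF funpow_measure_preserving[OF T, of n], of "\<lambda>z. \<bar>u z\<bar>"] u_int by auto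
    show "integrable M (\<lambda>z. r ^ n * u ((T ^^ n) z))" for n
      using integrable_measure_preserving[OF funpow_measure_preserving[OF T, of n] u_int] by auto
    show "AE z in M. summable (\<lambda>n. norm (r ^ n * u ((T ^^ n) z)))"
      using abel_summable[of r "\<lambda>n. \<bar>u ((T ^^ n) z)\<bar>" "1+t" for z] r u_bd by (auto simp: abs_mult)
    have "summable (\<lambda>n. r ^ n * (\<integral>z. \<bar>u z\<bar> \<partial>M))"
      using r by (intro summable_mult2 summable_geometric) auto
    then show "summable (\<lambda>n. \<integral>z. norm (r ^ n * u ((T ^^ n) z)) \<partial>M)"
      using r by (simp add: abs_mult e)
  qed
  define w where "w z = max 0 (v z)" for z
  have w_int: "integrable M w" unfolding w_def using v_int by auto
  have wT_int: "integrable M (\<lambda>z. w (T z))" using integrable_measure_preserving[OF T w_int] .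
  have v_meas: "v \<in> borel_measurable M" using v_int by auto
  have ind: "(\<lambda>z. indicator A z :: real) \<in> borel_measurable M"
    unfolding A indicator_def using v_meas by measurable
  have Ae: "integrable M (\<lambda>z. indicator A z * e z)" and Ah: "integrable M (\<lambda>z. indicator A z * h z)"
    by (rule Bochner_Integration.integrable_bound[OF e(1)], use ind e in \<open>auto split: split_indicator\<close>)
       (rule Bochner_Integration.integrable_bound[OF h(1)], use ind h in \<open>auto split: split_indicator\<close>)
  have "0 \<le> (1 - r) * (\<integral>z. w z \<partial>M)"
    using r by (intro mult_nonneg_nonneg integral_nonneg) (auto simp: w_def)
  also have "\<dots> = (\<integral>z. w z \<partial>M) - r * (\<integral>z. w (T z) \<partial>M)"
    using integral_measure_preserving[OF T, of w] w_int by (simp add: algebra_simps)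
  also have "\<dots> = (\<integral>z. w z - r * w (T z) \<partial>M)"
    using w_int wT_int by simp
  also have "\<dots> \<le> (\<integral>z. indicator A z * e z - t * (indicator A z * h z) \<partial>M)"
  proof (rule integral_mono)
    show "w z - r * w (T z) \<le> indicator A z * e z - t * (indicator A z * h z)" for z
    proof (cases "z \<in> A")
      case True
      have "r * v (T z) \<le> r * w (T z)" using r by (intro mult_left_mono) (auto simp: w_def)
      then show ?thesis using True v_rec[of z] by (simp add: A w_def u_def)
    next
      case False
      then show ?thesis using r by (auto simp: A w_def)
    qed
  qed (use w_int wT_int Ae Ah in auto)
  also have "\<dots> = (\<integral>z. indicator A z * e z \<partial>M) - t * (\<integral>z. indicator A z * h z \<partial>M)"
    using Ae Ah by simp
  also have "(\<integral>z. indicator A z * e z \<partial>M) \<le> (\<integral>z. e z \<partial>M)"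
    using Ae e by (intro integral_mono) (auto split: split_indicator)
  finally show ?thesis by simp
qed

section \<open>Invariant sets along asymptotic orbits\<close>

lemma abel_sum_abs_diff_le:
  assumes r: "0 \<le> r" "r < 1"
    and bd: "\<And>n. \<bar>p n\<bar> \<le> C" "\<And>n. \<bar>q n\<bar> \<le> C" "\<And>n. \<bar>d n\<bar> \<le> C" and le: "\<And>n. \<bar>p n - q n\<bar> \<le> d n"
  shows "\<bar>abel_sum r p - abel_sum r q\<bar> \<le> abel_sum r d"
proof -
  have bd2: "\<bar>p n\<bar> \<le> 3 * C" "\<bar>q n\<bar> \<le> 3 * C" "\<bar>d n\<bar> \<le> 3 * C" "\<bar>p n - q n\<bar> \<le> 3 * C" "\<bar>q n - p n\<bar> \<le> 3 * C" for n
    using bd(1)[of n] bd(2)[of n] bd(3)[of n] by auto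
  have "abel_sum r p - abel_sum r q = abel_sum r (\<lambda>n. p n - q n)"
    by (rule abel_sum_diff[symmetric, OF r bd(1,2)])
  also have "\<dots> \<le> abel_sum r d"
    by (rule abel_sum_mono[OF r bd2(4,3)]) (use le in \<open>auto simp: abs_le_iff\<close>)
  finally have 1: "abel_sum r p - abel_sum r q \<le> abel_sum r d" .
  have "abel_sum r q - abel_sum r p = abel_sum r (\<lambda>n. q n - p n)"
    by (rule abel_sum_diff[symmetric, OF r bd(2,1)])
  also have "\<dots> \<le> abel_sum r d"
    by (rule abel_sum_mono[OF r bd2(5,3)]) (use le in \<open>auto simp: abs_le_iff\<close>)
  finally show ?thesis using 1 by (auto simp: abs_le_iff)
qed

lemma measurable_abel_sum_orbit:
  fixes u :: "'a \<Rightarrow> real"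
  assumes "T \<in> measurable M M" "u \<in> borel_measurable M"
  shows "(\<lambda>z. abel_sum r (\<lambda>n. u ((T ^^ n) z))) \<in> borel_measurable M"
proof -
  have "T ^^ n \<in> measurable M M" for n
    by (induction n) (use assms in \<open>auto intro: measurable_comp\<close>)
  then have "(\<lambda>z. u ((T ^^ n) z)) \<in> borel_measurable M" for n
    using assms(2) by (rule measurable_compose)
  then show ?thesis unfolding abel_sum_def by measurable
qed

text \<open>The ratio of the Abel sums of \<open>h\<close> restricted to \<open>A\<close> and of
  \<open>h\<close> is within 1/4 of the indicator of \<open>W\<close>, except on a set that
  \<open>p\<close> and \<open>s\<close> hit with small probability, uniformly in \<open>r\<close>.
  As \<open>r\<close> tends to 1, the ratios at \<open>p q\<close> and \<open>s q\<close> come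
  together because the two orbits eventually look alike to \<open>h\<close> and \<open>A\<close>.
  Hence membership in \<open>W\<close> agrees.\<close>

lemma invariant_set_transfer:
  fixes h :: "'a \<Rightarrow> real" and p s :: "'b \<Rightarrow> 'a"
  assumes T: "T \<in> measurable M M" "distr M M T = M" and sp: "space M = UNIV"
    and h: "integrable M h" "\<And>z. 0 < h z" "\<And>z. h z \<le> 1"
    and W: "W \<in> sets M" "\<And>z. T z \<in> W \<longleftrightarrow> z \<in> W"
    and Q: "prob_space Q" and p: "p \<in> measurable Q M" and s: "s \<in> measurable Q M"
    and K: "0 \<le> K"
      "\<And>S. S \<in> sets M \<Longrightarrow> measure Q (p -` S \<inter> space Q) \<le> K * (\<integral>z. indicator S z * h z \<partial>M)"
      "\<And>S. S \<in> sets M \<Longrightarrow> measure Q (s -` S \<inter> space Q) \<le> K * (\<integral>z. indicator S z * h z \<partial>M)"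
    and approx: "\<And>d. 0 < d \<Longrightarrow> \<exists>A\<in>sets M. (\<integral>z. indicator (sym_diff W A) z * h z \<partial>M) < d \<and>
      (AE q in Q. \<exists>N. \<forall>n\<ge>N. h ((T ^^ n) (p q)) = h ((T ^^ n) (s q)) \<and>
         ((T ^^ n) (p q) \<in> A \<longleftrightarrow> (T ^^ n) (s q) \<in> A))"
    and dv: "AE q in Q. \<not> summable (\<lambda>n. h ((T ^^ n) (p q)))"
  shows "AE q in Q. p q \<in> W \<longleftrightarrow> s q \<in> W"
proof -
  interpret prob_space Q by fact
  have h0: "0 \<le> h z" for z using h(2)[of z] by simp
  have hm: "h \<in> borel_measurable M" using h by auto
  define B where "B = {q\<in>space Q. (p q \<in> W) \<noteq> (s q \<in> W)}"
  have B: "B \<in> sets Q"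
  proof -
    have "B = ((p -` W \<inter> space Q) - (s -` W \<inter> space Q)) \<union> ((s -` W \<inter> space Q) - (p -` W \<inter> space Q))"
      unfolding B_def by auto
    then show ?thesis using p s W(1) by (auto intro!: sets.Un sets.Diff measurable_sets)
  qed
  have Wn: "(T ^^ n) z \<in> W \<longleftrightarrow> z \<in> W" for n z by (induction n) (auto simp: W(2))
  \<comment> \<open>A sequence of discount factors, starting at 0 and tending to 1; countability
    admits dominated convergence.\<close>
  define r where "r i = 1 - inverse (real (Suc i))" for i
  have "r \<longlonglongrightarrow> 1 - 0"
    unfolding r_def by (intro tendsto_diff tendsto_const LIMSEQ_inverse_real_of_nat)
  then have r: "0 \<le> r i" "r i < 1" "r \<longlonglongrightarrow> 1" for i
    by (auto simp: r_def field_simps)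
  \<comment> \<open>Each of \<open>p\<close> and \<open>s\<close> meets the exceptional set with
    probability at most \<open>4 * K * d\<close>; the last \<open>d\<close> pays for those
    \<open>q\<close> whose two ratios are still apart.\<close>
  have main: "measure Q B \<le> 8 * K * d + d" if d: "0 < d" for d
  proof -
    obtain A where A: "A \<in> sets M" "(\<integral>z. indicator (sym_diff W A) z * h z \<partial>M) < d"
      and AE: "AE q in Q. \<exists>N. \<forall>n\<ge>N. h ((T ^^ n) (p q)) = h ((T ^^ n) (s q)) \<and>
         ((T ^^ n) (p q) \<in> A \<longleftrightarrow> (T ^^ n) (s q) \<in> A)"
      using approx[OF d] by blast
    define e where "e z = indicator (sym_diff W A) z * h z" for z
    define g where "g z = indicator A z * h z" for z
    have em: "e \<in> borel_measurable M" and gm: "g \<in> borel_measurable M"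
      unfolding e_def g_def using A W hm by auto
    have e: "0 \<le> e z" "e z \<le> 1" and g: "0 \<le> g z" "g z \<le> h z" for z
      using h0 h(3) unfolding e_def g_def by (auto split: split_indicator)
    have e_int: "integrable M e"
      by (rule Bochner_Integration.integrable_bound[OF h(1) em]) (use h0 in \<open>auto simp: e_def split: split_indicator\<close>)
    define H where "H i z = abel_sum (r i) (\<lambda>n. h ((T ^^ n) z))" for i z
    define G where "G i z = abel_sum (r i) (\<lambda>n. g ((T ^^ n) z))" for i z
    define E where "E i z = abel_sum (r i) (\<lambda>n. e ((T ^^ n) z))" for i z
    have meas: "H i \<in> borel_measurable M" "G i \<in> borel_measurable M" "E i \<in> borel_measurable M" for i
      unfolding H_def G_def E_def using T em gm hm by (auto intro: measurable_abel_sum_orbit)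
    \<comment> \<open>The threshold 1/4 is chosen because three errors of at most 1/4 (one at
      \<open>p q\<close>, one at \<open>s q\<close>, one between the ratios) cannot bridge the gap 1
      between the values of an indicator.\<close>
    define S where "S i = {z. (1/4) * H i z < E i z}" for i
    have S: "S i \<in> sets M" for i
    proof -
      have [measurable]: "H i \<in> borel_measurable M" "E i \<in> borel_measurable M" by (fact meas)+
      have "{z\<in>space M. (1/4) * H i z < E i z} \<in> sets M" by measurable
      then show ?thesis by (simp add: S_def sp)
    qed
    have "(1/4) * (\<integral>z. indicator (S i) z * h z \<partial>M) \<le> (\<integral>z. e z \<partial>M)" for i
      unfolding S_def H_def E_def
      by (rule abel_maximal_inequality[OF T e_int e h(1) h0 h(3) r(1,2)]) simp
    also have "(\<integral>z. e z \<partial>M) < d" using A(2) by (simp add: e_def)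
    finally have "(\<integral>z. indicator (S i) z * h z \<partial>M) < 4 * d" for i
      by (simp add: field_simps)
    then have S_le: "(\<integral>z. indicator (S i) z * h z \<partial>M) \<le> 4 * d" for i
      using less_imp_le by blast
    have Hpos: "0 < H i z" for i z
      unfolding H_def by (rule abel_sum_pos[of _ _ 1]) (use r h h0 in auto)
    have close: "\<bar>indicator W z - G i z / H i z\<bar> \<le> 1/4" if "z \<notin> S i" for i z
    proof -
      have "\<bar>abel_sum (r i) (\<lambda>n. indicator W z * h ((T ^^ n) z)) - G i z\<bar> \<le> E i z"
        unfolding G_def E_def
      proof (rule abel_sum_abs_diff_le[of _ _ 1])
        fix n
        \<comment> \<open>The indicator of \<open>W\<close> is constant along the orbit, so the
          terms differ only when the orbit visits the symmetric difference.\<close>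
        show "\<bar>indicator W z * h ((T ^^ n) z) - g ((T ^^ n) z)\<bar> \<le> e ((T ^^ n) z)"
          using h0[of "(T ^^ n) z"] Wn[of n z] unfolding g_def e_def by (auto simp: indicator_def)
      qed (use r h h0 e g in \<open>auto simp: indicator_def intro: order_trans[OF g(2)]\<close>)
      also have "abel_sum (r i) (\<lambda>n. indicator W z * h ((T ^^ n) z)) = indicator W z * H i z"
        unfolding H_def by (rule abel_sum_cmult[of _ _ 1]) (use r h h0 in auto)
      also have "E i z \<le> (1/4) * H i z" using that by (simp add: S_def)
      finally have "\<bar>indicator W z * H i z - G i z\<bar> / H i z \<le> 1/4"
        using Hpos[of i z] by (simp add: pos_divide_le_eq)
      also have "\<bar>indicator W z * H i z - G i z\<bar> / H i z = \<bar>(indicator W z * H i z - G i z) / H i z\<bar>"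
        using Hpos[of i z] by (simp add: abs_divide)
      also have "(indicator W z * H i z - G i z) / H i z = indicator W z - G i z / H i z"
        using Hpos[of i z] by (simp add: diff_divide_distrib)
      finally show ?thesis .
    qed
    define D where "D i q = G i (p q) / H i (p q) - G i (s q) / H i (s q)" for i q
    have Dm: "D i \<in> borel_measurable Q" for i
      unfolding D_def
      by (intro borel_measurable_diff borel_measurable_divide measurable_compose[OF p] measurable_compose[OF s] meas)
    define X where "X i = {q\<in>space Q. 1/4 < \<bar>D i q\<bar>}" for i
    have X: "X i \<in> sets Q" for i
      unfolding X_def using Dm by measurable
    have "AE q in Q. (\<lambda>i. D i q) \<longlonglongrightarrow> 0"
      using AE dv
    proof eventually_elim
      case (elim q)
      from elim(1) obtain N where "\<forall>n\<ge>N. h ((T ^^ n) (p q)) = h ((T ^^ n) (s q)) \<and>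
         ((T ^^ n) (p q) \<in> A \<longleftrightarrow> (T ^^ n) (s q) \<in> A)" ..
      then have N: "\<And>n. n \<ge> N \<Longrightarrow> h ((T ^^ n) (p q)) = h ((T ^^ n) (s q))"
         "\<And>n. n \<ge> N \<Longrightarrow> (T ^^ n) (p q) \<in> A \<longleftrightarrow> (T ^^ n) (s q) \<in> A" by simp_all
      show ?case unfolding D_def G_def H_def
        by (rule abel_ratio_difference_tendsto_0[where N = N and p = "\<lambda>n. h ((T ^^ n) (p q))"
              and q = "\<lambda>n. h ((T ^^ n) (s q))" and g = "\<lambda>n. g ((T ^^ n) (p q))"
              and k = "\<lambda>n. g ((T ^^ n) (s q))", OF h(2,3) h(2,3) g g N(1) _ elim(2) r])
           (simp_all add: g_def N indicator_def)
    qed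
    then have "AE q in Q. (\<lambda>i. indicator (X i) q) \<longlonglongrightarrow> (0::real)"
    proof eventually_elim
      case (elim q)
      then have "eventually (\<lambda>i. \<bar>D i q\<bar> < 1/4) sequentially"
        using tendsto_rabs[OF elim] by (intro order_tendstoD) auto
      then have "eventually (\<lambda>i. indicator (X i) q = (0::real)) sequentially"
        by eventually_elim (auto simp: X_def)
      then show ?case by (rule tendsto_eventually)
    qed
    then have "(\<lambda>i. \<integral>q. indicator (X i) q \<partial>Q) \<longlonglongrightarrow> (\<integral>q. (0::real) \<partial>Q)"
      using X by (intro integral_dominated_convergence[where w = "\<lambda>_. 1"]) auto
    then have "(\<lambda>i. measure Q (X i)) \<longlonglongrightarrow> 0"
      using X sets.sets_into_space[OF X] by (simp add: Int_absorb2)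
    then have "eventually (\<lambda>i. measure Q (X i) < d) sequentially"
      using d by (intro order_tendstoD)
    then obtain i where i: "measure Q (X i) < d" by (auto simp: eventually_sequentially)
    have "B \<subseteq> (p -` S i \<inter> space Q) \<union> (s -` S i \<inter> space Q) \<union> X i"
    proof
      fix q assume q: "q \<in> B"
      show "q \<in> (p -` S i \<inter> space Q) \<union> (s -` S i \<inter> space Q) \<union> X i"
      proof (rule ccontr)
        assume "q \<notin> (p -` S i \<inter> space Q) \<union> (s -` S i \<inter> space Q) \<union> X i"
        then have "p q \<notin> S i" "s q \<notin> S i" "\<bar>D i q\<bar> \<le> 1/4" using q by (auto simp: B_def X_def)
        moreover have "\<bar>indicator W (p q) - indicator W (s q) :: real\<bar> = 1"
          using q by (auto simp: B_def indicator_def)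
        ultimately show False
          using close[of "p q" i] close[of "s q" i] unfolding D_def by linarith
      qed
    qed
    then have "measure Q B \<le> measure Q ((p -` S i \<inter> space Q) \<union> (s -` S i \<inter> space Q) \<union> X i)"
      using S p s X by (intro finite_measure_mono) (auto intro!: measurable_sets)
    also have "\<dots> \<le> measure Q ((p -` S i \<inter> space Q) \<union> (s -` S i \<inter> space Q)) + measure Q (X i)"
      using S p s X by (intro measure_Un_le) (auto intro!: measurable_sets)
    also have "measure Q ((p -` S i \<inter> space Q) \<union> (s -` S i \<inter> space Q))
       \<le> measure Q (p -` S i \<inter> space Q) + measure Q (s -` S i \<inter> space Q)"
      using S p s by (intro measure_Un_le) (auto intro!: measurable_sets)
    also have "\<dots> \<le> K * (4 * d) + K * (4 * d)"
      using S_le[of i] K by (intro add_mono order_trans[OF K(2)[OF S]] order_trans[OF K(3)[OF S]] mult_left_mono) auto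
    finally show ?thesis using i by simp
  qed
  have "measure Q B \<le> 0 + x" if x: "0 < x" for x
  proof -
    define d where "d = x / (8 * K + 1)"
    have "8 * K + 1 > 0" using K(1) by simp
    then have "0 < d" "(8 * K + 1) * d = x" using x by (auto simp: d_def)
    with main[of d] show ?thesis by (simp add: distrib_right)
  qed
  then have "measure Q B \<le> 0" by (rule field_le_epsilon)
  then have "B \<in> null_sets Q" using B by (simp add: null_sets_def measure_le_0_iff emeasure_eq_measure)
  then show ?thesis by (rule AE_I') (auto simp: B_def)
qed

section \<open>The densities\<close>

locale krieger_densities =
  fixes l :: real
  assumes l_pos: "0 < l" and l_less_1: "l < 1"
begin

text \<open>The value 0 at negative indices gives the uniform density there. The factor
  \<open>l ^ 5 / 8\<close> is tuned to the exponent \<open>4 / l ^ 5\<close> in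
  \<open>V_bound\<close>: their product is \<open>1 / 2\<close>.\<close>

definition a :: "int \<Rightarrow> real" where
  "a k = (if 0 \<le> k then l ^ 5 / 8 / (of_int k + 1) else 0)"

text \<open>The exponent of \<open>l\<close> in the density. The interval lengths \<open>a k\<close>
  and \<open>l * a k\<close> balance the mass: \<open>(1 - l) * a k\<close> is lost on the left
  interval and \<open>(1 / l - 1) * (l * a k)\<close>, the same amount, is gained on the right
  one.\<close>

definition Y :: "int \<Rightarrow> real \<Rightarrow> int" where
  "Y k u = (if 0 < u \<and> u < a k then 1 else if 1 - l * a k < u \<and> u < 1 then - 1 else 0)"

definition dens :: "int \<Rightarrow> real \<Rightarrow> real" where
  "dens k u = indicator {0<..<1} u * l powi Y k u"

definition rho :: "int \<Rightarrow> real measure" where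
  "rho k = density lborel (\<lambda>u. ennreal (dens k u))"

lemma a_nonneg: "0 \<le> a k"
  using l_pos by (simp add: a_def)

lemma a_le: "a k \<le> 1 / 8"
proof (cases "0 \<le> k")
  case True
  have "l ^ 5 \<le> 1" using l_pos l_less_1 by (intro power_le_one) auto
  then have "l ^ 5 / 8 / (of_int k + 1) \<le> 1 / 8 / 1"
    using True l_pos by (intro frac_le) auto
  then show ?thesis using True by (simp add: a_def)
qed (simp add: a_def)

lemma la_le: "l * a k \<le> 1 / 8" "0 \<le> l * a k"
  using mult_mono[of l 1 "a k" "1/8"] l_pos l_less_1 a_nonneg[of k] a_le[of k] by auto

lemma a_antimono: "0 \<le> i \<Longrightarrow> i \<le> k \<Longrightarrow> a k \<le> a i"
  using l_pos by (auto simp: a_def intro!: divide_left_mono mult_pos_pos)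

lemma Y_neg [simp]: "k < 0 \<Longrightarrow> Y k u = 0"
  by (auto simp: Y_def a_def)

lemma abs_Y_le: "\<bar>Y k u\<bar> \<le> 1"
  by (auto simp: Y_def)

lemma measurable_Y [measurable]: "Y k \<in> measurable borel (count_space UNIV)"
  unfolding Y_def by measurable

lemma measurable_dens [measurable]: "dens k \<in> borel_measurable borel"
  unfolding dens_def by measurable

lemma dens_nonneg: "0 \<le> dens k u"
  using l_pos by (simp add: dens_def)

lemma dens_le: "dens k u \<le> 1 / l"
  using l_pos l_less_1 by (auto simp: dens_def Y_def indicator_def power_int_minus field_simps mult_le_one)

lemma sets_rho [measurable_cong, simp]: "sets (rho k) = sets borel"
  by (simp add: rho_def)

lemma space_rho [simp]: "space (rho k) = UNIV"
  by (simp add: rho_def)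

lemma emeasure_rho: "A \<in> sets borel \<Longrightarrow> emeasure (rho k) A = (\<integral>\<^sup>+u. ennreal (dens k u) * indicator A u \<partial>lborel)"
  unfolding rho_def by (subst emeasure_density) auto

lemma emeasure_rho_Y_1: "emeasure (rho k) {u. Y k u = 1} = ennreal (l * a k)"
proof -
  have "emeasure (rho k) {u. Y k u = 1} = (\<integral>\<^sup>+u. ennreal (dens k u) * indicator {u. Y k u = 1} u \<partial>lborel)"
    by (intro emeasure_rho) measurable
  also have "\<dots> = (\<integral>\<^sup>+u. ennreal l * indicator {0<..<a k} u \<partial>lborel)"
    using a_le[of k] la_le[of k] by (intro nn_integral_cong) (auto simp: dens_def Y_def indicator_def)
  also have "\<dots> = ennreal (l * a k)"
    using a_nonneg[of k] l_pos by (simp add: nn_integral_cmult_indicator ennreal_mult)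
  finally show ?thesis .
qed

lemma emeasure_rho_Y_m1: "emeasure (rho k) {u. Y k u = - 1} = ennreal (a k)"
proof -
  have "emeasure (rho k) {u. Y k u = - 1} = (\<integral>\<^sup>+u. ennreal (dens k u) * indicator {u. Y k u = - 1} u \<partial>lborel)"
    by (intro emeasure_rho) measurable
  also have "\<dots> = (\<integral>\<^sup>+u. ennreal (1 / l) * indicator {1 - l * a k<..<1} u \<partial>lborel)"
    using a_le[of k] la_le[of k]
    by (intro nn_integral_cong) (auto simp: dens_def Y_def indicator_def power_int_minus inverse_eq_divide)
  also have "\<dots> = ennreal (a k)"
    using a_nonneg[of k] l_pos la_le[of k]
    by (simp add: nn_integral_cmult_indicator ennreal_mult[symmetric])
  finally show ?thesis .
qed

lemma emeasure_rho_Y_0: "emeasure (rho k) {u. Y k u = 0} = ennreal (1 - (1 + l) * a k)"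
proof -
  have "emeasure (rho k) {u. Y k u = 0} = (\<integral>\<^sup>+u. ennreal (dens k u) * indicator {u. Y k u = 0} u \<partial>lborel)"
    by (intro emeasure_rho) measurable
  also have "\<dots> = (\<integral>\<^sup>+u. indicator {a k..1 - l * a k} u \<partial>lborel)"
    \<comment> \<open>If \<open>a k = 0\<close>, the closed interval contains 0 and 1, where the
      density vanishes; these two points are discarded as null sets.\<close>
    using AE_lborel_singleton[of 0] AE_lborel_singleton[of 1]
    by (intro nn_integral_cong_AE, eventually_elim)
       (use a_nonneg[of k] a_le[of k] la_le[of k] in \<open>auto simp: dens_def Y_def indicator_def\<close>)
  also have "\<dots> = ennreal (1 - (1 + l) * a k)"
    using a_le[of k] la_le[of k] by (simp add: algebra_simps)
  finally show ?thesis .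
qed

sublocale rho: prob_space "rho k" for k
proof
  have "emeasure (rho k) UNIV = emeasure (rho k) ({u. Y k u = 1} \<union> {u. Y k u = - 1} \<union> {u. Y k u = 0})"
    by (intro arg_cong[where f = "emeasure (rho k)"]) (auto simp: Y_def)
  also have "\<dots> = emeasure (rho k) ({u. Y k u = 1} \<union> {u. Y k u = - 1}) + emeasure (rho k) {u. Y k u = 0}"
    by (rule plus_emeasure[symmetric]) (measurable, auto)
  also have "emeasure (rho k) ({u. Y k u = 1} \<union> {u. Y k u = - 1}) =
      emeasure (rho k) {u. Y k u = 1} + emeasure (rho k) {u. Y k u = - 1}"
    by (rule plus_emeasure[symmetric]) (measurable, auto)
  also have "\<dots> + emeasure (rho k) {u. Y k u = 0} = 1"
    using la_le[of k] a_nonneg[of k] a_le[of k]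
    by (simp add: emeasure_rho_Y_1 emeasure_rho_Y_m1 emeasure_rho_Y_0 ennreal_plus[symmetric] algebra_simps del: ennreal_plus)
  finally show "emeasure (rho k) (space (rho k)) = 1" by simp
qed

text \<open>The two step functions can differ only between corresponding interval ends: on
  \<open>[m, M]\<close> and on \<open>[1 - l * M, 1 - l * m]\<close>, where \<open>m\<close> and
  \<open>M\<close> are the smaller and the larger of \<open>a i\<close> and \<open>a k\<close>. The
  density is at most \<open>1 / l\<close>.\<close>

lemma emeasure_rho_Y_neq_le: "emeasure (rho k) {u. Y i u \<noteq> Y k u} \<le> ennreal (2 / l * \<bar>a i - a k\<bar>)"
proof -
  define m M where "m = min (a i) (a k)" and "M = max (a i) (a k)"
  have mM: "0 \<le> m" "m \<le> M" "M \<le> 1/8" "M - m = \<bar>a i - a k\<bar>"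
    using a_nonneg a_le[of i] a_le[of k] by (auto simp: m_def M_def)
  have lmM: "l * m \<le> l * M" "0 \<le> l * m" "l * M \<le> M"
    using mM l_pos l_less_1 mult_right_mono[of l 1 M] by (auto intro: mult_left_mono)
  have "emeasure (rho k) {u. Y i u \<noteq> Y k u} = (\<integral>\<^sup>+u. ennreal (dens k u) * indicator {u. Y i u \<noteq> Y k u} u \<partial>lborel)"
    by (intro emeasure_rho) measurable
  also have "\<dots> \<le> (\<integral>\<^sup>+u. ennreal (1 / l) * (indicator {m..M} u + indicator {1 - l * M..1 - l * m} u) \<partial>lborel)"
  proof (intro nn_integral_mono)
    fix u
    have "l * a i = l * m \<and> l * a k = l * M \<or> l * a i = l * M \<and> l * a k = l * m"
      by (auto simp: m_def M_def min_def max_def)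
    then have "Y i u \<noteq> Y k u \<Longrightarrow> u \<in> {m..M} \<union> {1 - l * M..1 - l * m}"
      using mM lmM by (auto simp: Y_def m_def M_def split: if_splits)
    then show "ennreal (dens k u) * indicator {u. Y i u \<noteq> Y k u} u
      \<le> ennreal (1 / l) * (indicator {m..M} u + indicator {1 - l * M..1 - l * m} u)"
      using dens_le[of k u] by (intro mult_mono ennreal_leI) (auto simp: indicator_def)
  qed
  also have "\<dots> = ennreal (1 / l) * (ennreal (M - m) + ennreal (l * M - l * m))"
    using mM lmM by (subst nn_integral_cmult, measurable, subst nn_integral_add) auto
  also have "\<dots> = ennreal (1 / l * ((M - m) + (l * M - l * m)))"
    using mM lmM l_pos by (simp add: ennreal_plus[symmetric] ennreal_mult[symmetric] del: ennreal_plus)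
  also have "\<dots> \<le> ennreal (1 / l * (2 * (M - m)))"
  proof (intro ennreal_leI mult_left_mono)
    have "l * (M - m) \<le> 1 * (M - m)" using mM l_less_1 by (intro mult_right_mono) auto
    then show "M - m + (l * M - l * m) \<le> 2 * (M - m)" by (simp add: right_diff_distrib)
  qed (use l_pos in auto)
  finally show ?thesis by (simp add: mM)
qed

section \<open>The product measure\<close>

definition P :: "(int \<Rightarrow> real) measure" where "P = PiM UNIV rho"

sublocale prod: product_prob_space rho UNIV ..

lemma prob_space_P: "prob_space P"
  unfolding P_def by (rule prod.P.prob_space_axioms)

lemma space_P [simp]: "space P = UNIV"
  by (simp add: P_def space_PiM)

lemma sets_P [measurable_cong]: "sets P = sets (PiM UNIV (\<lambda>_. borel))"
  unfolding P_def by (rule sets_PiM_cong) auto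

lemma nn_integral_P_prod:
  assumes J: "finite J" and g: "\<And>k. k \<in> J \<Longrightarrow> g k \<in> borel_measurable borel"
  shows "(\<integral>\<^sup>+x. (\<Prod>k\<in>J. g k (x k)) \<partial>P) = (\<Prod>k\<in>J. \<integral>\<^sup>+u. g k u \<partial>rho k)"
proof -
  have "(\<integral>\<^sup>+x. (\<Prod>k\<in>J. g k (x k)) \<partial>P) = (\<integral>\<^sup>+x. (\<Prod>k\<in>J. g k ((\<lambda>x. restrict x J) x k)) \<partial>P)"
    by (intro nn_integral_cong prod.cong) auto
  also have "\<dots> = (\<integral>\<^sup>+x. (\<Prod>k\<in>J. g k (x k)) \<partial>(distr P (PiM J rho) (\<lambda>x. restrict x J)))"
    unfolding P_def using g
    by (subst nn_integral_distr)
       (auto intro!: measurable_restrict_subset borel_measurable_prod_ennreal measurable_compose[OF measurable_component_singleton])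
  also have "\<dots> = (\<integral>\<^sup>+x. (\<Prod>k\<in>J. g k (x k)) \<partial>(PiM J rho))"
    unfolding P_def by (subst prod.distr_PiM_restrict_finite) (use J in auto)
  also have "\<dots> = (\<Prod>k\<in>J. \<integral>\<^sup>+u. g k u \<partial>rho k)"
    by (rule prod.product_nn_integral_prod) (use J g in auto)
  finally show ?thesis .
qed

end

text \<open>The inequality \<open>ln t <= t - 1\<close> at \<open>t = n / (n + 1)\<close> bounds
  \<open>1 / (n + 1)\<close> by \<open>ln (n + 1) - ln n\<close>, which telescopes.\<close>

lemma sum_inverse_le_ln: "1 \<le> n \<Longrightarrow> (\<Sum>k<n. 1 / (real k + 1)) \<le> 1 + ln (real n)"
proof (induction n rule: dec_induct)
  case base
  then show ?case by simp
next
  case (step n)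
  have "ln (real n / (real n + 1)) \<le> real n / (real n + 1) - 1"
    using step by (intro ln_le_minus_one) auto
  also have "ln (real n / (real n + 1)) = ln (real n) - ln (real n + 1)"
    using step by (subst ln_div) auto
  finally have "1 / (real n + 1) \<le> ln (real n + 1) - ln (real n)"
    by (simp add: field_simps)
  then show ?case using step by (simp add: add.commute)
qed

lemma prod_power_int_eq_power_int_sum:
  fixes l :: real
  assumes "l \<noteq> 0"
  shows "(\<Prod>k\<in>A. l powi f k) = l powi (\<Sum>k\<in>A. f k)"
  by (induction A rule: infinite_finite_induct) (use assms in \<open>auto simp: power_int_add\<close>)

lemma prod_mono_ennreal:
  fixes f g :: "'a \<Rightarrow> ennreal"
  shows "(\<And>k. k \<in> A \<Longrightarrow> f k \<le> g k) \<Longrightarrow> prod f A \<le> prod g A"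
  by (induction A rule: infinite_finite_induct) (auto intro: mult_mono)

definition window :: "nat \<Rightarrow> int set" where
  "window K = {- int K..int K}"

lemma finite_window [simp]: "finite (window K)"
  by (simp add: window_def)

lemma window_mono: "K \<le> K' \<Longrightarrow> window K \<subseteq> window K'"
  by (auto simp: window_def)

lemma finite_subset_window:
  assumes "finite A"
  obtains K where "A \<subseteq> window K"
proof -
  from assms obtain b where b: "abs ` A \<subseteq> {..b}" unfolding finite_int_iff_bounded_le by blast
  have "A \<subseteq> window (nat b)"
  proof
    fix k assume "k \<in> A"
    then have "\<bar>k\<bar> \<le> b" using b by blast
    then show "k \<in> window (nat b)" by (auto simp: window_def abs_le_iff)
  qed
  then show thesis by (rule that)
qed

section \<open>Coordinates where the shifted densities differ\<close>

context krieger_densities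
begin

text \<open>\<open>a\<close> vanishes at negative indices, so each further shift brings in a zero at
  the left end and drops the last summand.\<close>

lemma sum_a_shift_le: "(\<Sum>k\<le>K. a (int k - int n)) \<le> (\<Sum>k\<le>K. a (int k))"
proof (induction n)
  case (Suc n)
  have "(\<Sum>k\<le>K. a (int k - int (Suc n))) \<le> (\<Sum>k\<le>K. a (int k - int n))"
  proof (cases K)
    case (Suc m)
    have "(\<Sum>k\<le>Suc m. a (int k - int (Suc n))) = (\<Sum>k\<le>m. a (int k - int n))"
      by (subst sum.atMost_Suc_shift) (simp add: a_def algebra_simps)
    also have "\<dots> \<le> (\<Sum>k\<le>Suc m. a (int k - int n))" using a_nonneg by simp
    finally show ?thesis using Suc by simp
  qed (use l_pos in \<open>simp add: a_def\<close>)
  with Suc show ?case by linarith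
qed simp

text \<open>For \<open>k >= n\<close> the difference is nonnegative by monotonicity. For
  \<open>k < n\<close> it is \<open>- a k\<close>, and adding \<open>2 * a k\<close> restores the
  absolute value. The sum of the signed differences is at most 0.\<close>

lemma sum_abs_a_diff_nonneg_le:
  "(\<Sum>k\<in>window K. \<bar>a (k - int n) - a k\<bar>) \<le> 2 * (\<Sum>k<n. a (int k))"
proof -
  have "(\<Sum>k\<in>window K. \<bar>a (k - int n) - a k\<bar>) = (\<Sum>k\<in>{0..int K}. \<bar>a (k - int n) - a k\<bar>)"
    by (rule sum.mono_neutral_right) (auto simp: window_def a_def)
  also have "\<dots> = (\<Sum>k\<le>K. \<bar>a (int k - int n) - a (int k)\<bar>)"
    by (rule sum.reindex_bij_witness[of _ int nat]) auto
  also have "\<dots> \<le> (\<Sum>k\<le>K. a (int k - int n) - a (int k) + 2 * (if k < n then a (int k) else 0))"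
  proof (rule sum_mono)
    fix k
    show "\<bar>a (int k - int n) - a (int k)\<bar> \<le> a (int k - int n) - a (int k) + 2 * (if k < n then a (int k) else 0)"
    proof (cases "k < n")
      case True
      then have "a (int k - int n) = 0" by (simp add: a_def)
      then show ?thesis using True a_nonneg[of "int k"] by simp
    next
      case False
      then show ?thesis using a_antimono[of "int k - int n" "int k"] by simp
    qed
  qed
  also have "\<dots> = (\<Sum>k\<le>K. a (int k - int n)) - (\<Sum>k\<le>K. a (int k)) + 2 * (\<Sum>k\<le>K. if k < n then a (int k) else 0)"
    by (simp add: sum.distrib sum_subtractf sum_distrib_left)
  also have "\<dots> \<le> 2 * (\<Sum>k\<le>K. if k < n then a (int k) else 0)"
    using sum_a_shift_le[where K = K and n = n] by simp
  also have "(\<Sum>k\<le>K. if k < n then a (int k) else 0) \<le> (\<Sum>k<n. a (int k))"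
    using a_nonneg by (simp add: sum.If_cases Collect_conj_eq[symmetric])
      (intro sum_mono2, auto)
  finally show ?thesis by simp
qed

lemma sum_abs_a_diff_le:
  "(\<Sum>k\<in>window K. \<bar>a (k - n) - a k\<bar>) \<le> 2 * (\<Sum>k<nat \<bar>n\<bar>. a (int k))"
proof (cases "0 \<le> n")
  case True
  then show ?thesis using sum_abs_a_diff_nonneg_le[where K = K and n = "nat n"] by simp
next
  case False
  define m where "m = nat (- n)"
  have n: "n = - int m" using False by (simp add: m_def)
  \<comment> \<open>Translating the index by \<open>m\<close> turns a negative shift into a positive
    one over a translated window, which a larger window contains.\<close>
  have "(\<Sum>k\<in>window K. \<bar>a (k - n) - a k\<bar>) = (\<Sum>k\<in>(\<lambda>k. k + int m) ` window K. \<bar>a (k - int m) - a k\<bar>)"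
    by (subst sum.reindex) (auto simp: n abs_minus_commute)
  also have "\<dots> \<le> (\<Sum>k\<in>window (K + m). \<bar>a (k - int m) - a k\<bar>)"
    by (intro sum_mono2) (auto simp: window_def)
  also have "\<dots> \<le> 2 * (\<Sum>k<m. a (int k))" by (rule sum_abs_a_diff_nonneg_le)
  finally show ?thesis by (simp add: n)
qed

text \<open>These are the coordinates at which the Radon-Nikodym derivative of the
  \<open>n\<close>-th shift has a factor different from 1.\<close>

definition S :: "int \<Rightarrow> (int \<Rightarrow> real) \<Rightarrow> int set" where
  "S n x = {k. Y (k - n) (x k) \<noteq> Y k (x k)}"

text \<open>A majorant of the factor \<open>l powi (Y (k - n) u - Y k u)\<close>, whose exponent is
  at least -2. The fourth power also makes the product over all \<open>k\<close> dominate
  \<open>(1 / l) ^ (2 * |c n x|)\<close> for the cocycle \<open>c\<close> below, as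
  \<open>|c n x| <= 2 * card (S n x)\<close>.\<close>

definition v :: "int \<Rightarrow> int \<Rightarrow> real \<Rightarrow> real" where
  "v n k u = (if Y (k - n) u \<noteq> Y k u then (1 / l) ^ 4 else 1)"

definition VK :: "nat \<Rightarrow> int \<Rightarrow> (int \<Rightarrow> real) \<Rightarrow> real" where
  "VK K n x = (\<Prod>k\<in>window K. v n k (x k))"

text \<open>Equal to \<open>((1 / l) ^ 4) ^ card (S n x)\<close> if \<open>S n x\<close> is finite,
  and infinite otherwise; being extended real valued, it lets a finite integral prove that
  \<open>S n x\<close> is finite almost everywhere.\<close>

definition V :: "int \<Rightarrow> (int \<Rightarrow> real) \<Rightarrow> ennreal" where
  "V n x = (SUP K. ennreal (VK K n x))"

definition V_bound :: "int \<Rightarrow> real" where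
  "V_bound n = exp (4 / l ^ 5 * (\<Sum>k<nat \<bar>n\<bar>. a (int k)))"

lemma measurable_v [measurable]: "v n k \<in> borel_measurable borel"
  unfolding v_def by measurable

lemma measurable_coord [measurable]: "(\<lambda>x. x k) \<in> borel_measurable P"
  using measurable_component_singleton[of k UNIV "\<lambda>_. borel"] by (simp cong: measurable_cong_sets add: sets_P)

lemma measurable_VK [measurable]: "VK K n \<in> borel_measurable P"
  unfolding VK_def by measurable

lemma measurable_V [measurable]: "V n \<in> borel_measurable P"
  unfolding V_def by measurable

lemma inv_l_gt_1: "1 < (1 / l) ^ 4"
  using l_pos l_less_1 by (intro one_less_power) auto

lemma v_ge_1: "1 \<le> v n k u"
  using inv_l_gt_1 by (simp add: v_def)

lemma VK_eq: "VK K n x = ((1 / l) ^ 4) ^ card (S n x \<inter> window K)"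
proof -
  have "VK K n x = (\<Prod>k\<in>window K. if k \<in> S n x then (1 / l) ^ 4 else 1)"
    unfolding VK_def v_def S_def by (intro prod.cong) auto
  also have "\<dots> = ((1 / l) ^ 4) ^ card (S n x \<inter> window K)"
    by (subst prod.If_cases) (auto simp: Int_commute)
  finally show ?thesis .
qed

lemma VK_mono: "K \<le> K' \<Longrightarrow> VK K n x \<le> VK K' n x"
  unfolding VK_eq using inv_l_gt_1 window_mono[of K K']
  by (intro power_increasing card_mono) auto

text \<open>\<open>1 + t <= exp t\<close> turns the product over the coordinates into the
  exponential of a sum. The power \<open>l ^ 5\<close> collects the \<open>(1 / l) ^ 4\<close> of
  \<open>v\<close> and the bound \<open>1 / l\<close> of the density.\<close>

lemma nn_integral_v_le: "(\<integral>\<^sup>+u. ennreal (v n k u) \<partial>rho k) \<le> ennreal (exp (2 / l ^ 5 * \<bar>a (k - n) - a k\<bar>))"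
proof -
  have [measurable]: "{u. Y (k - n) u \<noteq> Y k u} \<in> sets borel" by measurable
  have "(\<integral>\<^sup>+u. ennreal (v n k u) \<partial>rho k) \<le> (\<integral>\<^sup>+u. 1 + ennreal ((1 / l) ^ 4) * indicator {u. Y (k - n) u \<noteq> Y k u} u \<partial>rho k)"
    by (intro nn_integral_mono) (auto simp: v_def indicator_def)
  also have "\<dots> = 1 + ennreal ((1 / l) ^ 4) * emeasure (rho k) {u. Y (k - n) u \<noteq> Y k u}"
  proof -
    have m: "{u. Y (k - n) u \<noteq> Y k u} \<in> sets (rho k)" by simp
    then have "(\<lambda>u. ennreal ((1 / l) ^ 4) * indicator {u. Y (k - n) u \<noteq> Y k u} u) \<in> borel_measurable (rho k)"
      by (intro borel_measurable_times_ennreal borel_measurable_indicator) auto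
    with m show ?thesis
      using rho.emeasure_space_1[of k] by (simp add: nn_integral_add nn_integral_cmult_indicator)
  qed
  also have "\<dots> \<le> 1 + ennreal ((1 / l) ^ 4) * ennreal (2 / l * \<bar>a (k - n) - a k\<bar>)"
    by (intro add_left_mono mult_left_mono emeasure_rho_Y_neq_le) auto
  also have "\<dots> = ennreal (1 + 2 / l ^ 5 * \<bar>a (k - n) - a k\<bar>)"
  proof -
    have "(1 / l) ^ 4 * (2 / l * \<bar>a (k - n) - a k\<bar>) = 2 / l ^ 5 * \<bar>a (k - n) - a k\<bar>"
      using l_pos by (simp add: field_simps eval_nat_numeral)
    then show ?thesis using l_pos
      by (simp add: ennreal_mult[symmetric] ennreal_plus[symmetric] ennreal_1[symmetric] del: ennreal_plus ennreal_1)
  qed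
  also have "\<dots> \<le> ennreal (exp (2 / l ^ 5 * \<bar>a (k - n) - a k\<bar>))"
    by (intro ennreal_leI exp_ge_add_one_self)
  finally show ?thesis .
qed

lemma nn_integral_VK_le: "(\<integral>\<^sup>+x. ennreal (VK K n x) \<partial>P) \<le> ennreal (V_bound n)"
proof -
  have "(\<integral>\<^sup>+x. ennreal (VK K n x) \<partial>P) = (\<integral>\<^sup>+x. (\<Prod>k\<in>window K. ennreal (v n k (x k))) \<partial>P)"
    unfolding VK_def using v_ge_1 by (subst prod_ennreal) (auto intro: order_trans[OF zero_le_one])
  also have "\<dots> = (\<Prod>k\<in>window K. \<integral>\<^sup>+u. ennreal (v n k u) \<partial>rho k)"
    by (rule nn_integral_P_prod) auto
  also have "\<dots> \<le> (\<Prod>k\<in>window K. ennreal (exp (2 / l ^ 5 * \<bar>a (k - n) - a k\<bar>)))"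
    by (intro prod_mono_ennreal nn_integral_v_le)
  also have "\<dots> = ennreal (exp (2 / l ^ 5 * (\<Sum>k\<in>window K. \<bar>a (k - n) - a k\<bar>)))"
    by (subst prod_ennreal) (auto simp: exp_sum sum_distrib_left)
  also have "\<dots> \<le> ennreal (V_bound n)"
  proof -
    have "2 / l ^ 5 * (\<Sum>k\<in>window K. \<bar>a (k - n) - a k\<bar>) \<le> 2 / l ^ 5 * (2 * (\<Sum>k<nat \<bar>n\<bar>. a (int k)))"
      using l_pos by (intro mult_left_mono sum_abs_a_diff_le) auto
    then show ?thesis unfolding V_bound_def by (intro ennreal_leI) simp
  qed
  finally show ?thesis .
qed

lemma nn_integral_V_le: "(\<integral>\<^sup>+x. V n x \<partial>P) \<le> ennreal (V_bound n)"
proof -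
  have "(\<integral>\<^sup>+x. V n x \<partial>P) = (SUP K. \<integral>\<^sup>+x. ennreal (VK K n x) \<partial>P)"
    unfolding V_def
    by (intro nn_integral_monotone_convergence_SUP) (auto simp: incseq_def le_fun_def intro!: ennreal_leI VK_mono)
  also have "\<dots> \<le> ennreal (V_bound n)" by (intro SUP_least nn_integral_VK_le)
  finally show ?thesis .
qed

lemma finite_S_if_V_finite:
  assumes "V n x \<noteq> \<infinity>"
  shows "finite (S n x)"
proof (rule ccontr)
  assume inf: "infinite (S n x)"
  obtain b where b: "V n x = ennreal b" "0 \<le> b" using assms by (cases "V n x") auto
  obtain m where m: "b < ((1 / l) ^ 4) ^ m" using real_arch_pow[OF inv_l_gt_1] by blast
  obtain A where A: "finite A" "card A = m" "A \<subseteq> S n x"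
    using infinite_arbitrarily_large[OF inf] by blast
  obtain K where K: "A \<subseteq> window K" using finite_subset_window[OF A(1)] .
  have "((1 / l) ^ 4) ^ m \<le> VK K n x"
    unfolding VK_eq A(2)[symmetric] using inv_l_gt_1 A K by (intro power_increasing card_mono) auto
  moreover have "ennreal (VK K n x) \<le> ennreal b"
    unfolding b(1)[symmetric] V_def by (rule SUP_upper) simp
  then have "VK K n x \<le> b" using b by (simp add: ennreal_le_iff)
  ultimately show False using m by simp
qed

lemma V_eq:
  assumes "finite (S n x)"
  shows "V n x = ennreal (((1 / l) ^ 4) ^ card (S n x))"
proof (rule antisym)
  show "V n x \<le> ennreal (((1 / l) ^ 4) ^ card (S n x))"
    unfolding V_def VK_eq using inv_l_gt_1 assms
    by (intro SUP_least ennreal_leI power_increasing card_mono) auto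
  obtain K where K: "S n x \<subseteq> window K" using finite_subset_window[OF assms] .
  then have "VK K n x = ((1 / l) ^ 4) ^ card (S n x)" by (simp add: VK_eq Int_absorb2)
  then show "ennreal (((1 / l) ^ 4) ^ card (S n x)) \<le> V n x"
    unfolding V_def by (metis SUP_upper UNIV_I)
qed

definition X0 :: "(int \<Rightarrow> real) set" where
  "X0 = {x. \<forall>n. finite (S n x)}"

lemma AE_X0: "AE x in P. x \<in> X0"
proof -
  have "AE x in P. V n x \<noteq> \<infinity>" for n
    by (rule nn_integral_PInf_AE) (use nn_integral_V_le[of n] in \<open>auto simp: top_unique\<close>)
  then have "AE x in P. finite (S n x)" for n
    using finite_S_if_V_finite by (auto intro: AE_mp[OF _ AE_I2])
  then show ?thesis unfolding X0_def by (simp add: AE_all_countable)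
qed

text \<open>The constant in \<open>a\<close> leaves half a harmonic sum in the exponent, hence half
  a logarithm. Any power of \<open>N\<close> below the first would do for the divergence
  argument.\<close>

lemma V_bound_le: "n < N \<Longrightarrow> V_bound (int n) \<le> exp (1 / 2) * sqrt (real N)"
proof -
  assume nN: "n < N"
  have "(\<Sum>k<n. a (int k)) = l ^ 5 / 8 * (\<Sum>k<n. 1 / (real k + 1))"
    by (simp add: a_def sum_distrib_left)
  then have "4 / l ^ 5 * (\<Sum>k<n. a (int k)) = 4 / l ^ 5 * (l ^ 5 / 8 * (\<Sum>k<n. 1 / (real k + 1)))"
    by (simp only:)
  also have "\<dots> = 1 / 2 * (\<Sum>k<n. 1 / (real k + 1))"
    using l_pos by simp
  also have "\<dots> \<le> 1 / 2 * (\<Sum>k<N. 1 / (real k + 1))"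
    using nN by (intro mult_left_mono sum_mono2) auto
  also have "\<dots> \<le> 1 / 2 * (1 + ln (real N))"
    using nN by (intro mult_left_mono sum_inverse_le_ln) auto
  also have "\<dots> = 1 / 2 + ln (sqrt (real N))" using nN by (simp add: ln_sqrt)
  finally have "V_bound (int n) \<le> exp (1 / 2 + ln (sqrt (real N)))" by (simp add: V_bound_def)
  also have "\<dots> = exp (1 / 2) * sqrt (real N)" using nN by (subst exp_add) simp
  finally show ?thesis .
qed

end

section \<open>Measurability of integer-valued functions\<close>

lemma measurable_add_int:
  fixes f g :: "'a \<Rightarrow> int"
  assumes "f \<in> measurable M (count_space UNIV)" "g \<in> measurable M (count_space UNIV)"
  shows "(\<lambda>x. f x + g x) \<in> measurable M (count_space UNIV)"
  by (rule measurable_compose_countable[OF _ assms(1)]) (rule measurable_compose[OF assms(2)], simp)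

lemma measurable_diff_int:
  fixes f g :: "'a \<Rightarrow> int"
  assumes "f \<in> measurable M (count_space UNIV)" "g \<in> measurable M (count_space UNIV)"
  shows "(\<lambda>x. f x - g x) \<in> measurable M (count_space UNIV)"
  by (rule measurable_compose_countable[OF _ assms(1)]) (rule measurable_compose[OF assms(2)], simp)

lemma measurable_sum_int:
  fixes f :: "'b \<Rightarrow> 'a \<Rightarrow> int"
  assumes "\<And>k. f k \<in> measurable M (count_space UNIV)"
  shows "(\<lambda>x. \<Sum>k\<in>A. f k x) \<in> measurable M (count_space UNIV)"
  by (induction A rule: infinite_finite_induct) (auto intro!: measurable_add_int assms)

section \<open>Divergence along almost every orbit, and the cocycle\<close>

context krieger_densities
begin

interpretation P: prob_space P by (rule prob_space_P)

lemma V_ge_1: "1 \<le> V n x"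
proof -
  have "ennreal 1 \<le> ennreal (VK 0 n x)"
    unfolding VK_eq by (rule ennreal_leI, rule one_le_power, rule less_imp_le, rule inv_l_gt_1)
  also have "\<dots> \<le> V n x" unfolding V_def by (rule SUP_upper) simp
  finally show ?thesis by simp
qed

text \<open>Summing \<open>w \<ge> 2 t - t\<^sup>2 / w\<close> with \<open>t = N / M\<close> avoids Cauchy-Schwarz.\<close>

lemma sum_V_ge:
  assumes M: "0 < M" and le: "(\<Sum>n<N. 1 / enn2real (V (int n) x)) \<le> M"
  shows "ennreal ((real N)\<^sup>2 / M) \<le> (\<Sum>n<N. V (int n) x)"
proof (cases "\<exists>n<N. V (int n) x = \<infinity>")
  case True
  then obtain n where "n < N" "V (int n) x = \<infinity>" by blast
  then have *: "(\<Sum>n<N. V (int n) x) = \<infinity>"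
    using member_le_sum[of n "{..<N}" "\<lambda>n. V (int n) x"] by (simp add: top_unique)
  show ?thesis unfolding * by simp
next
  case False
  define w where "w n = enn2real (V (int n) x)" for n
  have Vw: "V (int n) x = ennreal (w n)" if "n < N" for n
    using False that unfolding w_def by (auto simp: ennreal_enn2real_if)
  have w: "1 \<le> w n" if "n < N" for n
    using V_ge_1[of "int n" x] Vw[OF that] by (simp add: ennreal_ge_1)
  define t where "t = real N / M"
  have "(real N)\<^sup>2 / M = 2 * t * real N - t\<^sup>2 * M"
    using M by (simp add: t_def power2_eq_square field_simps)
  also have "\<dots> \<le> 2 * t * real N - t\<^sup>2 * (\<Sum>n<N. 1 / w n)"
    using le by (simp add: w_def mult_left_mono)
  also have "\<dots> = (\<Sum>n<N. 2 * t - t\<^sup>2 * (1 / w n))"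
    by (simp add: sum_subtractf sum_distrib_left)
  also have "\<dots> \<le> (\<Sum>n<N. w n)"
  proof (rule sum_mono)
    fix n assume "n \<in> {..<N}"
    then have "0 < w n" using w[of n] by simp
    moreover have "0 \<le> (w n - t)\<^sup>2" by simp
    ultimately show "2 * t - t\<^sup>2 * (1 / w n) \<le> w n"
      by (simp add: power2_eq_square field_simps)
  qed
  finally have "ennreal ((real N)\<^sup>2 / M) \<le> ennreal (\<Sum>n<N. w n)" by (rule ennreal_leI)
  also have "\<dots> = (\<Sum>n<N. ennreal (w n))"
    using w by (intro sum_ennreal[symmetric]) (auto intro: order_trans[OF zero_le_one])
  also have "\<dots> = (\<Sum>n<N. V (int n) x)" by (simp add: Vw)
  finally show ?thesis .
qed

text \<open>The summands are the reciprocals of \<open>V\<close>. Where their partial sums stay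
  below \<open>M\<close>, the sum of the first \<open>N\<close> values of \<open>V\<close> is at
  least \<open>N^2 / M\<close>, but its integral is only of order \<open>N * sqrt N\<close>. So this
  event has probability of order \<open>1 / sqrt N\<close> for every \<open>N\<close>.\<close>

lemma AE_not_summable: "AE x in P. \<not> summable (\<lambda>n. (l ^ 4) ^ card (S (int n) x))"
proof -
  have null: "AE x in P. \<not> (\<forall>N. (\<Sum>n<N. 1 / enn2real (V (int n) x)) \<le> real M)"
    if M: "0 < M" for M :: nat
  proof -
    define A where "A = {x \<in> space P. \<forall>N. (\<Sum>n<N. 1 / enn2real (V (int n) x)) \<le> real M}"
    have A: "A \<in> sets P" unfolding A_def by measurable
    have le: "measure P A \<le> real M * exp (1 / 2) / sqrt (real N)" if N: "0 < N" for N
    proof -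
      have "ennreal ((real N)\<^sup>2 / real M) * emeasure P A = (\<integral>\<^sup>+x. ennreal ((real N)\<^sup>2 / real M) * indicator A x \<partial>P)"
        using A by (simp add: nn_integral_cmult_indicator)
      also have "\<dots> \<le> (\<integral>\<^sup>+x. (\<Sum>n<N. V (int n) x) \<partial>P)"
        using M sum_V_ge[where M = "real M" and N = N] by (intro nn_integral_mono) (auto simp: A_def indicator_def)
      also have "\<dots> = (\<Sum>n<N. \<integral>\<^sup>+x. V (int n) x \<partial>P)"
        by (rule nn_integral_sum) measurable
      also have "\<dots> \<le> (\<Sum>n<N. ennreal (exp (1 / 2) * sqrt (real N)))"
        by (intro sum_mono order_trans[OF nn_integral_V_le] ennreal_leI V_bound_le) auto
      also have "\<dots> = ennreal (real N * (exp (1 / 2) * sqrt (real N)))"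
        by (simp add: ennreal_of_nat_eq_real_of_nat ennreal_mult[symmetric])
      finally have "(real N)\<^sup>2 / real M * measure P A \<le> real N * (exp (1 / 2) * sqrt (real N))"
        by (simp add: P.emeasure_eq_measure ennreal_mult[symmetric])
      moreover define s where "s = sqrt (real N)"
      ultimately have *: "(s * s)\<^sup>2 / real M * measure P A \<le> (s * s) * (exp (1 / 2) * s)" by simp
      have s: "0 < s" using N by (simp add: s_def)
      have "s ^ 3 * (s * measure P A) = real M * ((s * s)\<^sup>2 / real M * measure P A)"
        using M by (simp add: power2_eq_square power3_eq_cube)
      also have "\<dots> \<le> real M * ((s * s) * (exp (1 / 2) * s))"
        by (rule mult_left_mono[OF *]) simp
      also have "\<dots> = s ^ 3 * (real M * exp (1 / 2))" by (simp add: power3_eq_cube)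
      finally have "s * measure P A \<le> real M * exp (1 / 2)"
        using s by (simp only: mult_le_cancel_left_pos zero_less_power)
      then show ?thesis using s by (simp add: s_def[symmetric] pos_le_divide_eq mult.commute)
    qed
    have "(\<lambda>N. real M * exp (1 / 2) / sqrt (real N)) \<longlonglongrightarrow> 0"
      by (intro real_tendsto_divide_at_top[OF tendsto_const]
            filterlim_compose[OF sqrt_at_top filterlim_real_sequentially])
    then have "measure P A \<le> 0"
      by (rule LIMSEQ_le_const) (use le in \<open>auto intro!: exI[of _ 1]\<close>)
    then have "A \<in> null_sets P" using A by (simp add: null_sets_def P.emeasure_eq_measure measure_le_0_iff)
    then show ?thesis by (rule AE_I') (auto simp: A_def)
  qed
  have "AE x in P. \<forall>M>0. \<not> (\<forall>N. (\<Sum>n<N. 1 / enn2real (V (int n) x)) \<le> real M)"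
    unfolding AE_all_countable
  proof
    fix M :: nat
    show "AE x in P. 0 < M \<longrightarrow> \<not> (\<forall>N. (\<Sum>n<N. 1 / enn2real (V (int n) x)) \<le> real M)"
    proof (cases "0 < M")
      case True
      then show ?thesis using null[of M] by simp
    qed simp
  qed
  with AE_X0 show ?thesis
  proof eventually_elim
    case (elim x)
    have V: "1 / enn2real (V (int n) x) = (l ^ 4) ^ card (S (int n) x)" for n
      using elim(1) l_pos by (subst V_eq) (auto simp: X0_def power_one_over)
    show ?case
    proof
      assume s: "summable (\<lambda>n. (l ^ 4) ^ card (S (int n) x))"
      define M where "M = nat \<lceil>\<Sum>n. (l ^ 4) ^ card (S (int n) x)\<rceil> + 1"
      have "(\<Sum>n<N. (l ^ 4) ^ card (S (int n) x)) \<le> real M" for N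
      proof -
        have "(\<Sum>n<N. (l ^ 4) ^ card (S (int n) x)) \<le> (\<Sum>n. (l ^ 4) ^ card (S (int n) x))"
          using s l_pos by (intro sum_le_suminf) auto
        also have "\<dots> \<le> real M" unfolding M_def by linarith
        finally show ?thesis .
      qed
      moreover have "0 < M" by (simp add: M_def)
      ultimately show False using elim(2) unfolding V by blast
    qed
  qed
qed

text \<open>Up to a null set this is the cocycle \<open>log\<^sub>l (d(P \<circ> T\<^sup>n)/dP)\<close>.\<close>

definition c :: "int \<Rightarrow> (int \<Rightarrow> real) \<Rightarrow> int" where
  "c n x = (\<Sum>k\<in>S n x. Y (k - n) (x k) - Y k (x k))"

definition cK :: "nat \<Rightarrow> int \<Rightarrow> (int \<Rightarrow> real) \<Rightarrow> int" where
  "cK K n x = (\<Sum>k\<in>window K. Y (k - n) (x k) - Y k (x k))"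

lemma c_eq_cK:
  assumes "S n x \<subseteq> window K"
  shows "c n x = cK K n x"
  unfolding c_def cK_def by (rule sum.mono_neutral_left) (use assms in \<open>auto simp: S_def\<close>)

lemma c_eq_sum:
  assumes "S n x \<subseteq> A" "finite A"
  shows "c n x = (\<Sum>k\<in>A. Y (k - n) (x k) - Y k (x k))"
  unfolding c_def by (rule sum.mono_neutral_left) (use assms in \<open>auto simp: S_def\<close>)

lemma measurable_Y_coord [measurable]: "(\<lambda>x. Y i (x k)) \<in> measurable P (count_space UNIV)"
  by (rule measurable_compose[OF measurable_coord measurable_Y])

lemma measurable_in_S [measurable]: "Measurable.pred P (\<lambda>x. k \<in> S n x)"
  unfolding S_def by simp measurable

lemma finite_S_iff: "finite (S n x) \<longleftrightarrow> (\<exists>K. \<forall>k. k \<in> S n x \<longrightarrow> k \<in> window K)"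
  by (metis finite_subset_window finite_subset finite_window subset_iff)

lemma measurable_finite_S [measurable]: "Measurable.pred P (\<lambda>x. finite (S n x))"
  unfolding finite_S_iff by measurable

lemma measurable_cK [measurable]: "cK K n \<in> measurable P (count_space UNIV)"
  unfolding cK_def by (intro measurable_sum_int measurable_diff_int measurable_Y_coord)

lemma measurable_c [measurable]: "c n \<in> measurable P (count_space UNIV)"
proof -
  \<comment> \<open>The random index set is replaced by the least window containing it, which is a
    choice among countably many measurable sums. If \<open>S n x\<close> is infinite, the sum
    defining \<open>c\<close> is 0 by convention.\<close>
  have "c n = (\<lambda>x. if finite (S n x) then cK (LEAST K. \<forall>k. k \<in> S n x \<longrightarrow> k \<in> window K) n x else 0)"
  proof
    fix x
    show "c n x = (if finite (S n x) then cK (LEAST K. \<forall>k. k \<in> S n x \<longrightarrow> k \<in> window K) n x else 0)"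
    proof (cases "finite (S n x)")
      case True
      then have "\<exists>K. \<forall>k. k \<in> S n x \<longrightarrow> k \<in> window K" by (simp add: finite_S_iff)
      then have "\<forall>k. k \<in> S n x \<longrightarrow> k \<in> window (LEAST K. \<forall>k. k \<in> S n x \<longrightarrow> k \<in> window K)"
        by (rule LeastI_ex)
      then show ?thesis using True by (auto intro!: c_eq_cK)
    qed (simp add: c_def)
  qed
  also have "\<dots> \<in> measurable P (count_space UNIV)"
  proof (rule measurable_If[OF _ measurable_const])
    have "(\<lambda>x. LEAST K. \<forall>k. k \<in> S n x \<longrightarrow> k \<in> window K) \<in> measurable P (count_space UNIV)"
      by (rule measurable_Least) measurable
    then show "(\<lambda>x. cK (LEAST K. \<forall>k. k \<in> S n x \<longrightarrow> k \<in> window K) n x) \<in> measurable P (count_space UNIV)"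
      by (rule measurable_compose_countable[OF measurable_cK])
    show "{x \<in> space P. finite (S n x)} \<in> sets P"
      using measurable_finite_S by (rule predE)
  qed simp
  finally show ?thesis .
qed

lemma l_powi_le_v: "l powi (Y (k - n) u - Y k u) \<le> v n k u"
proof (cases "Y (k - n) u = Y k u")
  case False
  have "- 2 \<le> Y (k - n) u - Y k u" using abs_Y_le[of "k - n" u] abs_Y_le[of k u] by linarith
  then have "l powi (Y (k - n) u - Y k u) \<le> l powi (- 4)"
    using l_pos l_less_1 by (intro power_int_decreasing) auto
  also have "l powi (- 4) = (1 / l) ^ 4" by (simp add: power_int_minus power_one_over inverse_eq_divide)
  finally show ?thesis using False by (simp add: v_def)
qed (simp add: v_def)

lemma l_powi_cK_le: "l powi cK K n x \<le> VK K n x"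
  unfolding cK_def VK_def using l_pos
  by (subst prod_power_int_eq_power_int_sum[symmetric]) (auto intro!: prod_mono l_powi_le_v)

lemma eventually_c_eq_cK:
  assumes "finite (S n x)"
  shows "eventually (\<lambda>K. c n x = cK K n x) sequentially"
proof -
  obtain K0 where K0: "S n x \<subseteq> window K0" using finite_subset_window[OF assms] .
  have "c n x = cK K n x" if "K0 \<le> K" for K
    using K0 window_mono[OF that] by (intro c_eq_cK) blast
  then show ?thesis unfolding eventually_sequentially by blast
qed

lemma dens_powi: "dens k u * l powi (Y i u - Y k u) = dens i u"
  using l_pos by (auto simp: dens_def power_int_diff)

text \<open>The integrand is the density of \<open>rho i\<close> with respect to
  \<open>rho k\<close>: \<open>dens k\<close> times the power of \<open>l\<close> is
  \<open>dens i\<close>.\<close>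

lemma nn_integral_rho_powi:
  assumes "F \<in> sets borel"
  shows "(\<integral>\<^sup>+u. ennreal (l powi (Y i u - Y k u)) * indicator F u \<partial>rho k) = emeasure (rho i) F"
proof -
  have "(\<integral>\<^sup>+u. ennreal (l powi (Y i u - Y k u)) * indicator F u \<partial>rho k)
      = (\<integral>\<^sup>+u. ennreal (dens k u) * (ennreal (l powi (Y i u - Y k u)) * indicator F u) \<partial>lborel)"
    unfolding rho_def using assms by (subst nn_integral_density) auto
  also have "\<dots> = (\<integral>\<^sup>+u. ennreal (dens i u) * indicator F u \<partial>lborel)"
    using l_pos by (intro nn_integral_cong)
      (simp add: mult.assoc[symmetric] ennreal_mult[symmetric] dens_nonneg dens_powi)
  also have "\<dots> = emeasure (rho i) F" using assms by (simp add: emeasure_rho)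
  finally show ?thesis .
qed

lemma distr_shift_eq_PiM: "distr P P (\<lambda>x k. x (k - n)) = PiM UNIV (\<lambda>k. rho (k - n))"
proof -
  have "distr (PiM UNIV rho) (\<Pi>\<^sub>M k\<in>UNIV. rho (k - n)) (\<lambda>x. \<lambda>k\<in>UNIV. x (k - n)) = PiM UNIV (\<lambda>k. rho (k - n))"
    by (rule distr_PiM_reindex) (auto intro: rho.prob_space_axioms)
  moreover have "distr (PiM UNIV rho) (\<Pi>\<^sub>M k\<in>UNIV. rho (k - n)) (\<lambda>x. \<lambda>k\<in>UNIV. x (k - n)) =
     distr P P (\<lambda>x k. x (k - n))"
    unfolding P_def by (rule distr_cong) (auto intro!: sets_PiM_cong)
  ultimately show ?thesis by simp
qed

text \<open>On a cylinder over \<open>J\<close>, the truncated cocycle \<open>cK\<close> gives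
  exactly the product value as soon as the window contains \<open>J\<close>. The truncations are
  eventually equal to \<open>c\<close> almost everywhere and dominated by the integrable
  \<open>V n\<close>, so the value passes to the limit.\<close>

lemma density_eq_PiM: "density P (\<lambda>x. ennreal (l powi c n x)) = PiM UNIV (\<lambda>k. rho (k - n))"
proof -
  interpret q: product_prob_space "\<lambda>k. rho (k - n)" UNIV ..
  show ?thesis
  proof (rule q.PiM_eq)
    show "sets (density P (\<lambda>x. ennreal (l powi c n x))) = sets (Pi\<^sub>M UNIV (\<lambda>k. rho (k - n)))"
      unfolding P_def by (simp, intro sets_PiM_cong) auto
    fix J F assume J: "finite J" "J \<subseteq> UNIV" and F: "\<And>j. j \<in> J \<Longrightarrow> F j \<in> sets (rho (j - n))"
    \<comment> \<open>Extending the sides by \<open>UNIV\<close> makes the cylinder a product over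
      the whole window; the additional factors of the measure are 1.\<close>
    define F' where "F' k = (if k \<in> J then F k else UNIV)" for k
    have F': "F' k \<in> sets borel" for k using F by (simp add: F'_def)
    define C where "C = prod_emb UNIV (\<lambda>k. rho (k - n)) J (Pi\<^sub>E J F)"
    have C: "x \<in> C \<longleftrightarrow> (\<forall>k\<in>J. x k \<in> F k)" for x
      by (auto simp: C_def prod_emb_def PiE_iff extensional_def)
    have Cs: "C \<in> sets P"
      unfolding C_def P_def using J F
      by (subst sets_PiM_cong[OF refl, of _ _ "\<lambda>k. rho (k - n)"]) (auto intro!: sets_PiM_I)
    have fin: "AE x in P. finite (S n x)" using AE_X0 by eventually_elim (auto simp: X0_def)
    define u where "u K x = ennreal (l powi cK K n x) * indicator C x" for K x
    have "(\<lambda>K. \<integral>\<^sup>+x. u K x \<partial>P) \<longlonglongrightarrow> (\<integral>\<^sup>+x. ennreal (l powi c n x) * indicator C x \<partial>P)"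
    proof (rule nn_integral_dominated_convergence[where w = "V n"])
      show "u K \<in> borel_measurable P" for K unfolding u_def using Cs by measurable
      show "(\<lambda>x. ennreal (l powi c n x) * indicator C x) \<in> borel_measurable P" using Cs by measurable
      show "(\<integral>\<^sup>+x. V n x \<partial>P) < \<infinity>" using nn_integral_V_le[of n] by (auto simp: top_unique less_top[symmetric])
      show "AE x in P. u K x \<le> V n x" for K
      proof (rule AE_I2)
        fix x
        have "u K x \<le> ennreal (l powi cK K n x)" by (auto simp: u_def indicator_def)
        also have "\<dots> \<le> ennreal (VK K n x)" by (intro ennreal_leI l_powi_cK_le)
        also have "\<dots> \<le> V n x" unfolding V_def by (rule SUP_upper) simp
        finally show "u K x \<le> V n x" .
      qed
      show "AE x in P. (\<lambda>K. u K x) \<longlonglongrightarrow> ennreal (l powi c n x) * indicator C x"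
        using fin
      proof eventually_elim
        case (elim x)
        show ?case
          by (rule tendsto_eventually) (use eventually_c_eq_cK[OF elim] in \<open>eventually_elim, simp add: u_def\<close>)
      qed
    qed (measurable)
    moreover have "(\<lambda>K. \<integral>\<^sup>+x. u K x \<partial>P) \<longlonglongrightarrow> (\<Prod>j\<in>J. emeasure (rho (j - n)) (F j))"
    proof (rule tendsto_eventually)
      obtain K0 where K0: "J \<subseteq> window K0" using finite_subset_window[OF J(1)] .
      have "(\<integral>\<^sup>+x. u K x \<partial>P) = (\<Prod>j\<in>J. emeasure (rho (j - n)) (F j))" if "K0 \<le> K" for K
      proof -
        have JK: "J \<subseteq> window K" using K0 window_mono[OF that] by blast
        have "u K x = (\<Prod>k\<in>window K. ennreal (l powi (Y (k - n) (x k) - Y k (x k))) * indicator (F' k) (x k))" for x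
        proof -
          have "(\<Prod>k\<in>window K. indicator (F' k) (x k)) = (indicator C x :: ennreal)"
          proof (cases "x \<in> C")
            case True
            then show ?thesis by (intro trans[OF prod.neutral]) (auto simp: C F'_def)
          next
            case False
            then obtain k where "k \<in> J" "x k \<notin> F k" by (auto simp: C)
            then show ?thesis using False JK
              by (subst prod_zero) (auto simp: F'_def intro!: bexI[of _ k])
          qed
          then show ?thesis using l_pos unfolding u_def cK_def
            by (simp add: prod.distrib prod_power_int_eq_power_int_sum[symmetric] prod_ennreal)
        qed
        then have "(\<integral>\<^sup>+x. u K x \<partial>P) =
          (\<Prod>k\<in>window K. \<integral>\<^sup>+y. ennreal (l powi (Y (k - n) y - Y k y)) * indicator (F' k) y \<partial>rho k)"
          using F' by (simp, subst nn_integral_P_prod) auto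
        also have "\<dots> = (\<Prod>k\<in>window K. emeasure (rho (k - n)) (F' k))"
          using F' by (intro prod.cong refl nn_integral_rho_powi)
        also have "\<dots> = (\<Prod>k\<in>J. emeasure (rho (k - n)) (F k))"
          using JK rho.emeasure_space_1 by (intro prod.mono_neutral_cong_right) (auto simp: F'_def)
        finally show ?thesis .
      qed
      then show "eventually (\<lambda>K. (\<integral>\<^sup>+x. u K x \<partial>P) = (\<Prod>j\<in>J. emeasure (rho (j - n)) (F j))) sequentially"
        unfolding eventually_sequentially by blast
    qed
    ultimately have "(\<integral>\<^sup>+x. ennreal (l powi c n x) * indicator C x \<partial>P) = (\<Prod>j\<in>J. emeasure (rho (j - n)) (F j))"
      by (rule LIMSEQ_unique)
    then show "emeasure (density P (\<lambda>x. ennreal (l powi c n x))) (prod_emb UNIV (\<lambda>k. rho (k - n)) J (Pi\<^sub>E J F)) =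
       (\<Prod>j\<in>J. emeasure (rho (j - n)) (F j))"
      using Cs unfolding C_def[symmetric] by (subst emeasure_density) auto
  qed
qed

lemma distr_shift: "distr P P (\<lambda>x k. x (k - n)) = density P (\<lambda>x. ennreal (l powi c n x))"
  by (simp add: distr_shift_eq_PiM density_eq_PiM)

end

section \<open>The Maharam extension\<close>

definition shift :: "int \<Rightarrow> (int \<Rightarrow> 'a) \<Rightarrow> int \<Rightarrow> 'a" where
  "shift n x = (\<lambda>k. x (k + n))"

lemma shift_shift: "shift n (shift m x) = shift (n + m) x"
  by (simp add: shift_def add.assoc)

lemma shift_0 [simp]: "shift 0 x = x"
  by (simp add: shift_def)

definition mix :: "int set \<Rightarrow> (int \<Rightarrow> 'a) \<Rightarrow> (int \<Rightarrow> 'a) \<Rightarrow> int \<Rightarrow> 'a" where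
  "mix A x y = (\<lambda>k. if k \<in> A then y k else x k)"

context krieger_densities
begin

interpretation P: prob_space P by (rule prob_space_P)

text \<open>If \<open>Y (k - m - n)\<close> and \<open>Y (k - m)\<close> differ at
  \<open>x k\<close>, then at least one of them differs there from \<open>Y k\<close>.\<close>

lemma S_shift: "(\<lambda>k. k + m) ` S n (shift m x) \<subseteq> S (n + m) x \<union> S m x"
  by (auto simp: S_def shift_def diff_diff_eq algebra_simps)

lemma shift_in_X0: "x \<in> X0 \<Longrightarrow> shift m x \<in> X0"
  unfolding X0_def
proof safe
  fix n assume "\<forall>n. finite (S n x)"
  then have "finite ((\<lambda>k. k + m) ` S n (shift m x))"
    using finite_subset[OF S_shift] by simp
  then show "finite (S n (shift m x))"
    by (rule finite_imageD) (simp add: inj_on_def)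
qed

lemma shift_in_X0_iff [simp]: "shift m x \<in> X0 \<longleftrightarrow> x \<in> X0"
  using shift_in_X0[of x m] shift_in_X0[of "shift m x" "- m"] by (auto simp: shift_shift)

text \<open>Over a common finite index set the two sums telescope through the intermediate term
  \<open>Y (k - m) (x k)\<close>.\<close>

lemma c_add:
  assumes x: "x \<in> X0"
  shows "c (n + m) x = c m x + c n (shift m x)"
proof -
  define A where "A = S (n + m) x \<union> S m x"
  have A: "finite A" using x by (auto simp: A_def X0_def)
  have "c n (shift m x) = (\<Sum>k\<in>S n (shift m x). Y (k + m - m - n) (x (k + m)) - Y (k + m - m) (x (k + m)))"
    by (simp add: c_def shift_def)
  also have "\<dots> = (\<Sum>k\<in>(\<lambda>k. k + m) ` S n (shift m x). Y (k - m - n) (x k) - Y (k - m) (x k))"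
    by (subst sum.reindex) (auto simp: inj_on_def)
  also have "\<dots> = (\<Sum>k\<in>A. Y (k - m - n) (x k) - Y (k - m) (x k))"
  proof (rule sum.mono_neutral_left)
    show "(\<lambda>k. k + m) ` S n (shift m x) \<subseteq> A" unfolding A_def by (rule S_shift)
    show "\<forall>k\<in>A - (\<lambda>k. k + m) ` S n (shift m x). Y (k - m - n) (x k) - Y (k - m) (x k) = 0"
    proof
      fix k assume "k \<in> A - (\<lambda>k. k + m) ` S n (shift m x)"
      then have "k - m \<notin> S n (shift m x)" by (auto simp: image_iff)
      then show "Y (k - m - n) (x k) - Y (k - m) (x k) = 0" by (simp add: S_def shift_def)
    qed
  qed (rule A)
  finally have "c m x + c n (shift m x) = (\<Sum>k\<in>A. Y (k - (n + m)) (x k) - Y k (x k))"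
    using c_eq_sum[of m x A] A by (simp add: A_def sum.distrib[symmetric] algebra_simps)
  also have "\<dots> = c (n + m) x"
    using A by (intro c_eq_sum[symmetric]) (auto simp: A_def)
  finally show ?thesis by simp
qed

lemma c_0 [simp]: "c 0 x = 0"
  by (simp add: c_def S_def)

lemma abs_c_le: "\<bar>c n x\<bar> \<le> 2 * int (card (S n x))"
proof -
  have "\<bar>c n x\<bar> \<le> (\<Sum>k\<in>S n x. \<bar>Y (k - n) (x k) - Y k (x k)\<bar>)" unfolding c_def by (rule sum_abs)
  also have "\<dots> \<le> (\<Sum>k\<in>S n x. 2)"
  proof (rule sum_mono)
    fix k
    show "\<bar>Y (k - n) (x k) - Y k (x k)\<bar> \<le> 2"
      using abs_Y_le[of "k - n" "x k"] abs_Y_le[of k "x k"] by linarith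
  qed
  finally show ?thesis by simp
qed

lemma measurable_into_P:
  assumes "\<And>k. (\<lambda>z. f z k) \<in> borel_measurable N"
  shows "f \<in> measurable N P"
proof -
  have "f \<in> measurable N (PiM UNIV (\<lambda>_. borel))"
    by (rule measurable_PiM_single') (use assms in auto)
  then show ?thesis using sets_P by (simp cong: measurable_cong_sets)
qed

lemma measurable_shift [measurable]: "shift n \<in> measurable P P"
  unfolding shift_def by (rule measurable_into_P) simp

lemma measurable_mix [measurable]: "(\<lambda>(x, y). mix A x y) \<in> measurable (P \<Otimes>\<^sub>M P) P"
proof (rule measurable_into_P)
  fix k
  show "(\<lambda>z. (case z of (x, y) \<Rightarrow> mix A x y) k) \<in> borel_measurable (P \<Otimes>\<^sub>M P)"
    using measurable_compose[OF measurable_fst measurable_coord[of k]]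
      measurable_compose[OF measurable_snd measurable_coord[of k]]
    by (cases "k \<in> A") (auto simp: mix_def split_beta')
qed

text \<open>A cylinder condition on the mixed point splits into a condition on \<open>x\<close> off
  \<open>A\<close> and one on \<open>y\<close> in \<open>A\<close>, and coordinates are independent
  under \<open>P\<close>.\<close>

lemma distr_mix: "distr (P \<Otimes>\<^sub>M P) P (\<lambda>(x, y). mix A x y) = P"
proof -
  have "distr (P \<Otimes>\<^sub>M P) P (\<lambda>(x, y). mix A x y) = PiM UNIV rho"
  proof (rule prod.PiM_eq)
    show "sets (distr (P \<Otimes>\<^sub>M P) P (\<lambda>(x, y). mix A x y)) = sets (PiM UNIV rho)" by (simp add: P_def)
    fix J F assume J: "finite J" "J \<subseteq> UNIV" and F: "\<And>j. j \<in> J \<Longrightarrow> F j \<in> sets (rho j)"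
    define C where "C I = prod_emb UNIV rho I (Pi\<^sub>E I F)" for I
    have Cs: "C I \<in> sets P" if "I \<subseteq> J" for I
      unfolding C_def P_def using J F that by (intro sets_PiM_I) (auto intro: finite_subset)
    have C: "x \<in> C I \<longleftrightarrow> (\<forall>k\<in>I. x k \<in> F k)" for I x
      by (auto simp: C_def prod_emb_def PiE_iff extensional_def)
    have CP: "emeasure P (C I) = (\<Prod>j\<in>I. emeasure (rho j) (F j))" if "I \<subseteq> J" for I
      unfolding C_def P_def using J F that by (intro prod.emeasure_PiM_emb) (auto intro: finite_subset)
    have pt: "mix A x y \<in> C J \<longleftrightarrow> x \<in> C (J - A) \<and> y \<in> C (J \<inter> A)" for x y
      unfolding C mix_def by (metis DiffE DiffI IntE IntI)
    have "emeasure (distr (P \<Otimes>\<^sub>M P) P (\<lambda>(x, y). mix A x y)) (C J) =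
        emeasure (P \<Otimes>\<^sub>M P) (C (J - A) \<times> C (J \<inter> A))"
      using Cs by (subst emeasure_distr)
        (auto simp: space_pair_measure pt intro!: arg_cong[where f = "emeasure (P \<Otimes>\<^sub>M P)"])
    also have "\<dots> = emeasure P (C (J - A)) * emeasure P (C (J \<inter> A))"
      using Cs by (intro P.emeasure_pair_measure_Times) auto
    also have "\<dots> = (\<Prod>j\<in>J - A. emeasure (rho j) (F j)) * (\<Prod>j\<in>J \<inter> A. emeasure (rho j) (F j))"
      by (simp add: CP)
    also have "\<dots> = (\<Prod>j\<in>(J - A) \<union> (J \<inter> A). emeasure (rho j) (F j))"
      using J by (intro prod.union_disjoint[symmetric]) auto
    also have "(J - A) \<union> (J \<inter> A) = J" by auto
    finally show "emeasure (distr (P \<Otimes>\<^sub>M P) P (\<lambda>(x, y). mix A x y)) (prod_emb UNIV rho J (Pi\<^sub>E J F)) =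
        (\<Prod>j\<in>J. emeasure (rho j) (F j))"
      by (simp add: C_def)
  qed
  then show ?thesis by (simp add: P_def)
qed

text \<open>The Maharam extension of the shift, whose fibre is \<open>\<int>\<close> because the cocycle is integer valued.\<close>

definition M :: "((int \<Rightarrow> real) \<times> int) measure" where
  "M = density (P \<Otimes>\<^sub>M count_space UNIV) (\<lambda>(x, j). ennreal (l powi (- j)))"

definition maharam :: "(int \<Rightarrow> real) \<times> int \<Rightarrow> (int \<Rightarrow> real) \<times> int" where
  "maharam = (\<lambda>(x, j). (shift 1 x, j + c 1 x))"

text \<open>A strictly positive weight, integrable because the exponent outweighs the fibre weight
  \<open>l powi (- j)\<close>: \<open>2 * |j| - j >= |j|\<close>.\<close>

definition h :: "(int \<Rightarrow> real) \<times> int \<Rightarrow> real" where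
  "h = (\<lambda>(x, j). l ^ (2 * nat \<bar>j\<bar>))"

lemma space_M [simp]: "space M = UNIV"
  by (simp add: M_def space_pair_measure)

lemma sets_M [measurable_cong]: "sets M = sets (P \<Otimes>\<^sub>M count_space UNIV)"
  by (simp add: M_def)

lemma measurable_maharam [measurable]: "maharam \<in> measurable M M"
proof -
  have "(\<lambda>z. snd z + c 1 (fst z)) \<in> measurable (P \<Otimes>\<^sub>M count_space UNIV) (count_space UNIV)"
    by (intro measurable_add_int measurable_snd measurable_compose[OF measurable_fst measurable_c])
  then have "maharam \<in> measurable (P \<Otimes>\<^sub>M count_space UNIV) (P \<Otimes>\<^sub>M count_space UNIV)"
    unfolding maharam_def split_beta'
    by (intro measurable_Pair measurable_compose[OF measurable_fst measurable_shift])
  then show ?thesis using sets_M by (simp cong: measurable_cong_sets)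
qed

lemma nn_integral_M:
  assumes f: "f \<in> borel_measurable M"
  shows "(\<integral>\<^sup>+z. f z \<partial>M) = (\<integral>\<^sup>+x. \<integral>\<^sup>+j. ennreal (l powi (- j)) * f (x, j) \<partial>count_space UNIV \<partial>P)"
proof -
  interpret C: sigma_finite_measure "count_space (UNIV :: int set)"
    by (rule sigma_finite_measure_count_space)
  have f': "f \<in> borel_measurable (P \<Otimes>\<^sub>M count_space UNIV)"
    using f sets_M by (simp cong: measurable_cong_sets)
  have w: "(\<lambda>(x, j). ennreal (l powi (- j))) \<in> borel_measurable (P \<Otimes>\<^sub>M count_space UNIV)"
    unfolding split_beta' by (rule measurable_compose[OF measurable_snd]) simp
  have "(\<integral>\<^sup>+z. f z \<partial>M) = (\<integral>\<^sup>+z. (case z of (x, j) \<Rightarrow> ennreal (l powi (- j))) * f z \<partial>(P \<Otimes>\<^sub>M count_space UNIV))"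
    unfolding M_def by (rule nn_integral_density[OF w f'])
  also have "\<dots> = (\<integral>\<^sup>+x. \<integral>\<^sup>+j. (case (x, j) of (x, j) \<Rightarrow> ennreal (l powi (- j))) * f (x, j) \<partial>count_space UNIV \<partial>P)"
    by (rule C.nn_integral_fst[symmetric]) (rule borel_measurable_times_ennreal[OF w f'])
  finally show ?thesis by simp
qed

lemma measurable_fibre_integral:
  assumes f: "f \<in> borel_measurable M"
  shows "(\<lambda>x. \<integral>\<^sup>+j. ennreal (l powi (- j)) * f (x, j) \<partial>count_space UNIV) \<in> borel_measurable P"
proof -
  interpret C: sigma_finite_measure "count_space (UNIV :: int set)"
    by (rule sigma_finite_measure_count_space)
  have "(\<lambda>(x, j). ennreal (l powi (- j)) * f (x, j)) \<in> borel_measurable (P \<Otimes>\<^sub>M count_space UNIV)"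
    using f sets_M unfolding split_beta'
    by (intro borel_measurable_times_ennreal measurable_compose[OF measurable_snd])
       (auto cong: measurable_cong_sets)
  then show ?thesis by (rule C.borel_measurable_nn_integral)
qed

text \<open>Translating the fibre by \<open>c 1 x\<close> multiplies its weight by
  \<open>l powi c 1 x\<close>. This is the density of the image of \<open>P\<close> under
  \<open>shift (- 1)\<close>, and the base map \<open>shift 1\<close> carries that image back to
  \<open>P\<close>.\<close>

lemma distr_maharam: "distr M M maharam = M"
proof (rule measure_eqI)
  fix A assume "A \<in> sets (distr M M maharam)"
  then have A: "A \<in> sets M" by simp
  define G where "G x = (\<integral>\<^sup>+j. ennreal (l powi (- j)) * indicator A (x, j) \<partial>count_space UNIV)" for x
  have G: "G \<in> borel_measurable P"
    unfolding G_def by (rule measurable_fibre_integral) (use A in auto)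
  have sh: "(\<lambda>x :: int \<Rightarrow> real. \<lambda>k. x (k - 1)) = shift (- 1)" by (auto simp: shift_def)
  have m: "(\<lambda>z. indicator A (maharam z) :: ennreal) \<in> borel_measurable M"
    using A by (intro measurable_compose[OF measurable_maharam]) auto
  have "emeasure (distr M M maharam) A = (\<integral>\<^sup>+z. indicator A z \<partial>distr M M maharam)" using A by simp
  also have "\<dots> = (\<integral>\<^sup>+z. indicator A (maharam z) \<partial>M)"
    using A by (subst nn_integral_distr) auto
  also have "\<dots> = (\<integral>\<^sup>+x. \<integral>\<^sup>+j. ennreal (l powi (- j)) * indicator A (shift 1 x, j + c 1 x) \<partial>count_space UNIV \<partial>P)"
    by (subst nn_integral_M[OF m]) (simp add: maharam_def)
  also have "\<dots> = (\<integral>\<^sup>+x. ennreal (l powi c 1 x) * G (shift 1 x) \<partial>P)"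
  proof (rule nn_integral_cong)
    fix x
    have "(\<integral>\<^sup>+j. ennreal (l powi (- j)) * indicator A (shift 1 x, j + c 1 x) \<partial>count_space UNIV)
        = (\<integral>\<^sup>+j. ennreal (l powi (- (j + c 1 x) + c 1 x)) * indicator A (shift 1 x, j + c 1 x) \<partial>count_space UNIV)"
      by simp
    also have "\<dots> = (\<integral>\<^sup>+j. ennreal (l powi (- j + c 1 x)) * indicator A (shift 1 x, j) \<partial>count_space UNIV)"
      by (rule nn_integral_bij_count_space[where g = "\<lambda>j. j + c 1 x"
            and f = "\<lambda>j. ennreal (l powi (- j + c 1 x)) * indicator A (shift 1 x, j)"])
         (rule bij_betwI[where g = "\<lambda>j. j - c 1 x"], auto)
    also have "\<dots> = (\<integral>\<^sup>+j. ennreal (l powi c 1 x) * (ennreal (l powi (- j)) * indicator A (shift 1 x, j)) \<partial>count_space UNIV)"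
    proof (rule nn_integral_cong)
      fix j
      have "l powi (- j + c 1 x) = l powi c 1 x * l powi (- j)"
        using power_int_add[of l "- j" "c 1 x"] l_pos by simp
      then have "ennreal (l powi (- j + c 1 x)) = ennreal (l powi c 1 x) * ennreal (l powi (- j))"
        using l_pos by (simp only: ennreal_mult zero_le_power_int less_imp_le)
      then show "ennreal (l powi (- j + c 1 x)) * indicator A (shift 1 x, j)
          = ennreal (l powi c 1 x) * (ennreal (l powi (- j)) * indicator A (shift 1 x, j))"
        by (simp only: mult.assoc)
    qed
    also have "\<dots> = ennreal (l powi c 1 x) * G (shift 1 x)"
      unfolding G_def by (subst nn_integral_cmult) auto
    finally show "(\<integral>\<^sup>+j. ennreal (l powi (- j)) * indicator A (shift 1 x, j + c 1 x) \<partial>count_space UNIV)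
        = ennreal (l powi c 1 x) * G (shift 1 x)" .
  qed
  also have "\<dots> = (\<integral>\<^sup>+x. G (shift 1 x) \<partial>density P (\<lambda>x. ennreal (l powi c 1 x)))"
    using G by (subst nn_integral_density) (auto intro: measurable_compose[OF measurable_shift])
  also have "\<dots> = (\<integral>\<^sup>+x. G (shift 1 x) \<partial>distr P P (shift (- 1)))"
    by (simp only: distr_shift[of 1, symmetric] sh)
  also have "\<dots> = (\<integral>\<^sup>+x. G (shift 1 (shift (- 1) x)) \<partial>P)"
    using G by (subst nn_integral_distr) (auto intro: measurable_compose[OF measurable_shift])
  also have "\<dots> = (\<integral>\<^sup>+x. G x \<partial>P)" by (simp add: shift_shift)
  also have "\<dots> = (\<integral>\<^sup>+z. indicator A z \<partial>M)"
    unfolding G_def using A by (subst nn_integral_M) auto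
  also have "\<dots> = emeasure M A" using A by simp
  finally show "emeasure (distr M M maharam) A = emeasure M A" .
qed simp

lemma h_bounds: "0 < h z" "h z \<le> 1"
  using l_pos l_less_1 by (auto simp: h_def power_le_one split: prod.split)

lemma measurable_h [measurable]: "h \<in> borel_measurable M"
proof -
  have "h \<in> borel_measurable (P \<Otimes>\<^sub>M count_space UNIV)"
    unfolding h_def split_beta' by (rule measurable_compose[OF measurable_snd]) simp
  then show ?thesis using sets_M by (simp cong: measurable_cong_sets)
qed

lemma nn_integral_count_space_power_abs_finite:
  "(\<integral>\<^sup>+j. ennreal (l ^ nat \<bar>j\<bar>) \<partial>count_space (UNIV :: int set)) < \<infinity>"
proof -
  have fin: "(\<integral>\<^sup>+n. ennreal (l ^ n) \<partial>count_space UNIV) < \<infinity>"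
    unfolding nn_integral_count_space_nat using l_pos l_less_1
    by (subst suminf_ennreal2) (auto intro: summable_geometric)
  have "(\<integral>\<^sup>+j. ennreal (l ^ nat \<bar>j\<bar>) \<partial>count_space (UNIV :: int set))
     \<le> (\<integral>\<^sup>+j. ennreal (l ^ nat \<bar>j\<bar>) * indicator {0..} j + ennreal (l ^ nat \<bar>j\<bar>) * indicator {..0} j \<partial>count_space UNIV)"
    by (intro nn_integral_mono) (auto simp: indicator_def)
  also have "\<dots> = (\<integral>\<^sup>+j. ennreal (l ^ nat \<bar>j\<bar>) \<partial>count_space {0..}) + (\<integral>\<^sup>+j. ennreal (l ^ nat \<bar>j\<bar>) \<partial>count_space {..0})"
    by (subst nn_integral_add) (auto simp: nn_integral_count_space_indicator)
  also have "(\<integral>\<^sup>+j. ennreal (l ^ nat \<bar>j\<bar>) \<partial>count_space {0..}) = (\<integral>\<^sup>+n. ennreal (l ^ nat \<bar>int n\<bar>) \<partial>count_space UNIV)"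
    by (rule nn_integral_bij_count_space[symmetric]) (rule bij_betwI[where g = nat], auto)
  also have "(\<integral>\<^sup>+j. ennreal (l ^ nat \<bar>j\<bar>) \<partial>count_space {..0}) = (\<integral>\<^sup>+n. ennreal (l ^ nat \<bar>- int n\<bar>) \<partial>count_space UNIV)"
    by (rule nn_integral_bij_count_space[symmetric]) (rule bij_betwI[where g = "\<lambda>j. nat (- j)"], auto)
  finally show ?thesis using fin by (auto simp: less_top[symmetric] top_unique)
qed

lemma integrable_h: "integrable M h"
proof (rule integrableI_nonneg)
  have "(\<integral>\<^sup>+z. ennreal (h z) \<partial>M) = (\<integral>\<^sup>+x. \<integral>\<^sup>+j. ennreal (l powi (- j)) * ennreal (h (x, j)) \<partial>count_space UNIV \<partial>P)"
    by (rule nn_integral_M) measurable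
  also have "\<dots> \<le> (\<integral>\<^sup>+x. \<integral>\<^sup>+j. ennreal (l ^ nat \<bar>j\<bar>) \<partial>count_space (UNIV :: int set) \<partial>P)"
  proof (intro nn_integral_mono)
    fix j :: int and x :: "int \<Rightarrow> real"
    have "h (x, j) = l powi (2 * \<bar>j\<bar>)"
      by (simp add: h_def power_int_def nat_mult_distrib)
    then have "l powi (- j) * h (x, j) = l powi (2 * \<bar>j\<bar> - j)"
      using power_int_add[of l "- j" "2 * \<bar>j\<bar>"] l_pos by simp
    also have "\<dots> \<le> l powi \<bar>j\<bar>"
      using l_pos l_less_1 by (intro power_int_decreasing) auto
    finally show "ennreal (l powi (- j)) * ennreal (h (x, j)) \<le> ennreal (l ^ nat \<bar>j\<bar>)"
      using l_pos by (subst ennreal_mult[symmetric]) (auto simp: power_int_def h_def intro!: ennreal_leI)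
  qed
  also have "\<dots> < \<infinity>"
    using nn_integral_count_space_power_abs_finite by (simp add: P.emeasure_space_1[simplified])
  finally show "(\<integral>\<^sup>+z. ennreal (h z) \<partial>M) < \<infinity>" .
qed (auto intro!: AE_I2 less_imp_le h_bounds(1))

lemma funpow_maharam: "x \<in> X0 \<Longrightarrow> (maharam ^^ n) (x, j) = (shift (int n) x, j + c (int n) x)"
proof (induction n)
  case (Suc n)
  then show ?case using c_add[of x 1 "int n"] by (simp add: maharam_def shift_shift add.commute)
qed simp

text \<open>The level after \<open>n\<close> steps is at most
  \<open>|j| + 2 * card (S (int n) x)\<close> in absolute value, so up to a constant factor the
  terms dominate the series already known to diverge.\<close>

lemma AE_not_summable_h: "AE x in P. \<not> summable (\<lambda>n. h ((maharam ^^ n) (x, j)))"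
  using AE_X0 AE_not_summable
proof eventually_elim
  case (elim x)
  show ?case
  proof
    assume s: "summable (\<lambda>n. h ((maharam ^^ n) (x, j)))"
    have "l ^ (2 * nat \<bar>j\<bar>) * (l ^ 4) ^ card (S (int n) x) \<le> h ((maharam ^^ n) (x, j))" for n
    proof -
      have "l ^ (2 * nat \<bar>j\<bar>) * (l ^ 4) ^ card (S (int n) x) = l ^ (2 * nat \<bar>j\<bar> + 4 * card (S (int n) x))"
        by (simp add: power_add power_mult)
      also have "\<dots> \<le> l ^ (2 * nat \<bar>j + c (int n) x\<bar>)"
      proof (rule power_decreasing)
        show "2 * nat \<bar>j + c (int n) x\<bar> \<le> 2 * nat \<bar>j\<bar> + 4 * card (S (int n) x)"
          using abs_c_le[of "int n" x] by linarith
      qed (use l_pos l_less_1 in auto)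
      finally show ?thesis using elim by (simp add: funpow_maharam h_def)
    qed
    then have "summable (\<lambda>n. l ^ (2 * nat \<bar>j\<bar>) * (l ^ 4) ^ card (S (int n) x))"
      using s l_pos by (intro summable_comparison_test'[OF s]) (auto simp: abs_mult)
    then have "summable (\<lambda>n. (l ^ 4) ^ card (S (int n) x))"
      using l_pos by (subst (asm) summable_cmult_iff) auto
    then show False using elim by simp
  qed
qed

section \<open>Levels of the extension and approximation by window sets\<close>

interpretation PP: pair_prob_space P P ..

lemma h_nonneg [simp]: "0 \<le> h z"
  by (rule less_imp_le[OF h_bounds(1)])

text \<open>The density with respect to \<open>P\<close> of the measure \<open>h\<close> times
  \<open>M\<close> on the level \<open>j\<close>.\<close>

definition kappa :: "int \<Rightarrow> real" where
  "kappa j = l powi (- j) * l ^ (2 * nat \<bar>j\<bar>)"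

lemma kappa_pos: "0 < kappa j"
  using l_pos by (simp add: kappa_def)

lemma measurable_level [measurable]: "(\<lambda>x. (x, j)) \<in> measurable P M"
proof -
  have "(\<lambda>x. (x, j)) \<in> measurable P (P \<Otimes>\<^sub>M count_space UNIV)" by simp
  then show ?thesis using sets_M by (simp cong: measurable_cong_sets)
qed

lemma sets_level: "A \<in> sets M \<Longrightarrow> {x. (x, j) \<in> A} \<in> sets P"
  using measurable_sets[OF measurable_level[of j], of A] by (simp add: vimage_def)

lemma integrable_indicator_h: "A \<in> sets M \<Longrightarrow> integrable M (\<lambda>z. indicator A z * h z)"
  by (rule Bochner_Integration.integrable_bound[OF integrable_h]) (auto split: split_indicator)

lemma measure_level_le:
  assumes A: "A \<in> sets M"
  shows "kappa j * measure P {x. (x, j) \<in> A} \<le> (\<integral>z. indicator A z * h z \<partial>M)"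
proof -
  have h0: "0 \<le> indicator A z * h z" for z by (simp split: split_indicator)
  have "ennreal (kappa j * measure P {x. (x, j) \<in> A}) = ennreal (kappa j) * emeasure P {x. (x, j) \<in> A}"
    using kappa_pos[of j] by (simp add: P.emeasure_eq_measure ennreal_mult)
  also have "\<dots> = (\<integral>\<^sup>+x. ennreal (kappa j) * indicator {x. (x, j) \<in> A} x \<partial>P)"
    using sets_level[OF A, of j] by (simp add: nn_integral_cmult_indicator)
  also have "\<dots> \<le> (\<integral>\<^sup>+x. \<integral>\<^sup>+i. ennreal (l powi (- i)) * ennreal (indicator A (x, i) * h (x, i)) \<partial>count_space UNIV \<partial>P)"
  proof (rule nn_integral_mono)
    fix x
    have "ennreal (kappa j) * indicator {x. (x, j) \<in> A} x = ennreal (l powi (- j)) * ennreal (indicator A (x, j) * h (x, j))"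
      using l_pos by (auto simp: kappa_def h_def ennreal_mult split: split_indicator)
    also have "\<dots> \<le> (\<integral>\<^sup>+i. ennreal (l powi (- i)) * ennreal (indicator A (x, i) * h (x, i)) \<partial>count_space UNIV)"
      by (rule nn_integral_ge_point) simp
    finally show "ennreal (kappa j) * indicator {x. (x, j) \<in> A} x \<le>
      (\<integral>\<^sup>+i. ennreal (l powi (- i)) * ennreal (indicator A (x, i) * h (x, i)) \<partial>count_space UNIV)" .
  qed
  also have "\<dots> = (\<integral>\<^sup>+z. ennreal (indicator A z * h z) \<partial>M)"
    using integrable_indicator_h[OF A] by (subst nn_integral_M) auto
  also have "\<dots> = ennreal (\<integral>z. indicator A z * h z \<partial>M)"
    by (rule nn_integral_eq_integral[OF integrable_indicator_h[OF A]]) (simp add: h0)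
  finally show ?thesis
    by (subst (asm) ennreal_le_iff) (rule Bochner_Integration.integral_nonneg, rule h0)
qed

lemma measure_level_le':
  assumes A: "A \<in> sets M"
  shows "measure P {x. (x, j) \<in> A} \<le> 1 / kappa j * (\<integral>z. indicator A z * h z \<partial>M)"
  using measure_level_le[OF A, of j] kappa_pos[of j] by (simp add: field_simps)

text \<open>Only the base point is restricted to finitely many coordinates; the dependence on the
  level \<open>j\<close> is arbitrary. Measurability is stated separately.\<close>

definition window_set :: "nat \<Rightarrow> ((int \<Rightarrow> real) \<times> int) set \<Rightarrow> bool" where
  "window_set m A \<longleftrightarrow> (\<forall>x y j. (\<forall>k\<in>window m. x k = y k) \<longrightarrow> ((x, j) \<in> A \<longleftrightarrow> (y, j) \<in> A))"

lemma window_set_mono: "window_set m A \<Longrightarrow> m \<le> m' \<Longrightarrow> window_set m' A"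
  unfolding window_set_def using window_mono[of m m'] by blast

lemma window_setD: "window_set m A \<Longrightarrow> (\<And>k. k \<in> window m \<Longrightarrow> x k = y k) \<Longrightarrow> (x, j) \<in> A \<longleftrightarrow> (y, j) \<in> A"
  unfolding window_set_def by blast

text \<open>Measurable window sets form an algebra, since two windows lie in a common larger one,
  and they generate the sigma-algebra of \<open>M\<close>. The finite measure \<open>h\<close> times
  \<open>M\<close> then allows \<open>sets_approximation\<close>.\<close>

lemma window_set_approximation:
  assumes W: "W \<in> sets M" and d: "0 < d"
  shows "\<exists>A\<in>sets M. (\<exists>m. window_set m A) \<and> (\<integral>z. indicator (sym_diff W A) z * h z \<partial>M) < d"
proof -
  define G where "G = {A \<in> sets M. \<exists>m. window_set m A}"
  define N where "N = density M (\<lambda>z. ennreal (h z))"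
  have measN: "measure N A = (\<integral>z. indicator A z * h z \<partial>M)" if A: "A \<in> sets M" for A
  proof -
    have "measure N A = (\<integral>z. indicator A z \<partial>N)" using A by (simp add: N_def)
    also have "\<dots> = (\<integral>z. h z *\<^sub>R indicator A z \<partial>M)"
      unfolding N_def using A by (intro integral_density) auto
    finally show ?thesis by (simp add: mult.commute)
  qed
  have fin: "finite_measure N"
  proof
    have "emeasure N (space N) = (\<integral>\<^sup>+z. ennreal (h z) \<partial>M)"
      unfolding N_def using sets.top[of M] by (subst emeasure_density) (auto intro!: nn_integral_cong)
    also have "\<dots> = ennreal (\<integral>z. h z \<partial>M)"
      by (rule nn_integral_eq_integral[OF integrable_h]) auto
    finally show "emeasure N (space N) \<noteq> \<infinity>" by simp
  qed
  have "W \<in> sigma_sets UNIV G"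
  proof -
    define \<Sigma> where "\<Sigma> = sigma UNIV G"
    have space\<Sigma>: "space \<Sigma> = UNIV" and sets\<Sigma>: "sets \<Sigma> = sigma_sets UNIV G"
      by (auto simp: \<Sigma>_def)
    have coord: "(\<lambda>z. fst z k) \<in> borel_measurable \<Sigma>" for k
    proof (rule measurableI)
      fix E :: "real set" assume E: "E \<in> sets borel"
      have "(\<lambda>z :: (int \<Rightarrow> real) \<times> int. fst z k) -` E \<in> G"
        unfolding G_def
      proof safe
        have "(\<lambda>z. fst z k) \<in> borel_measurable (P \<Otimes>\<^sub>M count_space UNIV)"
          by (rule measurable_compose[OF measurable_fst measurable_coord])
        from measurable_sets[OF this E]
        show "(\<lambda>z :: (int \<Rightarrow> real) \<times> int. fst z k) -` E \<in> sets M"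
          by (simp add: sets_M space_pair_measure)
        obtain m where "{k} \<subseteq> window m" using finite_subset_window[of "{k}"] by auto
        then show "\<exists>m. window_set m ((\<lambda>z :: (int \<Rightarrow> real) \<times> int. fst z k) -` E)"
          by (intro exI[of _ m]) (auto simp: window_set_def)
      qed
      then show "(\<lambda>z. fst z k) -` E \<inter> space \<Sigma> \<in> sets \<Sigma>"
        by (auto simp: space\<Sigma> sets\<Sigma>)
    qed auto
    have level: "snd \<in> measurable \<Sigma> (count_space UNIV)"
    proof (rule measurableI)
      fix E :: "int set"
      have "(snd :: (int \<Rightarrow> real) \<times> int \<Rightarrow> int) -` E \<in> G"
        unfolding G_def
      proof safe
        have "(snd :: (int \<Rightarrow> real) \<times> int \<Rightarrow> int) \<in> measurable (P \<Otimes>\<^sub>M count_space UNIV) (count_space UNIV)" by simp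
        from measurable_sets[OF this, of E]
        show "(snd :: (int \<Rightarrow> real) \<times> int \<Rightarrow> int) -` E \<in> sets M"
          by (simp add: sets_M space_pair_measure)
        show "\<exists>m. window_set m ((snd :: (int \<Rightarrow> real) \<times> int \<Rightarrow> int) -` E)"
          by (auto simp: window_set_def)
      qed
      then show "snd -` E \<inter> space \<Sigma> \<in> sets \<Sigma>"
        by (auto simp: space\<Sigma> sets\<Sigma>)
    qed auto
    \<comment> \<open>The identity is measurable from the generated sigma-algebra into the product
      because every coordinate and the level are; the preimage of \<open>W\<close> is
      \<open>W\<close> itself.\<close>
    have "(\<lambda>z. (fst z, snd z)) \<in> measurable \<Sigma> (P \<Otimes>\<^sub>M count_space UNIV)"
      by (intro measurable_Pair level measurable_into_P coord)
    from measurable_sets[OF this, of W] W show ?thesis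
      by (simp add: sets_M space\<Sigma> sets\<Sigma> vimage_def)
  qed
  then have W': "W \<in> sigma_sets (space N) G" by (simp add: N_def)
  have "\<exists>A\<in>G. measure N (sym_diff W A) < d"
  proof (rule sets_approximation[OF fin _ _ _ _ W' d])
    show "space N - A \<in> G" if "A \<in> G" for A
    proof -
      have "UNIV - A \<in> sets M" using that sets.compl_sets[of A M] by (simp add: G_def)
      then show ?thesis using that by (auto simp: G_def N_def window_set_def)
    qed
    show "A \<union> B \<in> G" if A: "A \<in> G" and B: "B \<in> G" for A B
    proof -
      obtain m m' where m: "window_set m A" "window_set m' B" using A B by (auto simp: G_def)
      have "window_set (max m m') A" "window_set (max m m') B"
        using m by (auto intro: window_set_mono)
      then have "window_set (max m m') (A \<union> B)" unfolding window_set_def by blast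
      then show ?thesis using A B by (auto simp: G_def)
    qed
    show "{} \<in> G" by (auto simp: G_def window_set_def)
    show "G \<subseteq> sets N" by (auto simp: G_def N_def)
  qed
  then obtain A where A: "A \<in> G" "measure N (sym_diff W A) < d" by blast
  have "sym_diff W A \<in> sets M" using A(1) W by (auto simp: G_def)
  then show ?thesis using A measN by (auto simp: G_def intro!: bexI[of _ A])
qed

section \<open>Resampling finitely many coordinates\<close>

lemma measurable_sum_Y [measurable]: "(\<lambda>x. \<Sum>k\<in>A. Y k (x k)) \<in> measurable P (count_space UNIV)"
  by (intro measurable_sum_int measurable_Y_coord)

lemma S_mix: "S n (mix A x y) \<subseteq> S n x \<union> A"
  by (auto simp: S_def mix_def)

lemma mix_in_X0: "x \<in> X0 \<Longrightarrow> finite A \<Longrightarrow> mix A x y \<in> X0"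
  unfolding X0_def using finite_subset[OF S_mix] by blast

text \<open>The fibre coordinate absorbs the difference of the cocycles along the orbits of \<open>x\<close> and
  \<open>mix A x y\<close>, so that the two orbits of the Maharam extension become asymptotic.\<close>

lemma c_mix:
  assumes x: "x \<in> X0" and A: "finite A" and n: "\<And>k. k \<in> A \<Longrightarrow> k < n"
  shows "c n x = (\<Sum>k\<in>A. Y k (y k)) - (\<Sum>k\<in>A. Y k (x k)) + c n (mix A x y)"
proof -
  define F where "F = S n x \<union> A"
  have F: "finite F" using x A by (auto simp: F_def X0_def)
  define y' where "y' = mix A x y"
  have "c n x - c n y' = (\<Sum>k\<in>F. (Y (k - n) (x k) - Y k (x k)) - (Y (k - n) (y' k) - Y k (y' k)))"
    using F S_mix[of n A x y] by (subst (1 2) c_eq_sum[of _ _ F]) (auto simp: F_def y'_def sum_subtractf)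
  also have "\<dots> = (\<Sum>k\<in>A. (Y (k - n) (x k) - Y k (x k)) - (Y (k - n) (y' k) - Y k (y' k)))"
    by (rule sum.mono_neutral_right) (use F in \<open>auto simp: F_def y'_def mix_def\<close>)
  \<comment> \<open>For \<open>k\<close> in \<open>A\<close> the index \<open>k - n\<close> is
    negative, where \<open>Y\<close> vanishes.\<close>
  also have "\<dots> = (\<Sum>k\<in>A. Y k (y k) - Y k (x k))"
    by (rule sum.cong) (use n in \<open>auto simp: y'_def mix_def\<close>)
  finally show ?thesis by (simp add: y'_def sum_subtractf)
qed

lemma measurable_mix_level:
  "(\<lambda>z. (mix A (fst z) (snd z), j + ((\<Sum>k\<in>A. Y k (snd z k)) - (\<Sum>k\<in>A. Y k (fst z k))))) \<in> measurable (P \<Otimes>\<^sub>M P) M"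
proof -
  have 1: "(\<lambda>z. mix A (fst z) (snd z)) \<in> measurable (P \<Otimes>\<^sub>M P) P"
    using measurable_mix[of A] by (simp add: split_beta')
  have 2: "(\<lambda>z. j + ((\<Sum>k\<in>A. Y k (snd z k)) - (\<Sum>k\<in>A. Y k (fst z k)))) \<in> measurable (P \<Otimes>\<^sub>M P) (count_space UNIV)"
    by (intro measurable_add_int measurable_diff_int
        measurable_compose[OF measurable_fst measurable_sum_Y] measurable_compose[OF measurable_snd measurable_sum_Y]) simp
  from measurable_Pair[OF 1 2] show ?thesis using sets_M by (simp cong: measurable_cong_sets)
qed

lemma measure_mix:
  assumes "A \<in> sets P"
  shows "measure (P \<Otimes>\<^sub>M P) {z. mix J (fst z) (snd z) \<in> A} = measure P A"
proof -
  have "measure P A = measure (distr (P \<Otimes>\<^sub>M P) P (\<lambda>(x, y). mix J x y)) A" by (simp add: distr_mix)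
  also have "\<dots> = measure (P \<Otimes>\<^sub>M P) {z. mix J (fst z) (snd z) \<in> A}"
    using assms by (subst measure_distr) (auto simp: space_pair_measure vimage_def split_beta')
  finally show ?thesis by simp
qed

lemma measure_fst:
  assumes "A \<in> sets P"
  shows "measure (P \<Otimes>\<^sub>M P) {z. fst z \<in> A} = measure P A"
  using measure_mix[OF assms, of "{}"] by (simp add: mix_def)

lemma measure_snd:
  assumes "A \<in> sets P"
  shows "measure (P \<Otimes>\<^sub>M P) {z. snd z \<in> A} = measure P A"
  using measure_mix[OF assms, of "UNIV"] by (simp add: mix_def)

lemma abs_sum_Y_diff_le:
  fixes x y :: "int \<Rightarrow> real"
  shows "\<bar>(\<Sum>k\<in>A. Y k (y k)) - (\<Sum>k\<in>A. Y k (x k))\<bar> \<le> 2 * int (card A)"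
proof -
  have *: "\<bar>\<Sum>k\<in>A. Y k (x k)\<bar> \<le> int (card A)" for x :: "int \<Rightarrow> real"
  proof -
    have "\<bar>\<Sum>k\<in>A. Y k (x k)\<bar> \<le> (\<Sum>k\<in>A. \<bar>Y k (x k)\<bar>)" by (rule sum_abs)
    also have "\<dots> \<le> (\<Sum>k\<in>A. 1)" by (intro sum_mono abs_Y_le)
    finally show ?thesis by simp
  qed
  show ?thesis using *[of x] *[of y] by linarith
qed

lemma AE_mix:
  assumes "AE x in P. R x"
  shows "AE z in P \<Otimes>\<^sub>M P. R (mix A (fst z) (snd z))"
proof -
  have "AE x in distr (P \<Otimes>\<^sub>M P) P (\<lambda>(x, y). mix A x y). R x" unfolding distr_mix by fact
  from AE_distrD[OF measurable_mix this] show ?thesis by (simp add: split_beta')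
qed

lemma AE_fst: "AE x in P. R x \<Longrightarrow> AE z in P \<Otimes>\<^sub>M P. R (fst z)"
  using AE_mix[of R "{}"] by (simp add: mix_def)

text \<open>An instance of \<open>invariant_set_transfer\<close>: the corrected level makes the
  levels of the two orbits agree for all large \<open>n\<close>, while the resampled coordinates are
  shifted out of every fixed window.\<close>

lemma AE_invariant_mix:
  assumes W: "W \<in> sets M" "\<And>z. maharam z \<in> W \<longleftrightarrow> z \<in> W" and A: "finite A"
  shows "AE z in P \<Otimes>\<^sub>M P. (fst z, j) \<in> W \<longleftrightarrow>
    (mix A (fst z) (snd z), j + ((\<Sum>k\<in>A. Y k (snd z k)) - (\<Sum>k\<in>A. Y k (fst z k)))) \<in> W"
proof -
  define b where "b = 2 * int (card A)"
  \<comment> \<open>The correction of the level is at most \<open>b\<close> in absolute value, so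
    the law of the resampled point is controlled by finitely many levels, each costing
    \<open>1 / kappa\<close>.\<close>
  define K where "K = (\<Sum>i\<in>{- b..b}. 1 / kappa (j + i))"
  define s where "s z = (mix A (fst z) (snd z), j + ((\<Sum>k\<in>A. Y k (snd z k)) - (\<Sum>k\<in>A. Y k (fst z k))))" for z
  have s_meas: "s \<in> measurable (P \<Otimes>\<^sub>M P) M" unfolding s_def by (rule measurable_mix_level)
  have p_meas: "(\<lambda>z. (fst z, j)) \<in> measurable (P \<Otimes>\<^sub>M P) M"
    by (rule measurable_compose[OF measurable_fst measurable_level])
  have I0: "0 \<le> (\<integral>z. indicator E z * h z \<partial>M)" for E
    by (rule Bochner_Integration.integral_nonneg) (simp split: split_indicator)
  have le: "(\<Sum>i\<in>{- b..b}. measure P {x. (x, j + i) \<in> E}) \<le> K * (\<integral>z. indicator E z * h z \<partial>M)" if "E \<in> sets M" for E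
    unfolding K_def sum_distrib_right using that by (intro sum_mono measure_level_le')
  have "AE z in P \<Otimes>\<^sub>M P. (fst z, j) \<in> W \<longleftrightarrow> s z \<in> W"
  proof (rule invariant_set_transfer[OF measurable_maharam distr_maharam space_M integrable_h h_bounds W PP.prob_space_axioms p_meas s_meas])
    show "0 \<le> K" unfolding K_def using kappa_pos by (intro sum_nonneg) (auto intro: less_imp_le)
    fix E assume E: "E \<in> sets M"
    have "measure (P \<Otimes>\<^sub>M P) ((\<lambda>z. (fst z, j)) -` E \<inter> space (P \<Otimes>\<^sub>M P)) = measure P {x. (x, j) \<in> E}"
      using measure_fst[OF sets_level[OF E, of j]] by (simp add: space_pair_measure vimage_def)
    also have "\<dots> \<le> (\<Sum>i\<in>{- b..b}. measure P {x. (x, j + i) \<in> E})"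
      using member_le_sum[of 0 "{- b..b}" "\<lambda>i. measure P {x. (x, j + i) \<in> E}"] by (simp add: b_def)
    finally show "measure (P \<Otimes>\<^sub>M P) ((\<lambda>z. (fst z, j)) -` E \<inter> space (P \<Otimes>\<^sub>M P)) \<le> K * (\<integral>z. indicator E z * h z \<partial>M)"
      using le[OF E] by linarith
    have mixs: "{z. (mix A (fst z) (snd z), j + i) \<in> E} \<in> sets (P \<Otimes>\<^sub>M P)" for i
      using measurable_sets[OF measurable_mix[of A] sets_level[OF E, of "j + i"]]
      by (simp add: space_pair_measure vimage_def split_beta')
    have "s -` E \<inter> space (P \<Otimes>\<^sub>M P) \<subseteq> (\<Union>i\<in>{- b..b}. {z. (mix A (fst z) (snd z), j + i) \<in> E})"
    proof
      fix z assume z: "z \<in> s -` E \<inter> space (P \<Otimes>\<^sub>M P)"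
      have "\<bar>(\<Sum>k\<in>A. Y k (snd z k)) - (\<Sum>k\<in>A. Y k (fst z k))\<bar> \<le> b"
        unfolding b_def by (rule abs_sum_Y_diff_le)
      then show "z \<in> (\<Union>i\<in>{- b..b}. {z. (mix A (fst z) (snd z), j + i) \<in> E})"
        using z unfolding s_def
        by (intro UN_I[of "(\<Sum>k\<in>A. Y k (snd z k)) - (\<Sum>k\<in>A. Y k (fst z k))"]) (auto simp: abs_le_iff)
    qed
    then have "measure (P \<Otimes>\<^sub>M P) (s -` E \<inter> space (P \<Otimes>\<^sub>M P)) \<le>
        measure (P \<Otimes>\<^sub>M P) (\<Union>i\<in>{- b..b}. {z. (mix A (fst z) (snd z), j + i) \<in> E})"
      using mixs by (intro PP.finite_measure_mono) auto
    also have "\<dots> \<le> (\<Sum>i\<in>{- b..b}. measure (P \<Otimes>\<^sub>M P) {z. (mix A (fst z) (snd z), j + i) \<in> E})"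
      using mixs by (intro PP.finite_measure_subadditive_finite) auto
    also have "\<dots> = (\<Sum>i\<in>{- b..b}. measure P {x. (x, j + i) \<in> E})"
      using measure_mix[OF sets_level[OF E]] by (intro sum.cong) auto
    finally show "measure (P \<Otimes>\<^sub>M P) (s -` E \<inter> space (P \<Otimes>\<^sub>M P)) \<le> K * (\<integral>z. indicator E z * h z \<partial>M)"
      using le[OF E] by linarith
  next
    fix d :: real assume "0 < d"
    from window_set_approximation[OF W(1) this] obtain G m where G: "G \<in> sets M" "window_set m G"
      "(\<integral>z. indicator (sym_diff W G) z * h z \<partial>M) < d" by blast
    obtain K0 where K0: "A \<subseteq> window K0" using finite_subset_window[OF A] .
    have "AE z in P \<Otimes>\<^sub>M P. fst z \<in> X0" by (rule AE_fst[OF AE_X0])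
    then have "AE z in P \<Otimes>\<^sub>M P. \<exists>N. \<forall>n\<ge>N. h ((maharam ^^ n) (fst z, j)) = h ((maharam ^^ n) (s z)) \<and>
         ((maharam ^^ n) (fst z, j) \<in> G \<longleftrightarrow> (maharam ^^ n) (s z) \<in> G)"
    proof eventually_elim
      case (elim z)
      show ?case
      \<comment> \<open>From this time on \<open>n\<close> exceeds every element of
        \<open>A\<close>, and the window of size \<open>m\<close>, moved by \<open>n\<close>, lies
        to the right of \<open>A\<close>.\<close>
      proof (intro exI[of _ "Suc (K0 + m)"] allI impI)
        fix n assume n: "Suc (K0 + m) \<le> n"
        define y where "y = mix A (fst z) (snd z)"
        have "k < int n" if "k \<in> A" for k using K0 that n by (auto simp: window_def)
        then have 1: "(maharam ^^ n) (s z) = (shift (int n) y, j + c (int n) (fst z))"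
          unfolding s_def y_def using c_mix[OF elim A, of "int n" "snd z"]
          by (subst funpow_maharam[OF mix_in_X0[OF elim A]]) simp
        have 2: "(maharam ^^ n) (fst z, j) = (shift (int n) (fst z), j + c (int n) (fst z))"
          by (rule funpow_maharam[OF elim])
        have "k + int n \<notin> A" if "k \<in> window m" for k
          using K0 that n by (auto simp: window_def)
        then have "(shift (int n) (fst z), j + c (int n) (fst z)) \<in> G \<longleftrightarrow> (shift (int n) y, j + c (int n) (fst z)) \<in> G"
          by (intro window_setD[OF G(2)]) (simp add: shift_def y_def mix_def)
        then show "h ((maharam ^^ n) (fst z, j)) = h ((maharam ^^ n) (s z)) \<and>
         ((maharam ^^ n) (fst z, j) \<in> G \<longleftrightarrow> (maharam ^^ n) (s z) \<in> G)"
          unfolding 1 2 by (simp add: h_def)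
      qed
    qed
    then show "\<exists>A\<in>sets M. (\<integral>z. indicator (sym_diff W A) z * h z \<partial>M) < d \<and>
      (AE z in P \<Otimes>\<^sub>M P. \<exists>N. \<forall>n\<ge>N. h ((maharam ^^ n) (fst z, j)) = h ((maharam ^^ n) (s z)) \<and>
         ((maharam ^^ n) (fst z, j) \<in> A \<longleftrightarrow> (maharam ^^ n) (s z) \<in> A))"
      using G by blast
  next
    show "AE z in P \<Otimes>\<^sub>M P. \<not> summable (\<lambda>n. h ((maharam ^^ n) (fst z, j)))"
      by (rule AE_fst[OF AE_not_summable_h])
  qed
  then show ?thesis by (simp add: s_def)
qed

section \<open>Ergodicity of the Maharam extension\<close>

lemma sets_mix: "A \<in> sets P \<Longrightarrow> {z. mix J (fst z) (snd z) \<in> A} \<in> sets (P \<Otimes>\<^sub>M P)"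
  using measurable_sets[OF measurable_mix[of J], of A] by (simp add: vimage_def space_pair_measure split_beta')

lemma sets_fst: "A \<in> sets P \<Longrightarrow> {z. fst z \<in> A} \<in> sets (P \<Otimes>\<^sub>M P)"
  using sets_mix[of A "{}"] by (simp add: mix_def)

lemma sets_snd: "A \<in> sets P \<Longrightarrow> {z. snd z \<in> A} \<in> sets (P \<Otimes>\<^sub>M P)"
  using sets_mix[of A UNIV] by (simp add: mix_def)

lemma measure_PP_Times:
  "A \<in> sets P \<Longrightarrow> A' \<in> sets P \<Longrightarrow> measure (P \<Otimes>\<^sub>M P) (A \<times> A') = measure P A * measure P A'"
  by (simp add: measure_def P.emeasure_pair_measure_Times enn2real_mult)

lemma measure_P_cylinder:
  assumes J: "finite J" and X: "\<And>k. k \<in> J \<Longrightarrow> X k \<in> sets borel"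
  shows "measure P {x. \<forall>k\<in>J. x k \<in> X k} = (\<Prod>k\<in>J. measure (rho k) (X k))"
proof -
  have "emeasure P {x. \<forall>k\<in>J. x k \<in> X k} = (\<Prod>k\<in>J. emeasure (rho k) (X k))"
    using prod.emeasure_PiM_Collect[of J X] J X unfolding P_def by (simp add: space_PiM)
  also have "\<dots> = ennreal (\<Prod>k\<in>J. measure (rho k) (X k))"
    by (simp add: rho.emeasure_eq_measure prod_ennreal)
  finally show ?thesis
    by (simp add: P.emeasure_eq_measure prod_nonneg)
qed

lemma measure_rho_Y_0: "measure (rho k) {u. Y k u = 0} = 1 - (1 + l) * a k"
proof -
  have "(1 + l) * a k \<le> 1" using a_le[of k] la_le[of k] by (simp add: distrib_right)
  then show ?thesis using emeasure_rho_Y_0[of k] by (simp add: rho.emeasure_eq_measure)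
qed

lemma measure_rho_Y_1: "measure (rho k) {u. Y k u = 1} = l * a k"
  using emeasure_rho_Y_1[of k] la_le[of k] by (simp add: rho.emeasure_eq_measure)

text \<open>Weierstrass' inequality bounds the product of the factors
  \<open>1 - (1 + l) * a k\<close> below by 1 minus the sum, and \<open>1 + l <= 2\<close>.\<close>

lemma measure_P_all_Y_0_ge:
  assumes J: "finite J" and s: "(\<Sum>k\<in>J. a k) \<le> 1 / 4"
  shows "1 / 2 \<le> measure P {x. \<forall>k\<in>J. x k \<in> {u. Y k u = 0}}"
proof -
  have "1 / 2 \<le> 1 - 2 * (\<Sum>k\<in>J. a k)" using s by simp
  also have "\<dots> \<le> 1 - (\<Sum>k\<in>J. (1 + l) * a k)"
    using l_less_1 a_nonneg by (auto simp: sum_distrib_left intro!: sum_mono mult_right_mono)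
  also have "\<dots> \<le> (\<Prod>k\<in>J. 1 - (1 + l) * a k)"
  proof (rule Weierstrass_prod_ineq)
    fix k
    show "(1 + l) * a k \<in> {0..1}"
      using a_le[of k] la_le[of k] a_nonneg[of k] by (simp add: distrib_right)
  qed
  also have "\<dots> = measure P {x. \<forall>k\<in>J. x k \<in> {u. Y k u = 0}}"
    using J by (subst measure_P_cylinder) (auto simp: measure_rho_Y_0)
  finally show ?thesis .
qed

lemma measure_P_sum_Y_0_ge:
  assumes J: "finite J" and s: "(\<Sum>k\<in>J. a k) \<le> 1 / 4"
  shows "1 / 2 \<le> measure P {x. (\<Sum>k\<in>J. Y k (x k)) = 0}"
proof -
  have m: "{x. (\<Sum>k\<in>J. Y k (x k)) = 0} \<in> sets P"
    using measurable_sets[OF measurable_sum_Y[of J], of "{0}"] by (simp add: vimage_def)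
  have "measure P {x. \<forall>k\<in>J. x k \<in> {u. Y k u = 0}} \<le> measure P {x. (\<Sum>k\<in>J. Y k (x k)) = 0}"
    using m by (intro P.finite_measure_mono) auto
  with measure_P_all_Y_0_ge[OF assms] show ?thesis by linarith
qed

text \<open>The events that exactly one coordinate of the block has \<open>Y = 1\<close> and all
  others have \<open>Y = 0\<close> are disjoint, and each has probability at least
  \<open>l * a k / 2\<close>.\<close>

lemma measure_P_sum_Y_1_ge:
  assumes J: "finite J" and s: "(\<Sum>k\<in>J. a k) \<le> 1 / 4" "1 / 8 \<le> (\<Sum>k\<in>J. a k)"
  shows "l / 16 \<le> measure P {x. (\<Sum>k\<in>J. Y k (x k)) = 1}"
proof -
  define X where "X k i = (if i = k then {u. Y i u = 1} else {u. Y i u = 0})" for k i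
  define E where "E k = {x. \<forall>i\<in>J. x i \<in> X k i}" for k
  have Xs: "X k i \<in> sets borel" for k i unfolding X_def by simp
  have Es: "E k \<in> sets P" for k
  proof -
    have "{x \<in> space P. \<forall>i\<in>J. x i \<in> X k i} \<in> sets P"
      using J measurable_sets[OF measurable_coord Xs]
      by (intro sets.sets_Collect_finite_All) (auto simp: vimage_def)
    then show ?thesis by (simp add: E_def)
  qed
  have ge: "l * a k / 2 \<le> measure P (E k)" if k: "k \<in> J" for k
  proof -
    have "(\<Sum>i\<in>J - {k}. a i) \<le> 1 / 4" using s(1) a_nonneg sum_mono2[of J "J - {k}" a] J by force
    then have "1 / 2 \<le> measure P {x. \<forall>i\<in>J - {k}. x i \<in> {u. Y i u = 0}}"
      using J by (intro measure_P_all_Y_0_ge) auto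
    also have "\<dots> = (\<Prod>i\<in>J - {k}. measure (rho i) (X k i))"
      using J by (subst measure_P_cylinder) (auto simp: X_def intro!: prod.cong)
    finally have "l * a k * (1 / 2) \<le> measure (rho k) (X k k) * (\<Prod>i\<in>J - {k}. measure (rho i) (X k i))"
      using la_le[of k] by (intro mult_mono) (auto simp: X_def measure_rho_Y_1)
    also have "\<dots> = measure P (E k)"
      unfolding E_def using J Xs k by (subst measure_P_cylinder) (auto simp: prod.remove)
    finally show ?thesis by simp
  qed
  have "l / 16 \<le> l / 2 * (\<Sum>k\<in>J. a k)" using s(2) l_pos by (simp add: field_simps)
  also have "\<dots> = (\<Sum>k\<in>J. l * a k / 2)" by (simp add: sum_distrib_left)
  also have "\<dots> \<le> (\<Sum>k\<in>J. measure P (E k))" by (intro sum_mono ge)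
  also have "\<dots> = measure P (\<Union>k\<in>J. E k)"
  proof (rule P.finite_measure_finite_Union[symmetric])
    show "disjoint_family_on E J"
      unfolding disjoint_family_on_def
    proof safe
      fix k k' x assume "k \<in> J" "k' \<in> J" "k \<noteq> k'" "x \<in> E k" "x \<in> E k'"
      then have "x k \<in> X k k" "x k \<in> X k' k" by (auto simp: E_def)
      then show "x \<in> {}" using \<open>k \<noteq> k'\<close> by (auto simp: X_def)
    qed
  qed (use J Es in auto)
  also have "\<dots> \<le> measure P {x. (\<Sum>k\<in>J. Y k (x k)) = 1}"
  proof (rule P.finite_measure_mono)
    show "{x. (\<Sum>k\<in>J. Y k (x k)) = 1} \<in> sets P"
      using measurable_sets[OF measurable_sum_Y[of J], of "{1}"] by (simp add: vimage_def)
    show "(\<Union>k\<in>J. E k) \<subseteq> {x. (\<Sum>k\<in>J. Y k (x k)) = 1}"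
    proof safe
      fix k x assume k: "k \<in> J" and x: "x \<in> E k"
      have "(\<Sum>i\<in>J. Y i (x i)) = (\<Sum>i\<in>J. if i = k then 1 else 0)"
        using x by (intro sum.cong) (auto simp: E_def X_def split: if_splits)
      then show "(\<Sum>k\<in>J. Y k (x k)) = 1" using k J by simp
    qed
  qed
  finally show ?thesis .
qed

lemma sum_a_unbounded: "\<exists>n. b < (\<Sum>k<n. a (int k))"
proof -
  have "\<not> summable (\<lambda>k. 1 / (real (Suc k)))"
    using not_summable_harmonic[where 'a = real] summable_Suc_iff[of "\<lambda>k. 1 / real k"] by (simp add: field_simps inverse_eq_divide)
  then have "\<not> summable (\<lambda>k. a (int k))"
    using summable_cmult_iff[of "l ^ 5 / 8" "\<lambda>k. 1 / real (Suc k)"] l_pos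
    by (simp add: a_def add.commute)
  then show ?thesis
    using summableI_nonneg_bounded[of "\<lambda>k. a (int k)" b] a_nonneg by (meson not_le)
qed

text \<open>Coordinates beyond the window are added until the sum first reaches 1/8, which happens
  because the sum of \<open>a\<close> diverges. The last summand is at most 1/8, so the sum stays
  below 1/4 or equals it.\<close>

lemma block_exists:
  obtains J where "finite J" "J \<inter> window m = {}" "(\<Sum>k\<in>J. a k) \<le> 1 / 4" "1 / 8 \<le> (\<Sum>k\<in>J. a k)"
proof -
  define f where "f n = (\<Sum>k\<in>{int m<..int m + int n}. a k)" for n
  have f0: "f 0 = 0" by (simp add: f_def)
  have fS: "f (Suc n) = f n + a (int m + int n + 1)" for n
  proof -
    have "{int m<..int m + int (Suc n)} = insert (int m + int n + 1) {int m<..int m + int n}" by auto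
    then show ?thesis by (simp add: f_def)
  qed
  have fsum: "(\<Sum>k<Suc m + n. a (int k)) = (\<Sum>k<Suc m. a (int k)) + f n" for n
    by (induction n) (simp_all add: f0 fS add.assoc add.commute)
  obtain n where n: "1 / 8 + (\<Sum>k<Suc m. a (int k)) < (\<Sum>k<n. a (int k))"
    using sum_a_unbounded by blast
  also have "\<dots> \<le> (\<Sum>k<Suc m + n. a (int k))" using a_nonneg by (intro sum_mono2) auto
  finally have ex: "1 / 8 \<le> f n" unfolding fsum by simp
  define n0 where "n0 = (LEAST n. 1 / 8 \<le> f n)"
  have n0: "1 / 8 \<le> f n0" unfolding n0_def using ex by (rule LeastI)
  have "n0 \<noteq> 0" using n0 f0 by (intro notI) simp
  then obtain n' where n': "n0 = Suc n'" by (cases n0) auto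
  have "\<not> 1 / 8 \<le> f n'" using not_less_Least[of n' "\<lambda>n. 1 / 8 \<le> f n"] n' unfolding n0_def by simp
  then have "f n0 \<le> 1 / 4" using fS[of n'] a_le[of "int m + int n' + 1"] n' by simp
  then show thesis
    using n0 by (intro that[of "{int m<..int m + int n0}"]) (auto simp: f_def window_def)
qed

text \<open>Resampling a block of coordinates outside the window of an approximating set moves the fibre
  coordinate by one with a probability that does not depend on the quality of the approximation.\<close>

lemma AE_invariant_level:
  assumes W: "W \<in> sets M" "\<And>z. maharam z \<in> W \<longleftrightarrow> z \<in> W"
  shows "AE x in P. (x, j) \<in> W \<longleftrightarrow> (x, j + 1) \<in> W"
proof -
  define D where "D = {x. ((x, j) \<in> W) \<noteq> ((x, j + 1) \<in> W)}"
  have D_eq: "D = sym_diff {x. (x, j) \<in> W} {x. (x, j + 1) \<in> W}" by (auto simp: D_def)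
  have D: "D \<in> sets P" unfolding D_eq using sets_level[OF W(1)] by auto
  define C where "C = 1 / kappa j + 1 / kappa (j + 1)"
  have C: "0 < C" unfolding C_def using kappa_pos by (intro add_pos_pos) auto
  have main: "measure P D \<le> (C * (1 + 32 / l)) * d" if d: "0 < d" for d
  proof -
    obtain G m where G: "G \<in> sets M" "window_set m G" "(\<integral>z. indicator (sym_diff W G) z * h z \<partial>M) < d"
      using window_set_approximation[OF W(1) d] by blast
    have WG: "sym_diff W G \<in> sets M" using W G by auto
    define E where "E i = {x. (x, i) \<in> sym_diff W G}" for i
    have E: "E i \<in> sets P" for i unfolding E_def by (rule sets_level[OF WG])
    have E_le: "measure P (E i) \<le> 1 / kappa i * d" for i
    proof -
      have "measure P (E i) \<le> 1 / kappa i * (\<integral>z. indicator (sym_diff W G) z * h z \<partial>M)"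
        unfolding E_def by (rule measure_level_le'[OF WG])
      also have "\<dots> \<le> 1 / kappa i * d" using G(3) kappa_pos[of i] by (intro mult_left_mono) auto
      finally show ?thesis .
    qed
    define D' where "D' = {x. ((x, j) \<in> G) \<noteq> ((x, j + 1) \<in> G)}"
    have D'_eq: "D' = sym_diff {x. (x, j) \<in> G} {x. (x, j + 1) \<in> G}" by (auto simp: D'_def)
    have D': "D' \<in> sets P" unfolding D'_eq using sets_level[OF G(1)] by auto
    obtain J where J: "finite J" "J \<inter> window m = {}" "(\<Sum>k\<in>J. a k) \<le> 1 / 4" "1 / 8 \<le> (\<Sum>k\<in>J. a k)"
      using block_exists .
    define O0 where "O0 = {x. (\<Sum>k\<in>J. Y k (x k)) = 0}"
    define O1 where "O1 = {x. (\<Sum>k\<in>J. Y k (x k)) = 1}"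
    have O: "O0 \<in> sets P" "O1 \<in> sets P"
      using measurable_sets[OF measurable_sum_Y[of J], of "{0}"] measurable_sets[OF measurable_sum_Y[of J], of "{1}"]
      by (simp_all add: vimage_def O0_def O1_def)
    \<comment> \<open>\<open>J\<close> avoids the window that determines \<open>G\<close>, so
      resampling \<open>J\<close> does not affect \<open>D'\<close>. This makes \<open>D'\<close>
      independent of the block sum.\<close>
    have mixD': "mix J x y \<in> D' \<longleftrightarrow> x \<in> D'" for x y
    proof -
      have "(mix J x y, i) \<in> G \<longleftrightarrow> (x, i) \<in> G" for i
        by (rule window_setD[OF G(2)]) (use J(2) in \<open>auto simp: mix_def\<close>)
      then show ?thesis by (simp add: D'_def)
    qed
    have mixO0: "mix J x y \<in> O0 \<longleftrightarrow> y \<in> O0" for x y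
      unfolding O0_def by (auto simp: mix_def)
    have "measure P (D' \<inter> O0) = measure (P \<Otimes>\<^sub>M P) {z. mix J (fst z) (snd z) \<in> D' \<inter> O0}"
      using D' O by (intro measure_mix[symmetric]) auto
    also have "{z. mix J (fst z) (snd z) \<in> D' \<inter> O0} = D' \<times> O0" by (auto simp: mixD' mixO0)
    also have "measure (P \<Otimes>\<^sub>M P) (D' \<times> O0) = measure P D' * measure P O0"
      by (rule measure_PP_Times[OF D' O(1)])
    finally have ind: "measure P (D' \<inter> O0) = measure P D' * measure P O0" .
    \<comment> \<open>On \<open>R\<close> resampling raises the block sum from 0 to 1 and hence the
      level from \<open>j\<close> to \<open>j + 1\<close>. As \<open>G\<close> separates these
      levels over \<open>x\<close>, it disagrees with \<open>W\<close> at \<open>(x, j)\<close> or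
      at the resampled point on level \<open>j + 1\<close>.\<close>
    define R where "R = (D' \<inter> O0) \<times> O1"
    have R_le: "measure (P \<Otimes>\<^sub>M P) R \<le> C * d"
    proof -
      have s1: "{z. fst z \<in> E j} \<in> sets (P \<Otimes>\<^sub>M P)"
        by (rule sets_fst[OF E])
      have s2: "{z. mix J (fst z) (snd z) \<in> E (j + 1)} \<in> sets (P \<Otimes>\<^sub>M P)"
        by (rule sets_mix[OF E])
      have "AE z in P \<Otimes>\<^sub>M P. z \<in> R \<longrightarrow> z \<in> {z. fst z \<in> E j} \<union> {z. mix J (fst z) (snd z) \<in> E (j + 1)}"
        using AE_invariant_mix[OF W J(1), of j]
      proof eventually_elim
        case (elim z)
        show ?case
        proof
          assume z: "z \<in> R"
          then have 1: "(fst z, j) \<in> W \<longleftrightarrow> (mix J (fst z) (snd z), j + 1) \<in> W"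
            using elim by (auto simp: R_def O0_def O1_def)
          have 2: "(mix J (fst z) (snd z), j + 1) \<in> G \<longleftrightarrow> (fst z, j + 1) \<in> G"
            using J(2) by (intro window_setD[OF G(2)]) (auto simp: mix_def)
          have 3: "((fst z, j) \<in> G) \<noteq> ((fst z, j + 1) \<in> G)" using z by (auto simp: R_def D'_def)
          show "z \<in> {z. fst z \<in> E j} \<union> {z. mix J (fst z) (snd z) \<in> E (j + 1)}"
            using 1 2 3 unfolding E_def by blast
        qed
      qed
      then have "measure (P \<Otimes>\<^sub>M P) R \<le> measure (P \<Otimes>\<^sub>M P) ({z. fst z \<in> E j} \<union> {z. mix J (fst z) (snd z) \<in> E (j + 1)})"
        using s1 s2 by (intro PP.finite_measure_mono_AE) auto
      also have "\<dots> \<le> measure (P \<Otimes>\<^sub>M P) {z. fst z \<in> E j} + measure (P \<Otimes>\<^sub>M P) {z. mix J (fst z) (snd z) \<in> E (j + 1)}"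
        using s1 s2 by (rule measure_Un_le)
      also have "\<dots> = measure P (E j) + measure P (E (j + 1))"
        by (simp add: measure_fst[OF E] measure_mix[OF E])
      also have "\<dots> \<le> C * d" using E_le[of j] E_le[of "j + 1"] by (simp add: C_def distrib_right)
      finally show ?thesis .
    qed
    \<comment> \<open>Block sum 0 before and 1 after the resampling have probabilities at least
      \<open>1 / 2\<close> and \<open>l / 16\<close>; this is the origin of
      \<open>32 / l\<close>.\<close>
    have "measure P D' * (1 / 2) * (l / 16) \<le> measure P D' * measure P O0 * measure P O1"
      unfolding O0_def O1_def using J l_pos
      by (intro mult_mono measure_P_sum_Y_0_ge measure_P_sum_Y_1_ge) auto
    also have "\<dots> = measure (P \<Otimes>\<^sub>M P) R"
      unfolding R_def ind[symmetric] using D' O by (intro measure_PP_Times[symmetric]) auto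
    also note R_le
    finally have D'_le: "measure P D' \<le> 32 / l * (C * d)" using l_pos by (simp add: field_simps)
    have "D \<subseteq> D' \<union> (E j \<union> E (j + 1))" by (auto simp: D_def D'_def E_def)
    then have "measure P D \<le> measure P (D' \<union> (E j \<union> E (j + 1)))"
      using D' E by (intro P.finite_measure_mono) auto
    also have "\<dots> \<le> measure P D' + measure P (E j \<union> E (j + 1))"
      using D' E by (intro measure_Un_le) auto
    also have "measure P (E j \<union> E (j + 1)) \<le> measure P (E j) + measure P (E (j + 1))"
      using E by (intro measure_Un_le) auto
    also have "\<dots> \<le> C * d" using E_le[of j] E_le[of "j + 1"] by (simp add: C_def distrib_right)
    finally show ?thesis using D'_le by (simp add: algebra_simps)
  qed
  have "measure P D \<le> 0 + e" if e: "0 < e" for e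
  proof -
    define b where "b = C * (1 + 32 / l)"
    have "0 < b" unfolding b_def using C l_pos by (intro mult_pos_pos add_pos_pos) auto
    then show ?thesis using main[of "e / b"] e unfolding b_def[symmetric] by simp
  qed
  then have "measure P D \<le> 0" by (rule field_le_epsilon)
  then have "D \<in> null_sets P" using D by (simp add: null_sets_def measure_le_0_iff P.emeasure_eq_measure)
  then show ?thesis by (rule AE_I') (auto simp: D_def)
qed

lemma AE_invariant_all_levels:
  assumes W: "W \<in> sets M" "\<And>z. maharam z \<in> W \<longleftrightarrow> z \<in> W"
  shows "AE x in P. \<forall>j. (x, j) \<in> W \<longleftrightarrow> (x, 0) \<in> W"
proof -
  have "AE x in P. \<forall>j. (x, j) \<in> W \<longleftrightarrow> (x, j + 1) \<in> W"
    unfolding AE_all_countable using AE_invariant_level[OF W] by blast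
  then show ?thesis
  proof eventually_elim
    case (elim x)
    show ?case
    proof
      fix j show "(x, j) \<in> W \<longleftrightarrow> (x, 0) \<in> W"
      proof (induction j rule: int_induct[of _ 0])
        case (step1 i)
        then show ?case using elim by blast
      next
        case (step2 i)
        then show ?case using elim[rule_format, of "i - 1"] by simp
      qed simp
    qed
  qed
qed

text \<open>Kolmogorov's zero-one argument: up to null sets \<open>W\<close> is a product of
  \<open>W0\<close> with the integers, and \<open>W0\<close> is unchanged when any finite set of
  coordinates is resampled. Resampling the whole window of an approximating set makes
  \<open>W0\<close> independent of itself.\<close>

lemma ergodic_extension:
  assumes W: "W \<in> sets M" "\<And>z. maharam z \<in> W \<longleftrightarrow> z \<in> W"
  shows "(AE x in P. \<forall>j. (x, j) \<in> W) \<or> (AE x in P. \<forall>j. (x, j) \<notin> W)"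
proof -
  define W0 where "W0 = {x. (x, 0) \<in> W}"
  have W0: "W0 \<in> sets P" unfolding W0_def by (rule sets_level[OF W(1)])
  have levels: "AE x in P. \<forall>j. (x, j) \<in> W \<longleftrightarrow> x \<in> W0"
    using AE_invariant_all_levels[OF W] by (simp add: W0_def)
  have mixW0: "AE z in P \<Otimes>\<^sub>M P. fst z \<in> W0 \<longleftrightarrow> mix J (fst z) (snd z) \<in> W0" if "finite J" for J
    using AE_invariant_mix[OF W that, of 0] AE_mix[OF levels, of J]
  proof eventually_elim
    case (elim z)
    have "fst z \<in> W0 \<longleftrightarrow> (fst z, 0) \<in> W" by (simp add: W0_def)
    then show ?case using elim(1) elim(2)[rule_format] by (simp only:)
  qed
  have main: "measure P W0 * measure P (UNIV - W0) \<le> 2 / kappa 0 * d" if d: "0 < d" for d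
  proof -
    obtain G m where G: "G \<in> sets M" "window_set m G" "(\<integral>z. indicator (sym_diff W G) z * h z \<partial>M) < d"
      using window_set_approximation[OF W(1) d] by blast
    have WG: "sym_diff W G \<in> sets M" using W G by auto
    define E where "E = {x. (x, 0) \<in> sym_diff W G}"
    have E: "E \<in> sets P" unfolding E_def by (rule sets_level[OF WG])
    have E_le: "measure P E \<le> 1 / kappa 0 * d"
    proof -
      have "measure P E \<le> 1 / kappa 0 * (\<integral>z. indicator (sym_diff W G) z * h z \<partial>M)"
        unfolding E_def by (rule measure_level_le'[OF WG])
      also have "\<dots> \<le> 1 / kappa 0 * d" using G(3) kappa_pos[of 0] by (intro mult_left_mono) auto
      finally show ?thesis .
    qed
    let ?m = "mix (window m)"
    have s1: "{z. snd z \<in> E} \<in> sets (P \<Otimes>\<^sub>M P)"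
      by (rule sets_snd[OF E])
    have s2: "{z. ?m (fst z) (snd z) \<in> E} \<in> sets (P \<Otimes>\<^sub>M P)"
      by (rule sets_mix[OF E])
    \<comment> \<open>If \<open>x\<close> is in \<open>W0\<close> and \<open>y\<close> is not, the
      mixed point is in \<open>W0\<close> but agrees with \<open>y\<close> on the window, so
      \<open>G\<close> is wrong at the mixed point or at \<open>y\<close>.\<close>
    have "AE z in P \<Otimes>\<^sub>M P. z \<in> W0 \<times> (UNIV - W0) \<longrightarrow> z \<in> {z. snd z \<in> E} \<union> {z. ?m (fst z) (snd z) \<in> E}"
      using mixW0[OF finite_window, of m]
    proof eventually_elim
      case (elim z)
      show ?case
      proof
        assume z: "z \<in> W0 \<times> (UNIV - W0)"
        have "(?m (fst z) (snd z), 0) \<in> G \<longleftrightarrow> (snd z, 0) \<in> G"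
          by (intro window_setD[OF G(2)]) (auto simp: mix_def)
        then show "z \<in> {z. snd z \<in> E} \<union> {z. ?m (fst z) (snd z) \<in> E}"
          using z elim unfolding E_def W0_def by auto
      qed
    qed
    then have "measure (P \<Otimes>\<^sub>M P) (W0 \<times> (UNIV - W0)) \<le> measure (P \<Otimes>\<^sub>M P) ({z. snd z \<in> E} \<union> {z. ?m (fst z) (snd z) \<in> E})"
      using s1 s2 by (intro PP.finite_measure_mono_AE) auto
    also have "\<dots> \<le> measure (P \<Otimes>\<^sub>M P) {z. snd z \<in> E} + measure (P \<Otimes>\<^sub>M P) {z. ?m (fst z) (snd z) \<in> E}"
      using s1 s2 by (rule measure_Un_le)
    also have "\<dots> = 2 * measure P E"
      by (simp add: measure_snd[OF E] measure_mix[OF E])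
    also have "measure (P \<Otimes>\<^sub>M P) (W0 \<times> (UNIV - W0)) = measure P W0 * measure P (UNIV - W0)"
      using W0 sets.compl_sets[OF W0] by (intro measure_PP_Times) auto
    finally have "measure P W0 * measure P (UNIV - W0) \<le> 2 * measure P E" .
    also have "\<dots> \<le> 2 * (1 / kappa 0 * d)" using E_le by simp
    finally show ?thesis by simp
  qed
  have "measure P W0 * measure P (UNIV - W0) \<le> 0 + e" if e: "0 < e" for e
    using main[of "e / (2 / kappa 0)"] e kappa_pos[of 0] by simp
  then have "measure P W0 * measure P (UNIV - W0) \<le> 0" by (rule field_le_epsilon)
  moreover have "0 \<le> measure P W0 * measure P (UNIV - W0)" by simp
  ultimately have "measure P W0 = 0 \<or> measure P (UNIV - W0) = 0" by (metis antisym mult_eq_0_iff)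
  then show ?thesis
  proof
    assume "measure P W0 = 0"
    then have "W0 \<in> null_sets P" using W0 by (simp add: null_sets_def P.emeasure_eq_measure)
    from AE_not_in[OF this] levels have "AE x in P. \<forall>j. (x, j) \<notin> W" by eventually_elim auto
    then show ?thesis ..
  next
    assume "measure P (UNIV - W0) = 0"
    then have "UNIV - W0 \<in> null_sets P"
      using sets.compl_sets[OF W0] by (simp add: null_sets_def P.emeasure_eq_measure)
    from AE_not_in[OF this] levels have "AE x in P. \<forall>j. (x, j) \<in> W" by eventually_elim auto
    then show ?thesis ..
  qed
qed

end

section \<open>The type of the shift\<close>

lemma funpow_left_shift: "left_shift ^^ n = shift (int n)"
proof (induction n)
  case (Suc n)
  show ?case
  proof
    fix x :: "int \<Rightarrow> 'a"
    show "(left_shift ^^ Suc n) x = shift (int (Suc n)) x"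
      by (simp add: Suc) (simp add: left_shift_def shift_def algebra_simps)
  qed
qed (auto simp: shift_def)

lemma funpow_shift_m1: "shift (- 1) ^^ n = shift (- int n)"
proof (induction n)
  case (Suc n)
  show ?case
  proof
    fix x :: "int \<Rightarrow> 'a"
    show "(shift (- 1) ^^ Suc n) x = shift (- int (Suc n)) x"
      by (simp add: Suc shift_shift)
  qed
qed (auto simp: shift_def)

lemma inv_left_shift: "inv left_shift = shift (- 1)"
proof (rule inv_equality)
  show "shift (- 1) (left_shift x) = x" for x :: "int \<Rightarrow> 'a" by (simp add: left_shift_def shift_def)
  show "left_shift (shift (- 1) x) = x" for x :: "int \<Rightarrow> 'a" by (simp add: left_shift_def shift_def)
qed

text \<open>On the full space \<open>inv_into\<close> is the ordinary inverse, so the negative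
  powers are iterates of \<open>shift (- 1)\<close>.\<close>

lemma powers_action_left_shift:
  assumes "space N = UNIV"
  shows "powers_action N left_shift = shift"
proof
  fix n :: int
  show "powers_action N left_shift n = shift n"
    using assms by (simp add: powers_action_def funpow_left_shift inv_left_shift funpow_shift_m1)
qed

lemma ln_power_int: "0 < x \<Longrightarrow> ln (x powi n) = of_int n * ln (x :: real)"
  using ln_powr[of x "of_int n"] by (simp add: powr_real_of_int')

section \<open>Nonsingularity, ergodicity and the ratio set\<close>

context krieger_densities
begin

interpretation P: prob_space P by (rule prob_space_P)

lemma measurable_action_shift: "measurable_action P shift"
  unfolding measurable_action_def by (auto simp: shift_shift)

lemma translated_measure_shift:
  "translated_measure P shift n = density P (\<lambda>x. ennreal (l powi c n x))"
proof -
  have "shift (- n) = (\<lambda>(x :: int \<Rightarrow> real) k. x (k - n))" by (auto simp: shift_def)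
  then show ?thesis unfolding translated_measure_def by (simp only: distr_shift)
qed

lemma nonsingular_shift: "nonsingular_action P shift"
  unfolding nonsingular_action_def
proof (intro conjI allI)
  show "sigma_finite_measure P" ..
  show "measurable_action P shift" by (rule measurable_action_shift)
  fix n
  have m: "(\<lambda>x. ennreal (l powi c n x)) \<in> borel_measurable P" by measurable
  show "null_sets (translated_measure P shift n) = null_sets P"
    unfolding translated_measure_shift using l_pos
    by (auto simp: null_sets_density_iff[OF m] AE_iff_null_sets null_setsD2 intro: AE_not_in)
qed

lemma AE_RN_deriv:
  "AE x in P. ln (enn2real (RN_deriv P (translated_measure P shift n) x)) = of_int (c n x) * ln l"
proof -
  have m: "(\<lambda>x. ennreal (l powi c n x)) \<in> borel_measurable P" by measurable
  have "AE x in P. ennreal (l powi c n x) = RN_deriv P (translated_measure P shift n) x"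
    by (rule P.RN_deriv_unique[OF m]) (simp add: translated_measure_shift)
  then show ?thesis
  proof eventually_elim
    case (elim x)
    then show ?case using l_pos by (simp add: elim[symmetric] ln_power_int)
  qed
qed

lemma measurable_extension_set:
  assumes "\<And>j. {x. (x, j) \<in> W} \<in> sets P"
  shows "W \<in> sets M"
proof -
  have "W = (\<Union>j. {x. (x, j) \<in> W} \<times> {j})" by auto
  also have "\<dots> \<in> sets (P \<Otimes>\<^sub>M count_space UNIV)"
    using assms by (intro sets.countable_UN) auto
  finally show ?thesis by (simp add: sets_M)
qed

lemma sets_shift: "A \<in> sets P \<Longrightarrow> {x. shift n x \<in> A} \<in> sets P"
  using measurable_sets[OF measurable_shift[of n], of A] by (simp add: vimage_def)

lemma ergodic_shift: "ergodic_action P shift"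
  unfolding ergodic_action_def
proof (intro ballI impI)
  fix E assume E: "E \<in> sets P" and inv: "\<forall>n. emeasure P (sym_diff E (shift n ` E)) = 0"
  have img: "shift n ` E = {x. shift (- n) x \<in> E}" for n
  proof -
    have "x \<in> shift n ` E" if "shift (- n) x \<in> E" for x
      by (rule image_eqI[OF _ that]) (simp add: shift_shift)
    then show ?thesis by (auto simp: shift_shift)
  qed
  have "AE x in P. x \<in> E \<longleftrightarrow> shift n x \<in> E" for n
  proof -
    have "sym_diff E (shift (- n) ` E) \<in> null_sets P"
      using inv[rule_format, of "- n"] E sets_shift[OF E] by (auto simp: img null_sets_def)
    from AE_not_in[OF this] show ?thesis by eventually_elim (auto simp: img)
  qed
  then have AE: "AE x in P. \<forall>n. x \<in> E \<longleftrightarrow> shift n x \<in> E" by (simp add: AE_all_countable)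
  \<comment> \<open>The intersection of all translates of \<open>E\<close> differs from
    \<open>E\<close> by a null set and is invariant at every point, as
    \<open>ergodic_extension\<close> demands; it is lifted to all levels.\<close>
  define W where "W = {(x, j :: int). \<forall>n. shift n x \<in> E}"
  have "{x. (x, j) \<in> W} \<in> sets P" for j
  proof -
    have "{x. (x, j) \<in> W} = (\<Inter>n. {x. shift n x \<in> E})" by (auto simp: W_def)
    also have "\<dots> \<in> sets P" using sets_shift[OF E] by (intro sets.countable_INT) auto
    finally show ?thesis .
  qed
  then have W: "W \<in> sets M" by (rule measurable_extension_set)
  have "(\<forall>n. shift (n + 1) x \<in> E) \<longleftrightarrow> (\<forall>n. shift n x \<in> E)" for x
    by (metis diff_add_cancel)
  then have "maharam z \<in> W \<longleftrightarrow> z \<in> W" for z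
    by (cases z) (simp add: W_def maharam_def shift_shift)
  from ergodic_extension[OF W this] show "emeasure P E = 0 \<or> emeasure P (space P - E) = 0"
  proof
    assume "AE x in P. \<forall>j. (x, j) \<in> W"
    with AE have "AE x in P. x \<notin> UNIV - E" by eventually_elim (auto simp: W_def)
    then have "emeasure P {x \<in> space P. x \<in> UNIV - E} = 0" by (intro emeasure_eq_0_AE) simp
    then show ?thesis by (simp add: set_diff_eq)
  next
    assume "AE x in P. \<forall>j. (x, j) \<notin> W"
    with AE have "AE x in P. x \<notin> E" by eventually_elim (auto simp: W_def)
    then have "emeasure P {x \<in> space P. x \<in> E} = 0" by (intro emeasure_eq_0_AE) simp
    then show ?thesis by simp
  qed
qed

text \<open>If the value failed for \<open>A\<close>, almost no point of \<open>A\<close> would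
  return to \<open>A\<close> with cocycle \<open>n\<close>. By ergodicity of the extension, the set
  of points whose orbit meets \<open>A\<close> on level \<open>n\<close> is null or of full measure.
  It contains almost all of \<open>A\<close> on level \<open>n\<close>, so it is not null; full
  measure on level 0 yields the forbidden returns.\<close>

lemma essential_value_of_int: "essential_value P shift (of_int n * ln l)"
  unfolding essential_value_def
proof (intro ballI impI allI)
  fix A and e :: real assume A: "A \<in> sets P" "emeasure P A > 0" and e: "0 < e"
  let ?R = "\<lambda>g x. ln (enn2real (RN_deriv P (translated_measure P shift g) x))"
  show "\<exists>g. emeasure P {x \<in> space P. x \<in> A \<and> shift g x \<in> A \<and> \<bar>?R g x - of_int n * ln l\<bar> < e} > 0"
  proof (rule ccontr)
    assume "\<not> ?thesis"
    then have null: "emeasure P {x \<in> space P. x \<in> A \<and> shift g x \<in> A \<and> \<bar>?R g x - of_int n * ln l\<bar> < e} = 0" for g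
      by (auto simp: not_less)
    have "AE x in P. \<not> (x \<in> A \<and> shift g x \<in> A \<and> c g x = n)" for g
    proof -
      have [measurable]: "A \<in> sets P" by fact
      have "{x \<in> space P. x \<in> A \<and> shift g x \<in> A \<and> \<bar>?R g x - of_int n * ln l\<bar> < e} \<in> sets P" by measurable
      then have "{x \<in> space P. x \<in> A \<and> shift g x \<in> A \<and> \<bar>?R g x - of_int n * ln l\<bar> < e} \<in> null_sets P"
        using null[of g] by (auto simp: null_sets_def)
      from AE_not_in[OF this] AE_RN_deriv[of g] show ?thesis
        by eventually_elim (use e in auto)
    qed
    then have AE: "AE x in P. \<forall>g. \<not> (x \<in> A \<and> shift g x \<in> A \<and> c g x = n)" by (simp add: AE_all_countable)
    \<comment> \<open>Restricting to \<open>X0\<close> makes the cocycle identity available at every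
      point, hence \<open>W\<close> exactly invariant.\<close>
    define W where "W = {(x, j). x \<in> X0 \<and> (\<exists>g. shift g x \<in> A \<and> j + c g x = n)}"
    have "{x. (x, j) \<in> W} \<in> sets P" for j
    proof -
      have [measurable]: "A \<in> sets P" by fact
      have "{x \<in> space P. (\<forall>n. finite (S n x)) \<and> (\<exists>g. shift g x \<in> A \<and> c g x = n - j)} \<in> sets P"
        by measurable
      moreover have "{x. (x, j) \<in> W} = {x \<in> space P. (\<forall>n. finite (S n x)) \<and> (\<exists>g. shift g x \<in> A \<and> c g x = n - j)}"
        by (auto simp: W_def X0_def)
      ultimately show ?thesis by simp
    qed
    then have W: "W \<in> sets M" by (rule measurable_extension_set)
    have "maharam z \<in> W \<longleftrightarrow> z \<in> W" for z
    proof -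
      obtain x j where z: "z = (x, j)" by (cases z)
      have "(\<exists>g. shift (g + 1) x \<in> A \<and> j + c (g + 1) x = n) \<longleftrightarrow> (\<exists>g. shift g x \<in> A \<and> j + c g x = n)"
        by (metis diff_add_cancel)
      then show ?thesis
        by (auto simp: z W_def maharam_def shift_shift c_add add.assoc)
    qed
    from ergodic_extension[OF W this] show False
    proof
      assume "AE x in P. \<forall>j. (x, j) \<in> W"
      with AE have "AE x in P. x \<notin> A"
      proof eventually_elim
        case (elim x)
        then have "(x, 0) \<in> W" by blast
        then show ?case using elim by (auto simp: W_def)
      qed
      then have "emeasure P {x \<in> space P. x \<in> A} = 0" by (intro emeasure_eq_0_AE) simp
      then show False using A by simp
    next
      assume "AE x in P. \<forall>j. (x, j) \<notin> W"
      with AE_X0 have "AE x in P. x \<notin> A"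
      proof eventually_elim
        case (elim x)
        then have "(x, n) \<notin> W" by blast
        then show ?case using elim by (auto simp: W_def dest!: spec[of _ 0])
      qed
      then have "emeasure P {x \<in> space P. x \<in> A} = 0" by (intro emeasure_eq_0_AE) simp
      then show False using A by simp
    qed
  qed
qed

text \<open>Almost everywhere the logarithm of the derivative is an integer multiple of
  \<open>ln l\<close>, and \<open>d * |ln l|\<close> is the distance from \<open>r\<close> to the
  nearest such multiple.\<close>

lemma essential_value_imp_of_int:
  assumes "essential_value P shift r"
  shows "\<exists>n :: int. r = of_int n * ln l"
proof (rule ccontr)
  assume contra: "\<not> ?thesis"
  have ln: "ln l < 0" using l_pos l_less_1 by simp
  define q where "q = r / ln l"
  have r: "r = q * ln l" using ln by (simp add: q_def)
  have q: "q \<noteq> of_int n" for n using contra r by auto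
  define d where "d = min (q - of_int \<lfloor>q\<rfloor>) (of_int \<lfloor>q\<rfloor> + 1 - q)"
  have d: "0 < d" unfolding d_def using q[of "\<lfloor>q\<rfloor>"] by (simp add: order_less_le) linarith
  have dist: "d \<le> \<bar>of_int n - q\<bar>" for n :: int
  proof (cases "n \<le> \<lfloor>q\<rfloor>")
    case True
    then have "real_of_int n \<le> of_int \<lfloor>q\<rfloor>" by simp
    then show ?thesis unfolding d_def by linarith
  next
    case False
    then have "real_of_int \<lfloor>q\<rfloor> + 1 \<le> of_int n" by linarith
    then show ?thesis unfolding d_def by linarith
  qed
  let ?R = "\<lambda>g x. ln (enn2real (RN_deriv P (translated_measure P shift g) x))"
  have "UNIV \<in> sets P" "0 < emeasure P UNIV" using sets.top[of P] P.emeasure_space_1 by auto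
  moreover have "0 < d * \<bar>ln l\<bar>" using d ln by (intro mult_pos_pos) auto
  ultimately obtain g where g: "0 < emeasure P {x \<in> space P. x \<in> UNIV \<and> shift g x \<in> UNIV \<and> \<bar>?R g x - r\<bar> < d * \<bar>ln l\<bar>}"
    using assms unfolding essential_value_def by blast
  have "AE x in P. \<not> (x \<in> UNIV \<and> shift g x \<in> UNIV \<and> \<bar>?R g x - r\<bar> < d * \<bar>ln l\<bar>)"
    using AE_RN_deriv[of g]
  proof eventually_elim
    case (elim x)
    have "\<bar>?R g x - r\<bar> = \<bar>of_int (c g x) - q\<bar> * \<bar>ln l\<bar>"
      by (simp add: elim r left_diff_distrib[symmetric] abs_mult)
    moreover have "d * \<bar>ln l\<bar> \<le> \<bar>of_int (c g x) - q\<bar> * \<bar>ln l\<bar>"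
      by (intro mult_right_mono dist) simp
    ultimately show ?case by simp
  qed
  then have "emeasure P {x \<in> space P. x \<in> UNIV \<and> shift g x \<in> UNIV \<and> \<bar>?R g x - r\<bar> < d * \<bar>ln l\<bar>} = 0"
    by (rule emeasure_eq_0_AE)
  with g show False by simp
qed

lemma krieger_ratio_set_shift: "krieger_ratio_set P shift = {of_int n * ln l | n :: int. True}"
  unfolding krieger_ratio_set_def using essential_value_of_int essential_value_imp_of_int by blast

lemma type_III_shift: "type_III_action l P shift"
  unfolding type_III_action_def
  using l_pos l_less_1 nonsingular_shift ergodic_shift krieger_ratio_set_shift by blast

lemma prob_density_dens: "prob_density (dens k)"
proof -
  have "(\<integral>\<^sup>+u. ennreal (dens k u) \<partial>lborel) = emeasure (rho k) UNIV"
    by (simp add: emeasure_rho)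
  also have "\<dots> = 1" using rho.emeasure_space_1[of k] by simp
  finally have "(\<integral>u. dens k u \<partial>lborel) = 1"
    by (subst integral_eq_nn_integral) (auto simp: dens_nonneg)
  then show ?thesis by (simp add: prob_density_def dens_nonneg)
qed

lemma dens_neg: "k < 0 \<Longrightarrow> dens k = indicator {0<..<1}"
  by (auto simp: dens_def)

end

theorem theorem1:
  fixes l :: real
  assumes "0 < l" and "l < 1"
  shows "\<exists>f :: nat \<Rightarrow> real \<Rightarrow> real. (\<forall>n. prob_density (f n)) \<and>
    bernoulli_shift_type_III l
      (\<lambda>n :: int. density_measure (if n < 0 then indicator {0<..<1} else f (nat n)))"
proof -
  interpret krieger_densities l using assms by unfold_locales
  \<comment> \<open>For \<open>n >= 0\<close> the index \<open>int (nat n)\<close> is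
    \<open>n\<close>; for \<open>n < 0\<close> both sides are the uniform distribution because
    \<open>a n = 0\<close>.\<close>
  have "density_measure (if n < 0 then indicator {0<..<1} else dens (int (nat n))) = rho n" for n :: int
    by (simp add: density_measure_def rho_def dens_neg)
  moreover have "bernoulli_shift_type_III l rho"
    using type_III_shift unfolding bernoulli_shift_type_III_def bernoulli_space_def P_def[symmetric]
    by (simp add: powers_action_left_shift)
  ultimately have "bernoulli_shift_type_III l
      (\<lambda>n :: int. density_measure (if n < 0 then indicator {0<..<1} else dens (int (nat n))))"
    by simp
  then show ?thesis using prob_density_dens by (intro exI[of _ "\<lambda>n. dens (int n)"]) auto
qed

end
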